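(* The Markov chain $\{Z_t\}_{t\ge 0}$ on $\mathcal{X}=\{0,1\}^n\setminus\{\mathbf{0}\}$ (described in the context) has total-variation cutoff at time $\frac{3}{2}n\log n$ with window $n$. That is, with $d(\cdot)=d_n(\cdot)$ denoting its worst-case total-variation distance to stationarity, $$\lim_{\alpha\to+\infty}\liminf_{n\to+\infty} d\left(\tfrac{3}{2}n\log n-\alpha n\right)=1$$ and $$\lim_{\alpha\to+\infty}\limsup_{n\to+\infty} d\left(\tfrac{3}{2}n\log n+\alpha n\right)=0.$$
   Context: For each integer $n\ge 2$, let $\mathcal{X}=\{0,1\}^n\setminus\{\mathbf{0}\}$, and write $x(i)$ for the $i$-th coordinate of $x\in\mathcal{X}$. The Markov chain $\{Z_t\}_{t\ge0}$ on $\mathcal{X}$ evolves as follows: if the current state is $x$, choose an ordered pair $(i,j)$ of distinct coordinates in $\{1,\dots,n\}$ uniformly at random (among the $n(n-1)$ such pairs) and replace $x(j)$ by $x(j)+x(i) \pmod 2$, leaving the other coordinates unchanged. Let $P$ be its transition matrix. Its stationary distribution $\pi$ is the uniform distribution on $\mathcal{X}$, $\pi(x)=\frac{1}{2^n-1}$. For an integer $t\ge0$, $$d(t)=\max_{x\in\mathcal{X}} d_x(t),\qquad d_x(t)=\sup_{A\subset\mathcal{X}}\left(\pi(A)-P^t(x,A)\right)=\sum_{y\in\mathcal{X}}\left(P^t(x,y)-\pi(y)\right)_+ .$$ The function $d$ depends on $n$. Here $\log$ is the natural logarithm, and non-integer times are replaced by their integer parts, i.e. $d(t)$ means $d(\lfloor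 t\rfloor)$ for real $t\ge 0$. For fixed $\alpha$ the times are nonnegative for all large $n$. *)

theory Defs
  imports "HOL-Probability.Probability" "HOL-Library.Z2"
begin

text \<open>
  Vectors over the two-element field of length \<open>n\<close> are functions on the coordinates \<open>{1..n}\<close>,
  extended by \<open>0\<close> outside that range; the state space omits the zero vector.
\<close>

definition states :: "nat \<Rightarrow> (nat \<Rightarrow> bit) set" where
  "states n = {x. \<forall>i. i \<notin> {1..n} \<longrightarrow> x i = 0} - {\<lambda>_. 0}"

definition coord_pairs :: "nat \<Rightarrow> (nat \<times> nat) set" where
  "coord_pairs n = {(i, j). i \<in> {1..n} \<and> j \<in> {1..n} \<and> i \<noteq> j}"

text \<open>
  \<open>pmf (step n x) y\<close> is the entry \<open>P(x, y)\<close> of the transition matrix. The set \<open>coord_pairs n\<close> is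
  nonempty, so that \<open>pmf_of_set\<close> is meaningful, exactly if \<open>n \<ge> 2\<close>.
\<close>

definition step :: "nat \<Rightarrow> (nat \<Rightarrow> bit) \<Rightarrow> (nat \<Rightarrow> bit) pmf" where
  "step n x = map_pmf (\<lambda>(i, j). x(j := x j + x i)) (pmf_of_set (coord_pairs n))"

text \<open>\<open>law n t x\<close> is the law of the chain at time \<open>t\<close> when started at \<open>x\<close>, that is, \<open>P^t(x, _)\<close>.\<close>

primrec law :: "nat \<Rightarrow> nat \<Rightarrow> (nat \<Rightarrow> bit) \<Rightarrow> (nat \<Rightarrow> bit) pmf" where
  "law n 0 x = return_pmf x"
| "law n (Suc t) x = bind_pmf (law n t x) (step n)"

definition stationary :: "nat \<Rightarrow> (nat \<Rightarrow> bit) pmf" where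
  "stationary n = pmf_of_set (states n)"

definition dist_from :: "nat \<Rightarrow> nat \<Rightarrow> (nat \<Rightarrow> bit) \<Rightarrow> real" where
  "dist_from n t x =
     (SUP A \<in> Pow (states n). measure_pmf.prob (stationary n) A - measure_pmf.prob (law n t x) A)"

definition worst_dist :: "nat \<Rightarrow> nat \<Rightarrow> real" where
  "worst_dist n t = Max (dist_from n t ` states n)"

text \<open>
  Extension to real times by integer parts. As \<open>nat\<close> maps negative integers to \<open>0\<close>, negative
  times are read as time \<open>0\<close>.
\<close>

definition worst_dist_real :: "nat \<Rightarrow> real \<Rightarrow> real" where
  "worst_dist_real n s = worst_dist n (nat \<lfloor>s\<rfloor>)"

end

theory Submission
  imports Defs "HOL-Real_Asymp.Real_Asymp"
begin

text \<open>
  States are identified with nonempty subsets of \<open>{1..n}\<close>.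

  Lower bound: from a single \<open>1\<close> the mean weight grows at most by the factor \<open>1 + 1 / n\<close> per step, so
  at time \<open>n ln n - \<alpha> n / 2\<close> the weight is still at most \<open>n / 4\<close>. From then on the bias
  \<open>n - 2 \<cdot> weight\<close> decays at most at rate \<open>1 / n\<close> up to fluctuations of order \<open>sqrt n\<close>, and another
  \<open>n ln n / 2 - \<alpha> n / 2\<close> steps leave it far above \<open>sqrt n\<close>.

  Upper bound: after \<open>n ln n + O(n)\<close> steps the chain from \<open>X\<close> is balanced on \<open>X\<close> and on its complement.
  By symmetry its law restricted to this event has density at most \<open>exp (c n)\<close> with respect to the
  uniform distribution, with \<open>c\<close> as small as desired. The Fourier coefficients of the law evolve under
  the same chain. A bounded density has small Fourier weight on each low level; the high levels
  become exponentially small within \<open>n\<close> steps, since a coefficient at level \<open>h\<close> relaxes at rate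
  \<open>h / n\<close> towards terms damped by the small bias. The low levels are compared to the weight chain, for
  which an explicit supersolution gives the contraction \<open>exp (- k t / n)\<close> at level \<open>k\<close>; as there are
  about \<open>n ^ k\<close> coefficients, \<open>t = n ln n / 2 + O(n)\<close> further steps suffice.
\<close>

text \<open>A direct L2 estimate from the starting point is too weak: a singleton stays put in each
  step with probability 1 - 1 / n, and against the factor 2 ^ n in the squared L2 distance this
  would take order n ^ 2 steps. So the law is cut off at the unbalanced sets, the lost mass is paid
  for in total variation, and L2 methods see only the bounded remainder, a sub-probability. Every
  move is an involution, so \<open>avg\<close> is self-adjoint. This is why n ln n / 2 steps suffice
  for the low levels: a squared norm after t steps is a pairing across 2 t steps, to which the n
  singletons contribute about exp (- 2 t / n) each. The split into low and high levels is forced by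
  the level inequality. It has an additive error exponentially small in n, which is negligible only
  on levels up to a small multiple of n. The burn-in leaves an error of order sqrt e, where e is a
  weight fraction. It shrinks neither with n nor with \<alpha>, so e is fixed by the target accuracy
  before \<alpha> grows.\<close>

declare One_nat_def [simp del]

section \<open>The chain as an averaging operator on sets\<close>

definition flip :: "'a \<Rightarrow> 'a set \<Rightarrow> 'a set" where
  "flip j S = (if j \<in> S then S - {j} else insert j S)"

definition toggle :: "'a \<Rightarrow> 'a \<Rightarrow> 'a set \<Rightarrow> 'a set" where
  "toggle i j S = (if i \<in> S then flip j S else S)"

text \<open>The transition operator acts on functions of sets rather than on measures; by
  self-adjointness the same operator also moves densities.\<close>

definition avg :: "nat \<Rightarrow> (nat set \<Rightarrow> real) \<Rightarrow> nat set \<Rightarrow> real" where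
  "avg n F S = (\<Sum>(i,j)\<in>coord_pairs n. F (toggle i j S)) / (real n * (real n - 1))"

lemma flip_flip [simp]: "flip j (flip j S) = S"
  by (auto simp: flip_def)

lemma flip_Pow: "j \<in> A \<Longrightarrow> S \<in> Pow A \<Longrightarrow> flip j S \<in> Pow A"
  by (auto simp: flip_def)

lemma mem_flip: "i \<noteq> j \<Longrightarrow> i \<in> flip j S \<longleftrightarrow> i \<in> S"
  by (auto simp: flip_def)

lemma bij_betw_flip: "j \<in> A \<Longrightarrow> bij_betw (flip j) (Pow A) (Pow A)"
  by (rule bij_betwI[of _ _ _ "flip j"]) (auto simp: flip_def split: if_splits)

lemma toggle_toggle: "i \<noteq> j \<Longrightarrow> toggle i j (toggle i j S) = S"
  by (auto simp: toggle_def mem_flip)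

lemma toggle_Pow: "j \<in> A \<Longrightarrow> S \<in> Pow A \<Longrightarrow> toggle i j S \<in> Pow A"
  using flip_Pow[of j A S] by (auto simp: toggle_def)

lemma toggle_nonempty: "i \<noteq> j \<Longrightarrow> S \<noteq> {} \<Longrightarrow> toggle i j S \<noteq> {}"
  by (auto simp: toggle_def flip_def)

lemma bij_betw_toggle: "i \<noteq> j \<Longrightarrow> j \<in> A \<Longrightarrow> bij_betw (toggle i j) (Pow A) (Pow A)"
proof (rule bij_betwI[of _ _ _ "toggle i j"])
  assume "i \<noteq> j" "j \<in> A"
  show "toggle i j \<in> Pow A \<rightarrow> Pow A" "toggle i j \<in> Pow A \<rightarrow> Pow A"
    using toggle_Pow[OF \<open>j \<in> A\<close>] by auto
qed (auto simp: toggle_toggle)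

lemma finite_coord_pairs [simp]: "finite (coord_pairs n)"
  by (rule finite_subset[of _ "{1..n} \<times> {1..n}"]) (auto simp: coord_pairs_def)

lemma coord_pairs_Sigma: "coord_pairs n = (SIGMA i:{1..n}. {1..n} - {i})"
  by (auto simp: coord_pairs_def)

lemma card_coord_pairs: "real (card (coord_pairs n)) = real n * (real n - 1)"
  by (cases "n = 0") (simp_all add: coord_pairs_Sigma card_SigmaI of_nat_diff)

lemma avg_cong:
  assumes "\<And>i j. (i, j) \<in> coord_pairs n \<Longrightarrow> F (toggle i j S) = G (toggle i j S)"
  shows "avg n F S = avg n G S"
  unfolding avg_def using assms by (intro arg_cong2[of _ _ _ _ "(/)"] sum.cong) auto

lemma avg_mono_gen:
  assumes "\<And>i j. (i, j) \<in> coord_pairs n \<Longrightarrow> F (toggle i j S) \<le> G (toggle i j S)"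
  shows "avg n F S \<le> avg n G S"
proof -
  have "real n * (real n - 1) \<ge> 0" using card_coord_pairs[of n, symmetric] by linarith
  thus ?thesis unfolding avg_def using assms by (intro divide_right_mono sum_mono) auto
qed

lemma avg_add: "avg n (\<lambda>S. F S + G S) S = avg n F S + avg n G S"
  by (simp add: avg_def sum.distrib case_prod_unfold add_divide_distrib)

lemma avg_cmult: "avg n (\<lambda>S. c * F S) S = c * avg n F S"
  by (simp add: avg_def sum_distrib_left case_prod_unfold)

lemma avg_const: "n \<ge> 2 \<Longrightarrow> avg n (\<lambda>S. c) S = c"
  by (simp add: avg_def card_coord_pairs)

text \<open>Group the pairs by the toggled coordinate \<open>j\<close>: if \<open>j\<close> lies in
  \<open>S\<close> there are \<open>card S - 1\<close> partners \<open>i\<close> that trigger the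
  toggle, otherwise there are \<open>card S\<close>. Nothing moves if \<open>i\<close> lies outside
  \<open>S\<close>.\<close>

lemma avg_formula:
  assumes S: "S \<subseteq> {1..n}" and n: "n \<ge> 2"
  shows "avg n F S = (1 - real (card S) / real n) * F S +
    ((real (card S) - 1) * (\<Sum>j\<in>S. F (S - {j})) +
     real (card S) * (\<Sum>j\<in>{1..n}-S. F (insert j S))) / (real n * (real n - 1))"
proof -
  have fS: "finite S" using S finite_subset by blast
  have *: "(\<Sum>(i,j)\<in>coord_pairs n. F (toggle i j S)) =
     (\<Sum>i\<in>{1..n}. \<Sum>j\<in>{1..n}-{i}. F (toggle i j S))"
    by (simp add: coord_pairs_Sigma sum.Sigma)
  also have "\<dots> = (\<Sum>i\<in>{1..n}-S. \<Sum>j\<in>{1..n}-{i}. F (toggle i j S)) + (\<Sum>i\<in>S. \<Sum>j\<in>{1..n}-{i}. F (toggle i j S))"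
    by (rule sum.subset_diff[OF S]) simp
  also have "(\<Sum>i\<in>{1..n}-S. \<Sum>j\<in>{1..n}-{i}. F (toggle i j S)) = (\<Sum>i\<in>{1..n}-S. (real n - 1) * F S)"
    using n by (intro sum.cong) (auto simp: toggle_def of_nat_diff)
  also have "\<dots> = (real n - card S) * (real n - 1) * F S"
    using S fS card_mono[of "{1..n}" S] by (simp add: card_Diff_subset of_nat_diff)
  also have "(\<Sum>i\<in>S. \<Sum>j\<in>{1..n}-{i}. F (toggle i j S)) =
     (\<Sum>i\<in>S. (\<Sum>j\<in>S-{i}. F (S - {j})) + (\<Sum>j\<in>{1..n}-S. F (insert j S)))"
  proof (rule sum.cong[OF refl])
    fix i assume i: "i \<in> S"
    have "{1..n}-{i} = (S-{i}) \<union> ({1..n}-S)" using S i by auto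
    hence "(\<Sum>j\<in>{1..n}-{i}. F (toggle i j S)) = (\<Sum>j\<in>S-{i}. F (toggle i j S)) + (\<Sum>j\<in>{1..n}-S. F (toggle i j S))"
      using fS by (simp add: sum.union_disjoint Int_Diff)
        (subst sum.union_disjoint, auto)
    thus "(\<Sum>j\<in>{1..n}-{i}. F (toggle i j S)) = (\<Sum>j\<in>S-{i}. F (S - {j})) + (\<Sum>j\<in>{1..n}-S. F (insert j S))"
      using i by (simp add: toggle_def flip_def)
  qed
  also have "\<dots> = (\<Sum>i\<in>S. (\<Sum>j\<in>S. F (S - {j})) - F (S - {i})) + card S * (\<Sum>j\<in>{1..n}-S. F (insert j S))"
    using fS by (simp add: sum.distrib sum_diff1)
  also have "(\<Sum>i\<in>S. (\<Sum>j\<in>S. F (S - {j})) - F (S - {i})) = (real (card S) - 1) * (\<Sum>j\<in>S. F (S - {j}))"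
    by (simp add: sum_subtractf algebra_simps)
  finally have "(\<Sum>(i,j)\<in>coord_pairs n. F (toggle i j S)) = (real n - card S) * (real n - 1) * F S +
     ((real (card S) - 1) * (\<Sum>j\<in>S. F (S - {j})) + card S * (\<Sum>j\<in>{1..n}-S. F (insert j S)))"
    by simp
  moreover have "(real n - card S) * (real n - 1) * F S / (real n * (real n - 1)) = (1 - real (card S) / real n) * F S"
    using n by (simp add: field_simps)
  ultimately show ?thesis by (simp add: avg_def add_divide_distrib)
qed

lemma avg_empty: "n \<ge> 2 \<Longrightarrow> avg n F {} = F {}"
  by (simp add: avg_formula)

text \<open>Each \<open>toggle i j\<close> is an involution permuting the power set, so it can be
  moved from one factor to the other.\<close>

lemma avg_selfadjoint:
  "(\<Sum>S\<in>Pow {1..n}. F S * avg n G S) = (\<Sum>S\<in>Pow {1..n}. avg n F S * G S)"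
proof -
  have "(\<Sum>S\<in>Pow {1..n}. F S * G (toggle i j S)) = (\<Sum>S\<in>Pow {1..n}. F (toggle i j S) * G S)"
    if "(i, j) \<in> coord_pairs n" for i j
  proof -
    have ij: "i \<noteq> j" "j \<in> {1..n}" using that by (auto simp: coord_pairs_def)
    show ?thesis
      using sum.reindex_bij_betw[OF bij_betw_toggle[OF ij], of "\<lambda>S. F S * G (toggle i j S)"]
      by (simp add: toggle_toggle[OF ij(1)])
  qed
  hence "(\<Sum>(i,j)\<in>coord_pairs n. \<Sum>S\<in>Pow {1..n}. F S * G (toggle i j S)) =
    (\<Sum>(i,j)\<in>coord_pairs n. \<Sum>S\<in>Pow {1..n}. F (toggle i j S) * G S)"
    by (intro sum.cong) auto
  moreover have "(\<Sum>S\<in>Pow {1..n}. F S * avg n G S) =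
    (\<Sum>(i,j)\<in>coord_pairs n. \<Sum>S\<in>Pow {1..n}. F S * G (toggle i j S)) / (real n * (real n - 1))"
    unfolding avg_def case_prod_unfold
    by (subst sum.swap) (simp add: sum_distrib_left sum_divide_distrib)
  moreover have "(\<Sum>S\<in>Pow {1..n}. avg n F S * G S) =
    (\<Sum>(i,j)\<in>coord_pairs n. \<Sum>S\<in>Pow {1..n}. F (toggle i j S) * G S) / (real n * (real n - 1))"
    unfolding avg_def case_prod_unfold
    by (subst sum.swap) (simp add: sum_distrib_right sum_divide_distrib)
  ultimately show ?thesis by simp
qed

lemma avg_funpow_selfadjoint:
  "(\<Sum>S\<in>Pow {1..n}. F S * (avg n ^^ t) G S) = (\<Sum>S\<in>Pow {1..n}. (avg n ^^ t) F S * G S)"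
proof (induction t arbitrary: F G)
  case (Suc t)
  have "(\<Sum>S\<in>Pow {1..n}. F S * (avg n ^^ Suc t) G S) = (\<Sum>S\<in>Pow {1..n}. F S * avg n ((avg n ^^ t) G) S)"
    by simp
  also have "\<dots> = (\<Sum>S\<in>Pow {1..n}. (avg n ^^ t) (avg n F) S * G S)"
    unfolding avg_selfadjoint by (rule Suc)
  finally show ?case by (simp add: funpow_swap1)
qed simp

lemma sum_avg: "n \<ge> 2 \<Longrightarrow> (\<Sum>S\<in>Pow {1..n}. avg n F S) = (\<Sum>S\<in>Pow {1..n}. F S)"
  using avg_selfadjoint[where F = "\<lambda>_. 1" and G = F and n = n] by (simp add: avg_const)

lemma sum_avg_funpow: "n \<ge> 2 \<Longrightarrow> (\<Sum>S\<in>Pow {1..n}. (avg n ^^ t) F S) = (\<Sum>S\<in>Pow {1..n}. F S)"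
  by (induction t) (simp_all add: sum_avg)

text \<open>Jensen's inequality for the uniform choice of the pair, obtained from
  Cauchy-Schwarz.\<close>

lemma avg_power2_le: "n \<ge> 2 \<Longrightarrow> (avg n F S)\<^sup>2 \<le> avg n (\<lambda>S. (F S)\<^sup>2) S"
proof -
  assume n: "n \<ge> 2"
  have pos: "real n * (real n - 1) > 0" using n by simp
  have "(\<Sum>p\<in>coord_pairs n. 1 * F (toggle (fst p) (snd p) S))\<^sup>2 \<le>
     (\<Sum>p\<in>coord_pairs n. 1\<^sup>2) * (\<Sum>p\<in>coord_pairs n. (F (toggle (fst p) (snd p) S))\<^sup>2)"
    by (rule Cauchy_Schwarz_ineq_sum)
  hence "(\<Sum>p\<in>coord_pairs n. F (toggle (fst p) (snd p) S))\<^sup>2 \<le>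
     (real n * (real n - 1)) * (\<Sum>p\<in>coord_pairs n. (F (toggle (fst p) (snd p) S))\<^sup>2)"
    by (simp add: card_coord_pairs)
  thus ?thesis using pos n
    by (simp add: avg_def case_prod_unfold power_divide divide_simps power2_eq_square mult_ac)
qed

lemma avg_l2_contraction:
  assumes "n \<ge> 2" shows "(\<Sum>S\<in>Pow {1..n}. (avg n F S)\<^sup>2) \<le> (\<Sum>S\<in>Pow {1..n}. (F S)\<^sup>2)"
proof -
  have "(\<Sum>S\<in>Pow {1..n}. (avg n F S)\<^sup>2) \<le> (\<Sum>S\<in>Pow {1..n}. avg n (\<lambda>S. (F S)\<^sup>2) S)"
    using assms by (intro sum_mono avg_power2_le)
  thus ?thesis by (simp add: sum_avg[OF assms])
qed

lemma avg_funpow_l2_contraction: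
  assumes "n \<ge> 2" shows "(\<Sum>S\<in>Pow {1..n}. ((avg n ^^ t) F S)\<^sup>2) \<le> (\<Sum>S\<in>Pow {1..n}. (F S)\<^sup>2)"
  by (induction t) (auto intro: order_trans[OF avg_l2_contraction[OF assms]])

text \<open>The chain never leaves the family of nonempty sets, so comparisons are only needed there.\<close>

lemma avg_mono:
  assumes "\<And>S. S \<in> Pow {1..n} - {{}} \<Longrightarrow> F S \<le> G S" "S \<in> Pow {1..n} - {{}}"
  shows "avg n F S \<le> avg n G S"
proof (rule avg_mono_gen)
  fix i j assume "(i, j) \<in> coord_pairs n"
  hence "i \<noteq> j" "j \<in> {1..n}" by (auto simp: coord_pairs_def)
  thus "F (toggle i j S) \<le> G (toggle i j S)"
    using assms(2) toggle_Pow[of j "{1..n}" S i] toggle_nonempty[of i j S] by (intro assms(1)) auto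
qed

lemma avg_funpow_mono:
  assumes "\<And>S. S \<in> Pow {1..n} - {{}} \<Longrightarrow> F S \<le> G S" "S \<in> Pow {1..n} - {{}}"
  shows "(avg n ^^ t) F S \<le> (avg n ^^ t) G S"
  using assms(2)
proof (induction t arbitrary: S)
  case (Suc t)
  show ?case unfolding funpow.simps o_apply by (rule avg_mono) (use Suc in auto)
qed (use assms in auto)

lemma avg_funpow_add: "(avg n ^^ t) (\<lambda>S. F S + G S) = (\<lambda>S. (avg n ^^ t) F S + (avg n ^^ t) G S)"
  by (induction t) (simp_all add: avg_add[abs_def])

lemma avg_funpow_cmult: "(avg n ^^ t) (\<lambda>S. c * F S) = (\<lambda>S. c * (avg n ^^ t) F S)"
  by (induction t) (simp_all add: avg_cmult[abs_def])

lemma avg_funpow_const: "n \<ge> 2 \<Longrightarrow> (avg n ^^ t) (\<lambda>S. c) = (\<lambda>S. c)"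
proof (induction t)
  case (Suc t)
  show ?case unfolding funpow.simps o_apply Suc.IH[OF Suc.prems] by (rule ext) (rule avg_const[OF Suc.prems])
qed simp

lemma avg_funpow_nonneg:
  assumes "n \<ge> 2" "\<And>S. S \<in> Pow {1..n} - {{}} \<Longrightarrow> 0 \<le> F S" "S \<in> Pow {1..n} - {{}}"
  shows "0 \<le> (avg n ^^ t) F S"
  using avg_funpow_mono[of n "\<lambda>_. 0" F S t] assms by (simp add: avg_funpow_const)

text \<open>A drift condition is iterated; \<open>c * w / (1 - r)\<close> is the fixed point of
  \<open>v = r * v + c * w\<close>. The step inequality is applied to the innermost function,
  because \<open>w\<close> bounds \<open>G\<close> only along the chain from the given
  \<open>S\<close>.\<close>

lemma avg_funpow_affine:
  assumes n: "n \<ge> 2" and r: "0 \<le> r" "r < 1"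
    and step: "\<And>S. S \<in> Pow {1..n} - {{}} \<Longrightarrow> avg n F S \<le> r * F S + c * G S"
    and w: "\<And>t. (avg n ^^ t) G S \<le> w" and "0 \<le> c" "0 \<le> w"
    and S: "S \<in> Pow {1..n} - {{}}"
  shows "(avg n ^^ t) F S \<le> r ^ t * F S + c * w / (1 - r)"
proof (induction t)
  case 0
  show ?case using assms by simp
next
  case (Suc t)
  have "(avg n ^^ Suc t) F S = (avg n ^^ t) (avg n F) S" by (simp add: funpow_swap1)
  also have "\<dots> \<le> (avg n ^^ t) (\<lambda>S. r * F S + c * G S) S"
    by (rule avg_funpow_mono[OF step S])
  also have "\<dots> = r * (avg n ^^ t) F S + c * (avg n ^^ t) G S"
    by (simp add: avg_funpow_add avg_funpow_cmult)
  also have "\<dots> \<le> r * (r ^ t * F S + c * w / (1 - r)) + c * w"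
    using Suc w[of t] assms by (intro add_mono mult_left_mono) auto
  also have "\<dots> = r ^ Suc t * F S + c * w / (1 - r)"
    using r by (simp add: field_simps)
  finally show ?case .
qed

section \<open>Translation of the chain on vectors to the operator on sets\<close>

definition supp :: "(nat \<Rightarrow> bit) \<Rightarrow> nat set" where
  "supp x = {i. x i = 1}"

lemma inj_supp: "inj supp"
proof (rule injI, rule ext)
  fix x y :: "nat \<Rightarrow> bit" and i assume "supp x = supp y"
  hence "x i = 1 \<longleftrightarrow> y i = 1" by (auto simp: supp_def)
  thus "x i = y i" by (cases "x i"; cases "y i") auto
qed

lemma supp_add: "supp (x(j := x j + x i)) = toggle i j (supp x)"
  by (cases "x i"; cases "x j") (auto simp: supp_def toggle_def flip_def)

lemma bij_betw_supp: "bij_betw supp (states n) (Pow {1..n} - {{}})"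
proof (rule bij_betwI[of _ _ _ "\<lambda>S i. if i \<in> S then 1 else 0"])
  show "supp \<in> states n \<rightarrow> Pow {1..n} - {{}}"
  proof
    fix x assume x: "x \<in> states n"
    have "supp x \<subseteq> {1..n}" using x by (force simp: supp_def states_def)
    moreover obtain i where "x i \<noteq> 0" using x by (auto simp: states_def fun_eq_iff)
    ultimately show "supp x \<in> Pow {1..n} - {{}}" by (auto simp: supp_def)
  qed
  show "(\<lambda>S i. if i \<in> S then 1 else 0) \<in> Pow {1..n} - {{}} \<rightarrow> states n"
    by (auto simp: states_def fun_eq_iff split: if_splits)
  show "(\<lambda>i. if i \<in> supp x then 1 else 0) = x" for x
    by (auto simp: supp_def fun_eq_iff)
  show "supp (\<lambda>i. if i \<in> S then 1 else 0) = S" for S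
    by (auto simp: supp_def)
qed

lemma supp_image_states: "supp ` states n = Pow {1..n} - {{}}"
  by (rule bij_betw_imp_surj_on[OF bij_betw_supp])

lemma supp_mem_iff: "supp x \<in> Pow {1..n} - {{}} \<longleftrightarrow> x \<in> states n"
  using inj_image_mem_iff[OF inj_supp, of x "states n"] by (simp only: supp_image_states)

lemma card_Pow_nonempty: "real (card (Pow {1..n} - {{}::nat set})) = 2 ^ n - 1"
  by (subst card_Diff_singleton) (simp_all add: card_Pow of_nat_diff)

lemma supp_image_vimage:
  assumes "A \<subseteq> Pow {1..n} - {{}}"
  shows "supp ` {y. supp y \<in> A} = A"
proof -
  have "A \<subseteq> range supp"
    by (rule order_trans[OF assms]) (use supp_image_states[of n, symmetric] in \<open>simp add: image_mono\<close>)
  thus ?thesis using image_vimage_eq[of supp A] by (simp add: vimage_def Int_absorb2)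
qed

lemma finite_states [simp]: "finite (states n)"
  using bij_betw_finite[OF bij_betw_supp, of n] by simp

lemma card_states: "real (card (states n)) = 2 ^ n - 1"
proof -
  have "card (states n) = card (Pow {1..n} - {{}::nat set})"
    by (rule bij_betw_same_card[OF bij_betw_supp])
  thus ?thesis using card_Pow_nonempty[of n] by simp
qed

lemma states_nonempty: "n \<ge> 1 \<Longrightarrow> states n \<noteq> {}"
proof -
  assume "n \<ge> 1"
  hence "{1} \<in> Pow {1..n} - {{}}" by auto
  thus ?thesis using supp_image_states[of n] by auto
qed

lemma coord_pairs_nonempty: "n \<ge> 2 \<Longrightarrow> coord_pairs n \<noteq> {}"
proof -
  assume "n \<ge> 2"
  hence "(1, 2) \<in> coord_pairs n" by (auto simp: coord_pairs_def)
  thus ?thesis by blast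
qed

lemma expectation_step:
  assumes "n \<ge> 2"
  shows "measure_pmf.expectation (step n x) (\<lambda>y. F (supp y)) = avg n F (supp x)"
proof -
  have "F (supp (case p of (i, j) \<Rightarrow> x(j := x j + x i))) = (case p of (i, j) \<Rightarrow> F (toggle i j (supp x)))" for p
    by (cases p) (simp only: prod.case supp_add)
  thus ?thesis using coord_pairs_nonempty[OF assms]
    by (simp only: step_def integral_map_pmf integral_pmf_of_set[OF coord_pairs_nonempty[OF assms]
        finite_coord_pairs] avg_def card_coord_pairs)
qed

lemma finite_set_pmf_step: "n \<ge> 2 \<Longrightarrow> finite (set_pmf (step n x))"
  using coord_pairs_nonempty[of n] by (simp add: step_def)

lemma finite_set_pmf_law: "n \<ge> 2 \<Longrightarrow> finite (set_pmf (law n t x))"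
  by (induction t) (simp_all add: finite_set_pmf_step)

lemma expectation_law:
  assumes "n \<ge> 2"
  shows "measure_pmf.expectation (law n t x) (\<lambda>y. F (supp y)) = (avg n ^^ t) F (supp x)"
proof (induction t arbitrary: F)
  case (Suc t)
  have "measure_pmf.expectation (law n (Suc t) x) (\<lambda>y. F (supp y)) =
    (\<Sum>y\<in>set_pmf (law n t x). pmf (law n t x) y *\<^sub>R
       measure_pmf.expectation (step n y) (\<lambda>y. F (supp y)))"
    unfolding law.simps
    by (rule pmf_expectation_bind) (simp_all add: finite_set_pmf_step finite_set_pmf_law assms)
  also have "\<dots> = measure_pmf.expectation (law n t x) (\<lambda>y. avg n F (supp y))"
    by (subst integral_measure_pmf[OF finite_set_pmf_law[OF assms]])
      (simp_all add: expectation_step[OF assms] set_pmf_iff)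
  also have "\<dots> = (avg n ^^ Suc t) F (supp x)"
    by (subst Suc.IH) (simp add: funpow_swap1)
  finally show ?case .
qed simp

lemma prob_law:
  assumes "n \<ge> 2"
  shows "measure_pmf.prob (law n t x) {y. supp y \<in> A} = (avg n ^^ t) (indicator A) (supp x)"
proof -
  have "measure_pmf.prob (law n t x) {y. supp y \<in> A} =
    measure_pmf.expectation (law n t x) (indicator {y. supp y \<in> A})"
    by simp
  also have "indicator {y. supp y \<in> A} = (\<lambda>y. indicator A (supp y) :: real)"
    by (auto simp: indicator_def fun_eq_iff)
  finally show ?thesis by (simp only: expectation_law[OF assms])
qed

lemma prob_stationary:
  assumes "A \<subseteq> Pow {1..n} - {{}}" "n \<ge> 2"
  shows "measure_pmf.prob (stationary n) {y. supp y \<in> A} = real (card A) / (2 ^ n - 1)"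
proof -
  have ne: "states n \<noteq> {}" using states_nonempty[of n] assms(2) by simp
  have "measure_pmf.prob (stationary n) {y. supp y \<in> A} = card (states n \<inter> {y. supp y \<in> A}) / card (states n)"
    unfolding stationary_def by (rule measure_pmf_of_set[OF ne]) simp
  also have "card (states n \<inter> {y. supp y \<in> A}) = card A"
  proof -
    have "states n \<inter> {y. supp y \<in> A} = {y. supp y \<in> A}"
      using assms(1) supp_mem_iff[of _ n] by blast
    hence "supp ` (states n \<inter> {y. supp y \<in> A}) = A"
      by (simp only: supp_image_vimage[OF assms(1)])
    thus ?thesis using card_image[OF inj_on_subset[OF inj_supp subset_UNIV]] by metis
  qed
  finally show ?thesis by (simp add: card_states)
qed

lemma dist_from_le:
  assumes "n \<ge> 2"
    and "\<And>A. A \<subseteq> Pow {1..n} - {{}} \<Longrightarrow>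
      real (card A) / (2 ^ n - 1) - (avg n ^^ t) (indicator A) (supp x) \<le> e"
  shows "dist_from n t x \<le> e"
  unfolding dist_from_def
proof (rule cSUP_least)
  fix A assume A: "A \<in> Pow (states n)"
  have "supp ` A \<subseteq> Pow {1..n} - {{}}"
    using A supp_image_states[of n] by auto
  moreover have "{y. supp y \<in> supp ` A} = A"
    using injD[OF inj_supp] by blast
  ultimately show "measure_pmf.prob (stationary n) A - measure_pmf.prob (law n t x) A \<le> e"
    using assms(2)[of "supp ` A"] prob_stationary[of "supp ` A" n] prob_law[of n t x "supp ` A"] assms(1)
    by simp
qed auto

lemma bdd_above_dist_from:
  "bdd_above ((\<lambda>A. measure_pmf.prob (stationary n) A - measure_pmf.prob (law n t x) A) ` Pow (states n))"
proof (rule bdd_aboveI[of _ 1], clarify)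
  fix A
  show "measure_pmf.prob (stationary n) A - measure_pmf.prob (law n t x) A \<le> 1"
    using measure_pmf.prob_le_1[of "stationary n" A] measure_nonneg[of "measure_pmf (law n t x)" A] by linarith
qed

lemma dist_from_ge:
  assumes "n \<ge> 2" "A \<subseteq> Pow {1..n} - {{}}" "x \<in> states n"
  shows "real (card A) / (2 ^ n - 1) - (avg n ^^ t) (indicator A) (supp x) \<le> dist_from n t x"
proof -
  have "{y. supp y \<in> A} \<in> Pow (states n)"
    using assms(2) supp_mem_iff[of _ n] by blast
  from cSUP_upper[OF this bdd_above_dist_from] show ?thesis
    by (simp add: dist_from_def prob_law prob_stationary assms)
qed

lemma worst_dist_le:
  assumes "n \<ge> 2"
    and "\<And>X A. X \<in> Pow {1..n} - {{}} \<Longrightarrow> A \<subseteq> Pow {1..n} - {{}} \<Longrightarrow>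
      real (card A) / (2 ^ n - 1) - (avg n ^^ t) (indicator A) X \<le> e"
  shows "worst_dist n t \<le> e"
proof -
  have "dist_from n t x \<le> e" if "x \<in> states n" for x
    using that supp_image_states[of n] by (intro dist_from_le assms) auto
  thus ?thesis unfolding worst_dist_def using states_nonempty[of n] assms(1)
    by (intro Max.boundedI) auto
qed

lemma worst_dist_ge:
  assumes "n \<ge> 2" "X \<in> Pow {1..n} - {{}}" "A \<subseteq> Pow {1..n} - {{}}"
  shows "real (card A) / (2 ^ n - 1) - (avg n ^^ t) (indicator A) X \<le> worst_dist n t"
proof -
  obtain x where x: "x \<in> states n" "supp x = X"
    using supp_image_states[of n] assms(2) by (metis imageE)
  have "dist_from n t x \<le> worst_dist n t"
    unfolding worst_dist_def using x by (intro Max_ge) auto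
  thus ?thesis using dist_from_ge[OF assms(1,3) x(1), of t] x(2) by simp
qed

lemma worst_dist_le_1: "n \<ge> 2 \<Longrightarrow> worst_dist n t \<le> 1"
proof (rule worst_dist_le)
  fix X A assume n: "n \<ge> 2" and X: "X \<in> Pow {1..n} - {{}}" and A: "A \<subseteq> Pow {1..n} - {{}}"
  have "card A \<le> card (Pow {1..n} - {{}::nat set})" by (rule card_mono[OF _ A]) simp
  hence "real (card A) \<le> 2 ^ n - 1" using card_Pow_nonempty[of n] by linarith
  hence "real (card A) / (2 ^ n - 1) \<le> 1" by (simp add: divide_le_eq)
  moreover have "(avg n ^^ t) (indicator A) X \<ge> 0"
    by (rule avg_funpow_nonneg[OF n _ X]) simp
  ultimately show "real (card A) / (2 ^ n - 1) - (avg n ^^ t) (indicator A) X \<le> 1" by linarith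
qed

lemma worst_dist_nonneg:
  assumes "n \<ge> 2" shows "0 \<le> worst_dist n t"
  using worst_dist_ge[OF assms, of "{1}" "{}" t] assms
  by (simp add: indicator_def[abs_def] avg_funpow_const)

section \<open>Fourier transform\<close>

text \<open>The Walsh characters. In product form, multiplicativity and summation over all
  \<open>Y\<close> can be checked factor by factor.\<close>

definition chi :: "'a set \<Rightarrow> 'a set \<Rightarrow> real" where
  "chi Y S = (\<Prod>i\<in>Y. if i \<in> S then -1 else 1)"

text \<open>Left unnormalised, so that a sub-probability has coefficients of absolute value at most
  1; applied twice, the transform multiplies by \<open>2 ^ n\<close>.\<close>

definition fourier :: "nat \<Rightarrow> (nat set \<Rightarrow> real) \<Rightarrow> nat set \<Rightarrow> real" where
  "fourier n q Y = (\<Sum>S\<in>Pow {1..n}. q S * chi Y S)"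

definition bias :: "nat \<Rightarrow> nat set \<Rightarrow> real" where
  "bias n S = real n - 2 * real (card S)"

lemma chi_conv_card: "finite Y \<Longrightarrow> chi Y S = (-1) ^ card (Y \<inter> S)"
  by (simp add: chi_def prod.If_cases Int_def)

lemma chi_sym: "finite Y \<Longrightarrow> finite S \<Longrightarrow> chi Y S = chi S Y"
  by (simp add: chi_conv_card Int_commute)

lemma abs_chi [simp]: "\<bar>chi Y S\<bar> = 1"
proof -
  have "\<bar>chi Y S\<bar> = (\<Prod>i\<in>Y. \<bar>if i \<in> S then -1 else 1::real\<bar>)"
    unfolding chi_def by (rule abs_prod)
  also have "\<dots> = 1" by (rule prod.neutral) auto
  finally show ?thesis .
qed

lemma chi_empty [simp]: "chi {} S = 1" "chi Y {} = 1"
  by (simp_all add: chi_def)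

lemma chi_mult: "chi Y S * chi Y T = chi Y (sym_diff S T)"
  unfolding chi_def prod.distrib[symmetric] by (rule prod.cong) auto

lemma chi_flip_right: "finite Y \<Longrightarrow> chi Y (flip j S) = (if j \<in> Y then - chi Y S else chi Y S)"
proof -
  assume Y: "finite Y"
  have *: "(\<Prod>i\<in>Y - {j}. if i \<in> flip j S then -1 else 1::real) = (\<Prod>i\<in>Y - {j}. if i \<in> S then -1 else 1)"
    by (rule prod.cong) (auto simp: flip_def)
  show ?thesis
  proof (cases "j \<in> Y")
    case True
    thus ?thesis using * Y unfolding chi_def
      by (subst (1 2) prod.remove[of Y j]) (auto simp: flip_def)
  next
    case False
    thus ?thesis using * by (simp add: chi_def)
  qed
qed

lemma chi_flip_left: "finite Y \<Longrightarrow> finite S \<Longrightarrow> chi (flip j Y) S = (if j \<in> S then - chi Y S else chi Y S)"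
  using chi_flip_right[of S j Y] by (simp add: chi_sym flip_def)

lemma chi_toggle:
  assumes "finite Y" "finite S"
  shows "chi Y (toggle i j S) = chi (toggle j i Y) S"
  using assms by (simp add: toggle_def chi_flip_left chi_flip_right)

text \<open>The sum factorises over the elements of \<open>A\<close>, with factor 0 for those in
  \<open>S\<close> and 2 for the others.\<close>

lemma sum_chi:
  assumes "finite A"
  shows "(\<Sum>Y\<in>Pow A. chi Y S) = (if S \<inter> A = {} then 2 ^ card A else 0)"
proof -
  have "(\<Sum>Y\<in>Pow A. chi Y S) = (\<Prod>i\<in>A. (if i \<in> S then -1 else 1) + (1::real))"
    using assms by (subst prod_add) (simp_all add: chi_def)
  also have "\<dots> = (if S \<inter> A = {} then 2 ^ card A else 0)"
  proof (cases "S \<inter> A = {}")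
    case True
    hence "(\<Prod>i\<in>A. (if i \<in> S then -1 else 1) + (1::real)) = (\<Prod>i\<in>A. 2)"
      by (intro prod.cong) auto
    thus ?thesis using True by simp
  next
    case False
    then obtain i where "i \<in> A" "i \<in> S" by auto
    thus ?thesis using False assms by (auto intro!: prod_zero bexI[of _ i])
  qed
  finally show ?thesis .
qed

lemma chi_orthogonal:
  assumes "finite A" "S \<subseteq> A" "T \<subseteq> A"
  shows "(\<Sum>Y\<in>Pow A. chi Y S * chi Y T) = (if S = T then 2 ^ card A else 0)"
proof -
  have "sym_diff S T \<inter> A = {} \<longleftrightarrow> S = T" using assms by auto
  thus ?thesis unfolding chi_mult sum_chi[OF assms(1)] by simp
qed

lemma finite_Pow_mem: "S \<in> Pow {1..n::nat} \<Longrightarrow> finite S"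
  by (auto intro: finite_subset)

lemma fourier_fourier:
  assumes "S \<in> Pow {1..n}"
  shows "fourier n (fourier n q) S = 2 ^ n * q S"
proof -
  have "fourier n (fourier n q) S = (\<Sum>Y\<in>Pow {1..n}. \<Sum>T\<in>Pow {1..n}. q T * (chi Y S * chi Y T))"
    unfolding fourier_def sum_distrib_right
    using assms by (intro sum.cong refl) (auto simp: chi_sym finite_subset mult_ac)
  also have "\<dots> = (\<Sum>T\<in>Pow {1..n}. q T * (\<Sum>Y\<in>Pow {1..n}. chi Y S * chi Y T))"
    by (subst sum.swap) (simp add: sum_distrib_left)
  also have "\<dots> = (\<Sum>T\<in>Pow {1..n}. if S = T then q T * 2 ^ n else 0)"
    using assms by (intro sum.cong refl) (auto simp: chi_orthogonal)
  also have "\<dots> = 2 ^ n * q S" using assms by (simp add: sum.delta)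
  finally show ?thesis .
qed

lemma fourier_selfadjoint:
  "(\<Sum>Y\<in>Pow {1..n}. fourier n q Y * p Y) = (\<Sum>S\<in>Pow {1..n}. q S * fourier n p S)"
proof -
  have "(\<Sum>Y\<in>Pow {1..n}. fourier n q Y * p Y) = (\<Sum>Y\<in>Pow {1..n}. \<Sum>S\<in>Pow {1..n}. q S * (p Y * chi S Y))"
    unfolding fourier_def sum_distrib_right
    by (intro sum.cong refl) (auto simp: chi_sym finite_subset)
  thus ?thesis by (subst (asm) sum.swap) (simp add: fourier_def sum_distrib_left)
qed

lemma parseval: "(\<Sum>Y\<in>Pow {1..n}. (fourier n q Y)\<^sup>2) = 2 ^ n * (\<Sum>S\<in>Pow {1..n}. (q S)\<^sup>2)"
proof -
  have "(\<Sum>Y\<in>Pow {1..n}. (fourier n q Y)\<^sup>2) = (\<Sum>S\<in>Pow {1..n}. q S * fourier n (fourier n q) S)"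
    unfolding power2_eq_square by (rule fourier_selfadjoint)
  also have "\<dots> = (\<Sum>S\<in>Pow {1..n}. 2 ^ n * (q S)\<^sup>2)"
    by (intro sum.cong refl) (simp add: fourier_fourier power2_eq_square)
  finally show ?thesis by (simp add: sum_distrib_left)
qed

lemma abs_fourier_le: "\<bar>fourier n q Y\<bar> \<le> (\<Sum>S\<in>Pow {1..n}. \<bar>q S\<bar>)"
proof -
  have "\<bar>fourier n q Y\<bar> \<le> (\<Sum>S\<in>Pow {1..n}. \<bar>q S * chi Y S\<bar>)" unfolding fourier_def by (rule sum_abs)
  thus ?thesis by (simp add: abs_mult)
qed

lemma swap_coord_pairs:
  "(\<Sum>(i,j)\<in>coord_pairs n. f j i) = (\<Sum>(i,j)\<in>coord_pairs n. f i j)"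
proof -
  have "bij_betw prod.swap (coord_pairs n) (coord_pairs n)"
    by (rule bij_betwI[of _ _ _ prod.swap]) (auto simp: coord_pairs_def)
  from sum.reindex_bij_betw[OF this, of "\<lambda>(i,j). f i j"] show ?thesis
    by (simp add: case_prod_unfold)
qed

text \<open>Since \<open>chi Y (toggle i j S) = chi (toggle j i Y) S\<close>, the Fourier transform turns the chain into itself.\<close>

lemma fourier_avg:
  assumes "Y \<in> Pow {1..n}"
  shows "fourier n (avg n q) Y = avg n (fourier n q) Y"
proof -
  have "fourier n (avg n q) Y = (\<Sum>S\<in>Pow {1..n}. q S * avg n (chi Y) S)"
    unfolding fourier_def by (rule avg_selfadjoint[symmetric])
  also have "\<dots> = (\<Sum>S\<in>Pow {1..n}. (\<Sum>(i,j)\<in>coord_pairs n. q S * chi (toggle j i Y) S) / (real n * (real n - 1)))"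
    using assms by (intro sum.cong refl)
      (auto simp: avg_def chi_toggle finite_subset sum_distrib_left case_prod_unfold)
  also have "\<dots> = (\<Sum>(i,j)\<in>coord_pairs n. fourier n q (toggle j i Y)) / (real n * (real n - 1))"
    unfolding sum_divide_distrib[symmetric] fourier_def case_prod_unfold by (subst sum.swap) simp
  also have "\<dots> = avg n (fourier n q) Y" unfolding avg_def by (subst swap_coord_pairs) simp
  finally show ?thesis .
qed

lemma avg_cong_Pow:
  assumes "\<And>S. S \<in> Pow {1..n} \<Longrightarrow> F S = G S" "S \<in> Pow {1..n}"
  shows "avg n F S = avg n G S"
  using toggle_Pow[of _ "{1..n}" S] assms(2) by (intro avg_cong assms(1)) (auto simp: coord_pairs_def)

lemma fourier_avg_funpow:
  assumes "Y \<in> Pow {1..n}"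
  shows "fourier n ((avg n ^^ t) q) Y = (avg n ^^ t) (fourier n q) Y"
  using assms
proof (induction t arbitrary: Y)
  case (Suc t)
  have "fourier n ((avg n ^^ Suc t) q) Y = avg n (fourier n ((avg n ^^ t) q)) Y"
    by (simp only: funpow.simps o_apply fourier_avg[OF Suc.prems])
  also have "\<dots> = avg n ((avg n ^^ t) (fourier n q)) Y"
    by (rule avg_cong_Pow[OF Suc.IH Suc.prems])
  finally show ?case by simp
qed simp

lemma bias_conv_sum: "S \<in> Pow {1..n} \<Longrightarrow> bias n S = (\<Sum>i=1..n. if i \<in> S then -1 else 1)"
proof -
  assume S: "S \<in> Pow {1..n}"
  have "(\<Sum>i=1..n. if i \<in> S then -1 else 1::real) = - real (card ({1..n} \<inter> S)) + real (card ({1..n} - S))"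
    by (simp add: sum.If_cases Diff_eq Compl_eq Int_def)
  also have "{1..n} \<inter> S = S" using S by auto
  also have "real (card ({1..n} - S)) = n - card S"
    using S card_mono[of "{1..n}" S] by (subst card_Diff_subset) (auto simp: finite_subset of_nat_diff)
  finally show ?thesis using card_mono[of "{1..n}" S] S by (simp add: bias_def of_nat_diff)
qed

text \<open>Flipping \<open>i\<close> in the index multiplies the character by the sign of
  \<open>i\<close> in \<open>S\<close>, and these signs add up to the bias.\<close>

lemma sum_fourier_flip:
  assumes "Y \<in> Pow {1..n}"
  shows "(\<Sum>i=1..n. fourier n q (flip i Y)) = fourier n (\<lambda>S. bias n S * q S) Y"
proof -
  have "(\<Sum>i=1..n. fourier n q (flip i Y)) = (\<Sum>S\<in>Pow {1..n}. \<Sum>i=1..n. q S * chi (flip i Y) S)"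
    unfolding fourier_def by (rule sum.swap)
  also have "\<dots> = (\<Sum>S\<in>Pow {1..n}. \<Sum>i=1..n. q S * chi Y S * (if i \<in> S then -1 else 1))"
    using assms by (intro sum.cong refl) (auto simp: chi_flip_left finite_subset)
  also have "\<dots> = fourier n (\<lambda>S. bias n S * q S) Y"
    unfolding fourier_def sum_distrib_left[symmetric]
    by (intro sum.cong refl) (simp add: bias_conv_sum mult_ac)
  finally show ?thesis .
qed

section \<open>Generating functions and Chernoff bounds\<close>

lemma sum_power_card:
  fixes x :: real
  assumes "finite A"
  shows "(\<Sum>S\<in>Pow A. x ^ card S) = (1 + x) ^ card A"
proof -
  have "(\<Prod>i\<in>A. x + 1) = (\<Sum>S\<in>Pow A. x ^ card S)"
    using assms by (subst prod_add) simp_all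
  thus ?thesis by (simp add: add.commute)
qed

text \<open>Exponential tilting: for every set counted, \<open>x ^ card S\<close> is at least
  \<open>x ^ k\<close>.\<close>

lemma card_small_subsets:
  fixes x :: real
  assumes "finite A" "0 < x" "x \<le> 1"
  shows "real (card {S\<in>Pow A. card S \<le> k}) \<le> (1 + x) ^ card A / x ^ k"
proof -
  have "real (card {S\<in>Pow A. card S \<le> k}) * x ^ k = (\<Sum>S\<in>{S\<in>Pow A. card S \<le> k}. x ^ k)"
    by simp
  also have "\<dots> \<le> (\<Sum>S\<in>{S\<in>Pow A. card S \<le> k}. x ^ card S)"
    using assms by (intro sum_mono power_decreasing) auto
  also have "\<dots> \<le> (\<Sum>S\<in>Pow A. x ^ card S)"
    using assms by (intro sum_mono2) auto
  finally show ?thesis using assms by (simp add: sum_power_card field_simps)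
qed

lemma exp_add_exp_uminus_le:
  fixes l :: real
  assumes "0 \<le> l" "l \<le> 1"
  shows "exp l + exp (-l) \<le> 2 * exp (l\<^sup>2)"
proof -
  have 1: "exp l \<le> 1 + l + l\<^sup>2" using assms by (rule exp_bound)
  have "exp (-l) \<le> 1 - l + l\<^sup>2"
  proof -
    \<comment> \<open>The product equals \<open>1 + l ^ 3\<close>.\<close>
    have "1 \<le> (1 - l + l\<^sup>2) * (1 + l)"
      using assms by (simp add: algebra_simps power2_eq_square power3_eq_cube)
    also have "\<dots> \<le> (1 - l + l\<^sup>2) * exp l"
    proof (rule mult_left_mono)
      show "0 \<le> 1 - l + l\<^sup>2" using assms zero_le_power2[of l] by linarith
    qed simp
    finally show ?thesis by (simp add: exp_minus field_simps)
  qed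
  with 1 have "exp l + exp (-l) \<le> 2 * (1 + l\<^sup>2)" by simp
  also have "\<dots> \<le> 2 * exp (l\<^sup>2)" by (intro mult_left_mono exp_ge_add_one_self) simp
  finally show ?thesis .
qed

lemma sum_exp_bias:
  "(\<Sum>S\<in>Pow {1..n}. exp (l * bias n S)) = (exp l + exp (-l)) ^ n"
proof -
  have "(\<Sum>S\<in>Pow {1..n}. exp (l * bias n S)) = (\<Sum>S\<in>Pow {1..n}. exp l ^ n * exp (-2 * l) ^ card S)"
    by (intro sum.cong refl) (simp add: bias_def exp_of_nat_mult[symmetric] exp_add[symmetric] algebra_simps)
  also have "\<dots> = (exp l * (1 + exp (-2*l))) ^ n"
    by (simp add: sum_distrib_left[symmetric] sum_power_card power_mult_distrib)
  also have "exp l * (1 + exp (-2*l)) = exp l + exp (-l)"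
    by (simp add: algebra_simps exp_add[symmetric])
  finally show ?thesis .
qed

lemma chernoff_half:
  assumes "0 \<le> g" "g \<le> 1" "s = 1 \<or> s = -1"
  shows "real (card {S\<in>Pow {1..n}. s * bias n S > g * n}) \<le> 2 ^ n * exp (- g\<^sup>2 * n / 4)"
proof -
  \<comment> \<open>The minimiser of \<open>l\<^sup>2 - l * g\<close>, the exponent per coordinate;
    the minimum is \<open>- g\<^sup>2 / 4\<close>.\<close>
  define l where "l = g / 2"
  have l: "0 \<le> l" "l \<le> 1" using assms by (auto simp: l_def)
  have "real (card {S\<in>Pow {1..n}. s * bias n S > g * n}) * exp (l * (g * n)) =
    (\<Sum>S\<in>{S\<in>Pow {1..n}. s * bias n S > g * n}. exp (l * (g * n)))" by simp
  also have "\<dots> \<le> (\<Sum>S\<in>{S\<in>Pow {1..n}. s * bias n S > g * n}. exp (l * s * bias n S))"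
    using l by (intro sum_mono) (auto simp: mult.assoc intro!: mult_left_mono)
  also have "\<dots> \<le> (\<Sum>S\<in>Pow {1..n}. exp (l * s * bias n S))"
    by (intro sum_mono2) auto
  also have "\<dots> = (exp (l * s) + exp (- (l * s))) ^ n" by (rule sum_exp_bias)
  also have "exp (l * s) + exp (- (l * s)) = exp l + exp (-l)" using assms(3) by auto
  also have "(exp l + exp (-l)) ^ n \<le> (2 * exp (l\<^sup>2)) ^ n"
    using exp_add_exp_uminus_le[OF l] by (intro power_mono) (auto intro: add_nonneg_nonneg)
  also have "\<dots> = 2 ^ n * exp (l\<^sup>2 * n)"
    by (simp add: power_mult_distrib exp_of_nat_mult[symmetric] mult.commute)
  also have "exp (l\<^sup>2 * n) = exp (- g\<^sup>2 * n / 4) * exp (l * (g * n))"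
    by (simp add: exp_add[symmetric] l_def power2_eq_square)
  finally show ?thesis by simp
qed

lemma chernoff:
  assumes "0 \<le> g" "g \<le> 1"
  shows "real (card {S\<in>Pow {1..n}. \<bar>bias n S\<bar> > g * n}) \<le> 2 * 2 ^ n * exp (- g\<^sup>2 * n / 4)"
proof -
  have "{S\<in>Pow {1..n}. \<bar>bias n S\<bar> > g * n} \<subseteq>
    {S\<in>Pow {1..n}. 1 * bias n S > g * n} \<union> {S\<in>Pow {1..n}. (-1) * bias n S > g * n}" by auto
  hence "card {S\<in>Pow {1..n}. \<bar>bias n S\<bar> > g * n} \<le>
    card ({S\<in>Pow {1..n}. 1 * bias n S > g * n} \<union> {S\<in>Pow {1..n}. (-1) * bias n S > g * n})"
    by (intro card_mono) auto
  also have "\<dots> \<le> card {S\<in>Pow {1..n}. 1 * bias n S > g * n} + card {S\<in>Pow {1..n}. (-1) * bias n S > g * n}"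
    by (rule card_Un_le)
  finally have "real (card {S\<in>Pow {1..n}. \<bar>bias n S\<bar> > g * n}) \<le>
    real (card {S\<in>Pow {1..n}. 1 * bias n S > g * n}) + real (card {S\<in>Pow {1..n}. (-1) * bias n S > g * n})"
    by linarith
  also have "\<dots> \<le> 2 ^ n * exp (- g\<^sup>2 * n / 4) + 2 ^ n * exp (- g\<^sup>2 * n / 4)"
    by (intro add_mono chernoff_half[OF assms]) auto
  finally show ?thesis by simp
qed

section \<open>Lower bound\<close>

lemma nat_floor_bounds:
  fixes x :: real
  assumes "0 \<le> x"
  shows "real (nat \<lfloor>x\<rfloor>) \<le> x" "x - 1 \<le> real (nat \<lfloor>x\<rfloor>)"
  using assms by linarith+

text \<open>One step of the weight chain. The truncated \<open>h - 1\<close> at \<open>h = 0\<close>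
  and the value at \<open>n + 1\<close> for \<open>h = n\<close> have coefficient 0.\<close>

definition radial :: "nat \<Rightarrow> (nat \<Rightarrow> real) \<Rightarrow> nat \<Rightarrow> real" where
  "radial n f h = (1 - real h / real n) * f h +
     (real h * (real h - 1) * f (h - 1) + real h * (real n - real h) * f (h + 1)) / (real n * (real n - 1))"

lemma card_le_n: "S \<in> Pow {1..n} \<Longrightarrow> card S \<le> n"
  using card_mono[of "{1..n}" S] by auto

lemma avg_radial:
  assumes "S \<in> Pow {1..n}" "n \<ge> 2"
  shows "avg n (\<lambda>S. f (card S)) S = radial n f (card S)"
proof -
  have fS: "finite S" using assms by (auto intro: finite_subset)
  have "(\<Sum>j\<in>S. f (card (S - {j}))) = card S * f (card S - 1)"
    using fS by simp
  moreover have "(\<Sum>j\<in>{1..n}-S. f (card (insert j S))) = (real n - card S) * f (card S + 1)"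
    using fS assms card_le_n[OF assms(1)] by (simp add: card_Diff_subset of_nat_diff Suc_eq_plus1)
  ultimately show ?thesis using assms by (simp add: avg_formula radial_def mult_ac)
qed

lemma avg_card_le:
  assumes "S \<in> Pow {1..n} - {{}}" "n \<ge> 2"
  shows "avg n (\<lambda>S. real (card S)) S \<le> (1 + 1 / n) * card S"
proof -
  define h where "h = real (card S)"
  have h: "1 \<le> card S" using assms by (metis Diff_iff Suc_leI card_gt_0_iff finite_Pow_mem One_nat_def singletonI)
  have "avg n (\<lambda>S. real (card S)) S = (1 - h / n) * h + (h * (h - 1) * (h - 1) + h * (n - h) * (h + 1)) / (n * (real n - 1))"
    using avg_radial[of S n real] assms h by (simp add: radial_def h_def of_nat_diff add.commute)
  also have "\<dots> = h + h * (n - 2 * h + 1) / (n * (real n - 1))"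
    using assms(2) by (simp add: divide_simps) (simp add: algebra_simps)
  \<comment> \<open>Since \<open>h\<close> is at least 1, \<open>n - 2 * h + 1\<close> is at most
    \<open>n - 1\<close>.\<close>
  also have "\<dots> \<le> h + h * (real n - 1) / (n * (real n - 1))"
    using assms(2) h by (intro add_left_mono divide_right_mono mult_left_mono) (auto simp: h_def)
  also have "\<dots> = (1 + 1 / n) * h" using assms(2) by (simp add: divide_simps) (simp add: algebra_simps)
  finally show ?thesis by (simp add: h_def)
qed

lemma avg_funpow_card_le:
  assumes "n \<ge> 2" "S \<in> Pow {1..n} - {{}}"
  shows "(avg n ^^ s) (\<lambda>S. real (card S)) S \<le> (1 + 1 / n) ^ s * card S"
proof (induction s)
  case (Suc s)
  have "(avg n ^^ Suc s) (\<lambda>S. real (card S)) S = (avg n ^^ s) (avg n (\<lambda>S. real (card S))) S"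
    by (simp add: funpow_swap1)
  also have "\<dots> \<le> (avg n ^^ s) (\<lambda>S. (1 + 1 / n) * card S) S"
    by (rule avg_funpow_mono[OF avg_card_le assms(2)]) (use assms in auto)
  also have "\<dots> = (1 + 1 / n) * (avg n ^^ s) (\<lambda>S. real (card S)) S"
    by (simp add: avg_funpow_cmult)
  also have "\<dots> \<le> (1 + 1 / n) * ((1 + 1 / n) ^ s * card S)"
    using Suc by (intro mult_left_mono) auto
  finally show ?case by (simp add: mult_ac)
qed simp

text \<open>The mean of the new bias has a linear lower bound, with a quadratic surplus when the
  bias is large. Squaring only the shortfall under \<open>l\<close> makes this one-sided information
  enough for a Chebyshev estimate.\<close>

definition below :: "nat \<Rightarrow> real \<Rightarrow> nat set \<Rightarrow> real" where
  "below n l S = (max 0 (l - bias n S))\<^sup>2"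

text \<open>The truncated square is dominated by a polynomial in the deviation \<open>w\<close>.
  When \<open>w\<close> has mean 0, averaging kills the linear term and leaves the variance.\<close>

lemma max_0_diff_power2_le:
  fixes a b w :: real
  assumes "a \<le> b"
  shows "(max 0 (a - w))\<^sup>2 \<le> (max 0 b)\<^sup>2 - 2 * max 0 a * w + w\<^sup>2"
proof -
  have "(max 0 (a - w))\<^sup>2 \<le> (max 0 a - w)\<^sup>2"
    by (cases "w \<le> a") (auto simp: max_def intro!: power_mono)
  moreover have "(max 0 a)\<^sup>2 \<le> (max 0 b)\<^sup>2" using assms by (intro power_mono) auto
  ultimately show ?thesis unfolding power2_diff by linarith
qed

text \<open>In the mean, \<open>bias + 1\<close> shrinks at most by the factor \<open>r\<close>, so
  the level is moved by the corresponding affine map, which fixes -1. The bias changes by 0 or 2 in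
  absolute value, so its variance is at most 4.\<close>

lemma avg_below_le:
  assumes S: "S \<in> Pow {1..n} - {{}}" and n: "n \<ge> 3"
  defines "r \<equiv> 1 - 1 / (real n - 1)"
  shows "avg n (below n (r * (l + 1) - 1)) S \<le> r\<^sup>2 * below n l S + 4"
proof -
  define h where "h = card S"
  define p q where "p = real h * (real n - h) / (real n * (real n - 1))"
    and "q = real h * (real h - 1) / (real n * (real n - 1))"
  have h: "1 \<le> h" "h \<le> n" using S card_le_n[of S n] unfolding h_def
    by (metis Diff_iff Suc_leI card_gt_0_iff finite_Pow_mem One_nat_def singletonI, auto)
  have pq: "p \<ge> 0" "q \<ge> 0" using h n by (auto simp: p_def q_def)
  have "p + q = real h * (real n - 1) / (real n * (real n - 1))"
    by (simp add: p_def q_def add_divide_distrib[symmetric] algebra_simps)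
  hence pq3: "p + q = real h / real n" using n by simp
  hence pq4: "p + q \<le> 1" using h n by simp
  define s where "s = bias n S"
  \<comment> \<open>The mean of the new bias: it drops by 2 with probability \<open>p\<close> and
    rises by 2 with probability \<open>q\<close>.\<close>
  define m where "m = s - 2 * (p - q)"
  define a where "a = r * (l + 1) - 1 - m"
  have "m - r * s + 1 / (real n - 1) = (s\<^sup>2 + s) / (real n * (real n - 1))"
    using n by (simp add: m_def r_def s_def bias_def p_def q_def h_def[symmetric] divide_simps)
      (simp add: algebra_simps power2_eq_square)
  \<comment> \<open>This is negative only strictly between -1 and 0, where there is no
    integer.\<close>
  moreover have "s\<^sup>2 + s \<ge> 0"
  proof (cases "s \<ge> 0")
    case False
    define z where "z = int n - 2 * int h"
    have sz: "s = of_int z" by (simp add: s_def bias_def z_def h_def)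
    hence "z \<le> -1" using False by auto
    hence "s \<le> -1" using sz by linarith
    hence "(-s) * (-s - 1) \<ge> 0" by (intro mult_nonneg_nonneg) auto
    thus ?thesis by (simp add: power2_eq_square algebra_simps)
  qed auto
  ultimately have "m - r * s + 1 / (real n - 1) \<ge> 0" using n by simp
  moreover have "r * (l - s) - a = m - r * s + 1 / (real n - 1)"
  proof -
    have "1 / (real n - 1) = 1 - r" by (simp add: r_def)
    thus ?thesis by (simp add: a_def algebra_simps)
  qed
  ultimately have a: "a \<le> r * (l - s)" by linarith
  define f where "f = (\<lambda>k. (max 0 (r * (l - s)))\<^sup>2 - 2 * max 0 a * ((real n - 2 * real k) - m) + ((real n - 2 * real k) - m)\<^sup>2)"
  have "avg n (below n (r * (l + 1) - 1)) S \<le> avg n (\<lambda>S. f (card S)) S"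
  proof (rule avg_mono[OF _ S])
    fix T
    show "below n (r * (l + 1) - 1) T \<le> f (card T)"
    proof -
      have "r * (l + 1) - 1 - bias n T = a - (bias n T - m)" by (simp add: a_def)
      thus ?thesis using max_0_diff_power2_le[OF a, of "bias n T - m"]
        by (simp only: below_def f_def) (simp add: bias_def)
    qed
  qed
  also have "\<dots> = radial n f h" using S n by (subst avg_radial) (auto simp: h_def)
  also have "\<dots> = (1 - (p + q)) * f h + q * f (h - 1) + p * f (h + 1)"
    unfolding pq3 by (simp add: radial_def p_def q_def add_divide_distrib)
  also have "f h = (max 0 (r * (l - s)))\<^sup>2 - 2 * max 0 a * (2 * (p - q)) + (2 * (p - q))\<^sup>2"
    by (simp add: f_def m_def s_def bias_def h_def)
  also have "f (h + 1) = (max 0 (r * (l - s)))\<^sup>2 - 2 * max 0 a * (2 * (p - q) - 2) + (2 * (p - q) - 2)\<^sup>2"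
    by (simp add: f_def m_def s_def bias_def h_def algebra_simps)
  also have "f (h - 1) = (max 0 (r * (l - s)))\<^sup>2 - 2 * max 0 a * (2 * (p - q) + 2) + (2 * (p - q) + 2)\<^sup>2"
    using h by (simp add: f_def m_def s_def bias_def h_def of_nat_diff algebra_simps)
  also have "(1 - (p + q)) * ((max 0 (r * (l - s)))\<^sup>2 - 2 * max 0 a * (2 * (p - q)) + (2 * (p - q))\<^sup>2)
      + q * ((max 0 (r * (l - s)))\<^sup>2 - 2 * max 0 a * (2 * (p - q) + 2) + (2 * (p - q) + 2)\<^sup>2)
      + p * ((max 0 (r * (l - s)))\<^sup>2 - 2 * max 0 a * (2 * (p - q) - 2) + (2 * (p - q) - 2)\<^sup>2)
     = (max 0 (r * (l - s)))\<^sup>2 + 4 * (p + q) - 4 * (p - q)\<^sup>2"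
    by (simp add: algebra_simps power2_eq_square)
  also have "\<dots> \<le> (max 0 (r * (l - s)))\<^sup>2 + 4"
  proof -
    have "A + 4 * (p + q) - 4 * z \<le> A + 4" if "0 \<le> z" for A z :: real using pq4 that by argo
    thus ?thesis by simp
  qed
  also have "(max 0 (r * (l - s)))\<^sup>2 = r\<^sup>2 * below n l S"
  proof -
    have "r \<ge> 0" using n by (simp add: r_def divide_simps)
    hence "max 0 (r * (l - s)) = r * max 0 (l - s)" by (simp add: max_mult_distrib_left)
    thus ?thesis by (simp add: below_def s_def power_mult_distrib)
  qed
  finally show ?thesis .
qed

text \<open>\<open>4 * (real n - 1)\<close> is the fixed point of \<open>v = r * v + 4\<close>,
  after \<open>r\<^sup>2\<close> is relaxed to \<open>r\<close>. The level travels with the time, so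
  that initially there is no shortfall.\<close>

lemma avg_funpow_below_le:
  assumes S: "S \<in> Pow {1..n} - {{}}" and n: "n \<ge> 3" and l: "l \<le> bias n S"
  defines "r \<equiv> 1 - 1 / (real n - 1)"
  shows "(avg n ^^ t) (below n (r ^ t * (l + 1) - 1)) S \<le> 4 * (real n - 1)"
proof (induction t)
  case 0
  show ?case using l n by (simp add: below_def)
next
  case (Suc t)
  define l' where "l' = r ^ t * (l + 1) - 1"
  have r: "0 \<le> r" "r \<le> 1" using n by (auto simp: r_def divide_simps)
  have "(avg n ^^ Suc t) (below n (r ^ Suc t * (l + 1) - 1)) S = (avg n ^^ t) (avg n (below n (r * (l' + 1) - 1))) S"
    by (simp add: funpow_swap1 l'_def mult.assoc)
  also have "\<dots> \<le> (avg n ^^ t) (\<lambda>S. r\<^sup>2 * below n l' S + 4) S"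
    unfolding r_def by (rule avg_funpow_mono[OF avg_below_le[OF _ n] S])
  also have "\<dots> = r\<^sup>2 * (avg n ^^ t) (below n l') S + 4"
    using n by (subst avg_funpow_add) (simp add: avg_funpow_cmult avg_funpow_const)
  also have "\<dots> \<le> r\<^sup>2 * (4 * (real n - 1)) + 4" using Suc by (simp add: l'_def mult_left_mono)
  also have "r\<^sup>2 * (4 * (real n - 1)) \<le> r * (4 * (real n - 1))"
    using r n by (intro mult_right_mono) (auto simp: power2_eq_square mult_left_le_one_le)
  also have "r * (4 * (real n - 1)) + 4 = 4 * (real n - 1)" using n by (simp add: r_def field_simps)
  finally show ?case by simp
qed

text \<open>The test set contains the sets of bias at most \<open>K * sqrt n\<close>, nearly all
  sets by Chernoff. From a singleton, the chain hits it only if the weight exceeds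
  \<open>n / 4\<close> at time \<open>s\<close> (Markov), or if the bias falls from at least
  \<open>n / 2\<close> to \<open>K * sqrt n\<close> in \<open>t\<close> steps (Chebyshev with
  \<open>below\<close>).\<close>

lemma worst_dist_lower:
  fixes n s t :: nat
  assumes n: "n \<ge> 3" and K: "0 < K" "K \<le> sqrt n"
  defines "L \<equiv> (1 - 1 / (real n - 1)) ^ t * (n / 2 + 1) - 1"
  assumes L: "K * sqrt n < L"
  shows "worst_dist n (s + t) \<ge>
    1 - 4 * exp (- K\<^sup>2 / 4) - 4 / n * (1 + 1 / n) ^ s - 4 * n / (L - K * sqrt n)\<^sup>2"
proof -
  define A where "A = {S \<in> Pow {1..n} - {{}}. bias n S \<le> K * sqrt n}"
  define X where "X = {1::nat}"
  have X: "X \<in> Pow {1..n} - {{}}" using n by (auto simp: X_def)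
  have n2: "n \<ge> 2" using n by simp
  have pointwise: "(avg n ^^ t) (indicator A) S \<le> 4 / n * card S + 4 * n / (L - K * sqrt n)\<^sup>2"
    if S: "S \<in> Pow {1..n} - {{}}" for S
  proof (cases "bias n S \<ge> n / 2")
    case False
    have "1 \<le> 4 / n * card S" using n False by (simp add: bias_def field_simps)
    have "(avg n ^^ t) (indicator A) S \<le> (avg n ^^ t) (\<lambda>_. 1) S"
      by (rule avg_funpow_mono[OF _ S]) (simp add: indicator_def)
    hence "(avg n ^^ t) (indicator A) S \<le> 1" using n2 by (simp add: avg_funpow_const)
    moreover have "0 \<le> 4 * n / (L - K * sqrt n)\<^sup>2" by simp
    ultimately show ?thesis using \<open>1 \<le> 4 / n * card S\<close> by linarith
  next
    case True
    have "(avg n ^^ t) (indicator A) S \<le> (avg n ^^ t) (\<lambda>S. 1 / (L - K * sqrt n)\<^sup>2 * below n L S) S"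
    proof (rule avg_funpow_mono[OF _ S])
      fix T
      show "indicator A T \<le> 1 / (L - K * sqrt n)\<^sup>2 * below n L T"
      proof (cases "T \<in> A")
        case True
        hence "(L - K * sqrt n)\<^sup>2 \<le> below n L T" unfolding below_def using L
          by (intro power_mono) (auto simp: A_def)
        thus ?thesis using True L by (simp add: field_simps)
      qed (auto simp: below_def)
    qed
    also have "\<dots> = 1 / (L - K * sqrt n)\<^sup>2 * (avg n ^^ t) (below n L) S"
      by (simp only: avg_funpow_cmult)
    also have "\<dots> \<le> 1 / (L - K * sqrt n)\<^sup>2 * (4 * (real n - 1))"
      unfolding L_def by (intro mult_left_mono avg_funpow_below_le S n True) auto
    also have "\<dots> \<le> 4 * n / (L - K * sqrt n)\<^sup>2"
      by (simp add: divide_right_mono)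
    finally have "(avg n ^^ t) (indicator A) S \<le> 4 * n / (L - K * sqrt n)\<^sup>2" .
    moreover have "0 \<le> 4 / n * card S" by simp
    ultimately show ?thesis by linarith
  qed
  have "(avg n ^^ (s + t)) (indicator A) X = (avg n ^^ s) ((avg n ^^ t) (indicator A)) X"
    by (simp add: funpow_add)
  also have "\<dots> \<le> (avg n ^^ s) (\<lambda>S. 4 / n * card S + 4 * n / (L - K * sqrt n)\<^sup>2) X"
    by (rule avg_funpow_mono[OF pointwise X])
  also have "\<dots> = 4 / n * (avg n ^^ s) (\<lambda>S. real (card S)) X + 4 * n / (L - K * sqrt n)\<^sup>2"
    using n2 by (subst avg_funpow_add) (simp only: avg_funpow_cmult avg_funpow_const)
  also have "(avg n ^^ s) (\<lambda>S. real (card S)) X \<le> (1 + 1 / n) ^ s"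
    using avg_funpow_card_le[OF n2 X, of s] by (simp add: X_def)
  finally have upper: "(avg n ^^ (s + t)) (indicator A) X \<le> 4 / n * (1 + 1 / n) ^ s + 4 * n / (L - K * sqrt n)\<^sup>2"
    by (simp add: mult_left_mono divide_right_mono)
  have "1 - 4 * exp (- K\<^sup>2 / 4) \<le> real (card A) / (2 ^ n - 1)"
  proof -
    define B where "B = {S \<in> Pow {1..n}. \<bar>bias n S\<bar> > K / sqrt n * n}"
    have g: "K / sqrt n * n = K * sqrt n" by (metis times_divide_eq_left times_divide_eq_right of_nat_0_le_iff real_div_sqrt)
    have "(Pow {1..n} - {{}}) - B \<subseteq> A" unfolding A_def B_def g by auto
    hence "card ((Pow {1..n} - {{}}) - B) \<le> card A" by (intro card_mono) (auto simp: A_def)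
    moreover have "card (Pow {1..n} - {{}::nat set}) - card B \<le> card ((Pow {1..n} - {{}}) - B)"
      by (rule diff_card_le_card_Diff) (auto simp: B_def)
    ultimately have "2 ^ n - 1 - real (card B) \<le> real (card A)"
      using card_Pow_nonempty[of n] by linarith
    moreover have "real (card B) \<le> 2 * 2 ^ n * exp (- K\<^sup>2 / 4)"
    proof -
      have "real (card B) \<le> 2 * 2 ^ n * exp (- (K / sqrt n)\<^sup>2 * n / 4)"
        unfolding B_def using K n by (intro chernoff) auto
      moreover have "- (K / sqrt n)\<^sup>2 * n / 4 = - K\<^sup>2 / 4" using n by (simp add: power_divide)
      ultimately show ?thesis by simp
    qed
    \<comment> \<open>\<open>2 ^ n - 1\<close> is at least half of \<open>2 ^ n\<close>; this pays
      for the missing zero vector.\<close>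
    moreover have "(2::real) * 2 ^ n \<le> 4 * (2 ^ n - 1)"
    proof -
      have "(2::real) ^ n \<ge> 2 ^ 1" using n by (intro power_increasing) auto
      thus ?thesis by simp
    qed
    hence "2 * 2 ^ n * exp (- K\<^sup>2 / 4) \<le> 4 * (2 ^ n - 1) * exp (- K\<^sup>2 / 4)"
      by (intro mult_right_mono) auto
    moreover have "(1 - 4 * exp (- K\<^sup>2 / 4)) * (2 ^ n - 1) = (2 ^ n - 1) - 4 * (2 ^ n - 1) * exp (- K\<^sup>2 / 4)"
      by (simp add: algebra_simps)
    ultimately have "(1 - 4 * exp (- K\<^sup>2 / 4)) * (2 ^ n - 1) \<le> real (card A)"
      by linarith
    moreover have "(2::real) ^ n - 1 > 0" using n by simp
    ultimately show ?thesis by (simp add: pos_le_divide_eq)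
  qed
  moreover have "real (card A) / (2 ^ n - 1) - (avg n ^^ (s + t)) (indicator A) X \<le> worst_dist n (s + t)"
    by (rule worst_dist_ge[OF n2 X]) (auto simp: A_def)
  ultimately show ?thesis using upper by linarith
qed

text \<open>Eventually \<open>sqrt n * r ^ t\<close> is at least half of exp (\<alpha> / 2), which
  is \<open>8 * K\<close>. The level \<open>L\<close> is then at least
  \<open>4 * (K * sqrt n) - 1\<close>, leaving a gap of at least \<open>K * sqrt n\<close> above the
  test set.\<close>

lemma worst_dist_real_lower:
  assumes a: "\<alpha> > 0"
  defines "K \<equiv> exp (\<alpha> / 2) / 16"
  shows "eventually (\<lambda>n. worst_dist_real n (3 / 2 * real n * ln (real n) - \<alpha> * real n) \<ge>
    1 - 4 * exp (- K\<^sup>2 / 4) - 4 * exp (- \<alpha> / 2) - 4 / K\<^sup>2) at_top"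
proof -
  have K: "K > 0" by (simp add: K_def)
  \<comment> \<open>The summand 1 next to the time covers the rounding of \<open>s\<close>.\<close>
  have "((\<lambda>n::real. sqrt n * exp ((n * ln n / 2 - \<alpha> * n / 2 + 1) * ln (1 - 1 / (n - 1)))) \<longlongrightarrow> exp (\<alpha> / 2)) at_top"
    by real_asymp
  from filterlim_compose[OF this filterlim_real_sequentially]
  have "eventually (\<lambda>n. sqrt n * exp ((n * ln n / 2 - \<alpha> * n / 2 + 1) * ln (1 - 1 / (real n - 1))) > exp (\<alpha> / 2) / 2) at_top"
    by (rule order_tendstoD) simp
  moreover have "eventually (\<lambda>n. real n * ln n - \<alpha> * n / 2 > 0) at_top" by real_asymp
  moreover have "eventually (\<lambda>n. real n * ln n / 2 - \<alpha> * n / 2 > 2) at_top" by real_asymp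
  moreover have "eventually (\<lambda>n. sqrt (real n) > K) at_top" by real_asymp
  moreover have "eventually (\<lambda>n. sqrt (real n) * (2 * K) > 1) at_top" using K by real_asymp
  moreover have "eventually (\<lambda>n. n \<ge> (3::nat)) at_top" by (rule eventually_ge_at_top)
  ultimately show ?thesis
  proof eventually_elim
    case (elim n)
    define s where "s = nat \<lfloor>real n * ln n - \<alpha> * n / 2\<rfloor>"
    define T where "T = nat \<lfloor>3 / 2 * real n * ln (real n) - \<alpha> * real n\<rfloor>"
    define t where "t = T - s"
    define r where "r = 1 - 1 / (real n - 1)"
    have r: "0 < r" "r \<le> 1" using elim by (auto simp: r_def divide_simps)
    have s1: "real s \<le> real n * ln n - \<alpha> * n / 2" "real s \<ge> real n * ln n - \<alpha> * n / 2 - 1"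
      using nat_floor_bounds[of "real n * ln n - \<alpha> * n / 2"] elim by (simp_all add: s_def)
    have T1: "real T \<le> 3 / 2 * real n * ln n - \<alpha> * n" "real T \<ge> 3 / 2 * real n * ln n - \<alpha> * n - 1"
    proof -
      have "3 / 2 * real n * ln n - \<alpha> * n = (real n * ln n - \<alpha> * n / 2) + (real n * ln n / 2 - \<alpha> * n / 2)"
        by simp
      hence "0 \<le> 3 / 2 * real n * ln n - \<alpha> * n" using elim by linarith
      from nat_floor_bounds[OF this] show "real T \<le> 3 / 2 * real n * ln n - \<alpha> * n"
        "real T \<ge> 3 / 2 * real n * ln n - \<alpha> * n - 1" by (simp_all only: T_def)
    qed
    have "real s \<le> real T" using s1 T1 elim by linarith
    hence t: "T = s + t" "real t \<le> n * ln n / 2 - \<alpha> * n / 2 + 1"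
      using s1 T1 by (auto simp: t_def of_nat_diff)
    have "exp (real t * ln r) \<ge> exp ((n * ln n / 2 - \<alpha> * n / 2 + 1) * ln r)"
      using r t by (simp add: mult_right_mono_neg)
    hence "r ^ t \<ge> exp ((n * ln n / 2 - \<alpha> * n / 2 + 1) * ln r)"
      using r by (simp add: exp_of_nat_mult)
    hence "sqrt n * r ^ t \<ge> sqrt n * exp ((n * ln n / 2 - \<alpha> * n / 2 + 1) * ln r)"
      by (intro mult_left_mono) auto
    hence "sqrt n * r ^ t \<ge> exp (\<alpha> / 2) / 2" using elim(1) unfolding r_def[symmetric] by linarith
    hence "sqrt n * (sqrt n * r ^ t) \<ge> sqrt n * (8 * K)" by (intro mult_left_mono) (auto simp: K_def)
    moreover have "sqrt n * (sqrt n * r ^ t) = n * r ^ t" by (simp add: mult.assoc[symmetric])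
    ultimately have "n * r ^ t \<ge> 8 * (K * sqrt n)" by (simp add: mult_ac)
    moreover have "r ^ t * (n / 2 + 1) - 1 = n * r ^ t / 2 + r ^ t - 1" by (simp add: algebra_simps)
    moreover have "r ^ t \<ge> 0" using r by simp
    ultimately have "r ^ t * (n / 2 + 1) - 1 \<ge> 4 * (K * sqrt n) - 1" by linarith
    moreover have "2 * (K * sqrt n) > 1" using elim by (simp add: mult_ac)
    ultimately have L: "r ^ t * (n / 2 + 1) - 1 - K * sqrt n \<ge> K * sqrt n" by linarith
    have pos: "K * sqrt n > 0" using K elim by simp
    have "worst_dist n (s + t) \<ge> 1 - 4 * exp (- K\<^sup>2 / 4) - 4 / n * (1 + 1 / n) ^ s
       - 4 * n / (r ^ t * (n / 2 + 1) - 1 - K * sqrt n)\<^sup>2"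
      unfolding r_def
    proof (rule worst_dist_lower)
      show "K * sqrt n < (1 - 1 / (real n - 1)) ^ t * (n / 2 + 1) - 1"
        using L pos unfolding r_def by linarith
    qed (use elim K in auto)
    moreover have "4 / n * (1 + 1 / n) ^ s \<le> 4 * exp (- \<alpha> / 2)"
    proof -
      have "(1 + 1 / real n) ^ s \<le> exp (1 / n) ^ s" by (intro power_mono exp_ge_add_one_self) auto
      also have "\<dots> = exp (real s / n)" by (simp add: exp_of_nat_mult[symmetric])
      also have "\<dots> \<le> exp (ln n - \<alpha> / 2)" using s1 elim by (simp add: field_simps)
      also have "\<dots> = n * exp (- \<alpha> / 2)" using elim exp_add[of "ln (real n)" "- \<alpha> / 2"] by simp
      finally show ?thesis using elim by (simp add: field_simps)
    qed
    moreover have "4 * n / (r ^ t * (n / 2 + 1) - 1 - K * sqrt n)\<^sup>2 \<le> 4 / K\<^sup>2"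
    proof -
      have "(K * sqrt n)\<^sup>2 \<le> (r ^ t * (n / 2 + 1) - 1 - K * sqrt n)\<^sup>2"
        using L pos by (intro power_mono) auto
      hence "4 * n / (r ^ t * (n / 2 + 1) - 1 - K * sqrt n)\<^sup>2 \<le> 4 * n / (K * sqrt n)\<^sup>2"
        using pos L K elim by (intro divide_left_mono mult_pos_pos zero_less_power) (linarith | simp)+
      also have "\<dots> = 4 / K\<^sup>2" using elim by (simp add: power_mult_distrib)
      finally show ?thesis .
    qed
    moreover have "worst_dist_real n (3 / 2 * real n * ln (real n) - \<alpha> * real n) = worst_dist n (s + t)"
      unfolding worst_dist_real_def T_def[symmetric] t(1) ..
    ultimately show ?case by linarith
  qed
qed

lemma cutoff_lower:
  "((\<lambda>\<alpha>::real. liminf (\<lambda>n. ereal (worst_dist_real n (3 / 2 * real n * ln (real n) - \<alpha> * real n)))) \<longlongrightarrow> 1) at_top"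
proof (rule tendsto_sandwich)
  define g where "g = (\<lambda>\<alpha>::real. 1 - 4 * exp (- (exp (\<alpha> / 2) / 16)\<^sup>2 / 4) - 4 * exp (- \<alpha> / 2) - 4 / (exp (\<alpha> / 2) / 16)\<^sup>2)"
  have "(g \<longlongrightarrow> 1) at_top" unfolding g_def by real_asymp
  thus "((\<lambda>\<alpha>. ereal (g \<alpha>)) \<longlongrightarrow> 1) at_top" by (simp add: one_ereal_def)
  show "\<forall>\<^sub>F \<alpha> in at_top. ereal (g \<alpha>) \<le> liminf (\<lambda>n. ereal (worst_dist_real n (3 / 2 * real n * ln (real n) - \<alpha> * real n)))"
    using eventually_gt_at_top[of 0]
  proof eventually_elim
    case (elim \<alpha>)
    show ?case by (rule Liminf_bounded) (use worst_dist_real_lower[OF elim] in \<open>simp add: g_def\<close>)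
  qed
  show "\<forall>\<^sub>F \<alpha> in at_top. liminf (\<lambda>n. ereal (worst_dist_real n (3 / 2 * real n * ln (real n) - \<alpha> * real n))) \<le> 1"
  proof (intro always_eventually allI)
    fix \<alpha> :: real
    have "eventually (\<lambda>n. ereal (worst_dist_real n (3 / 2 * real n * ln (real n) - \<alpha> * real n)) \<le> 1) at_top"
      using eventually_ge_at_top[of "2::nat"]
      by eventually_elim (simp add: worst_dist_real_def worst_dist_le_1)
    hence "limsup (\<lambda>n. ereal (worst_dist_real n (3 / 2 * real n * ln (real n) - \<alpha> * real n))) \<le> 1"
      by (rule Limsup_bounded)
    thus "liminf (\<lambda>n. ereal (worst_dist_real n (3 / 2 * real n * ln (real n) - \<alpha> * real n))) \<le> 1"
      by (rule order_trans[OF Liminf_le_Limsup[OF sequentially_bot]])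
  qed
qed simp

section \<open>Burn-in\<close>

text \<open>
  The function \<open>decay\<close>, of order \<open>1 / sqrt h\<close>, is an approximate eigenfunction of the weight chain
  for the eigenvalue \<open>1 - 1 / (2 n)\<close>; it controls the time at which the weight becomes linear in \<open>n\<close>.
\<close>

definition decay :: "nat \<Rightarrow> real" where
  "decay h = (\<Prod>i=1..<h. 1 - 1 / (2 * real i))"

lemma decay_1 [simp]: "decay 1 = 1"
  by (simp add: decay_def)

lemma decay_Suc: "h \<ge> 1 \<Longrightarrow> decay (Suc h) = decay h * (1 - 1 / (2 * real h))"
  by (simp add: decay_def prod.atLeastLessThan_Suc)

lemma decay_pos: "decay h > 0"
  unfolding decay_def by (rule prod_pos) (auto simp: field_simps)

lemma decay_le_1: "decay h \<le> 1"
  unfolding decay_def by (rule prod_le_1) (auto simp: field_simps)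

text \<open>A Wallis-type bound: \<open>decay h\<close> is the central binomial coefficient of order
  \<open>h - 1\<close> divided by \<open>4 ^ (h - 1)\<close>. The companion lower bound is
  \<open>decay_lower\<close>; both are equalities at \<open>h = 1\<close>.\<close>

lemma decay_upper: "h \<ge> 1 \<Longrightarrow> (decay h)\<^sup>2 * h \<le> 1"
proof (induction h rule: dec_induct)
  case (step h)
  have "(1 - 1 / (2 * real h))\<^sup>2 * (h + 1) \<le> h"
  proof -
    have "(2 * real h - 1)\<^sup>2 * (h + 1) \<le> 4 * real h ^ 3"
      using step(1) by (simp add: power2_eq_square power3_eq_cube algebra_simps)
    moreover have "(1 - 1 / (2 * real h))\<^sup>2 = (2 * real h - 1)\<^sup>2 / (4 * (real h)\<^sup>2)"
      using step(1) by (simp add: field_simps power2_eq_square)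
    ultimately show ?thesis
      using step(1) by (simp add: field_simps power2_eq_square power3_eq_cube)
  qed
  hence "(decay h)\<^sup>2 * ((1 - 1 / (2 * real h))\<^sup>2 * (h + 1)) \<le> (decay h)\<^sup>2 * h"
    by (intro mult_left_mono) auto
  thus ?case using step by (simp add: decay_Suc power_mult_distrib mult_ac add.commute)
qed simp

lemma decay_lower: "h \<ge> 1 \<Longrightarrow> 1 \<le> (decay h)\<^sup>2 * (4 * h - 3)"
proof (induction h rule: dec_induct)
  case (step h)
  have "4 * real h - 3 \<le> (1 - 1 / (2 * real h))\<^sup>2 * (4 * h + 1)"
  proof -
    have "4 * (real h)\<^sup>2 * (4 * real h - 3) \<le> (2 * real h - 1)\<^sup>2 * (4 * real h + 1)"
      by (simp add: power2_eq_square algebra_simps)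
    moreover have "(1 - 1 / (2 * real h))\<^sup>2 = (2 * real h - 1)\<^sup>2 / (4 * (real h)\<^sup>2)"
      using step(1) by (simp add: field_simps power2_eq_square)
    moreover have "4 * (real h)\<^sup>2 > 0" using step(1) by simp
    ultimately show ?thesis by (simp add: field_simps)
  qed
  note * = this
  have "1 \<le> (decay h)\<^sup>2 * (4 * real h - 3)" using step by simp
  also have "(decay h)\<^sup>2 * (4 * real h - 3) \<le> (decay h)\<^sup>2 * ((1 - 1 / (2 * real h))\<^sup>2 * (4 * h + 1))"
    using * by (intro mult_left_mono) auto
  also have "\<dots> = (decay (Suc h))\<^sup>2 * (4 * real (Suc h) - 3)"
    using step by (simp add: decay_Suc power_mult_distrib mult_ac)
  finally show ?case by simp
qed simp

text \<open>An upward step occurs at rate about \<open>h / n\<close> and multiplies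
  \<open>decay h\<close> by \<open>1 - 1 / (2 * h)\<close>, which combines to the rate
  \<open>1 / (2 * n)\<close> independently of \<open>h\<close>. The remainder is of order
  \<open>h * decay h / n\<^sup>2\<close>, where \<open>h * decay h\<close> is at most
  \<open>sqrt n\<close> by \<open>decay_upper\<close>.\<close>

lemma radial_decay_le:
  assumes h: "1 \<le> h" "h \<le> n" and n: "n \<ge> 2"
  shows "radial n decay h \<le> (1 - 1 / (2 * real n)) * decay h + 3 / 2 * sqrt n / (real n * (real n - 1))"
proof -
  define N where "N = real n * (real n - 1)"
  have N: "N > 0" using n by (simp add: N_def)
  have down: "real h * (real h - 1) * decay (h - 1) \<le> (real h)\<^sup>2 * decay h"
  proof (cases "h = 1")
    case False
    define k where "k = h - 1"
    have k: "k \<ge> 1" "h = Suc k" using h False by (auto simp: k_def)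
    have dk: "decay h = decay k * (1 - 1 / (2 * real k))" using k by (simp add: decay_Suc)
    have "1 * 1 \<le> real k * real k" using k by (intro mult_mono) auto
    hence "real h * real k \<le> (real h)\<^sup>2 * (1 - 1 / (2 * real k))"
      using k by (simp add: field_simps power2_eq_square)
    hence "real h * real k * decay k \<le> (real h)\<^sup>2 * (1 - 1 / (2 * real k)) * decay k"
      using decay_pos[of k] by (intro mult_right_mono) auto
    thus ?thesis using k dk by (simp add: mult_ac)
  qed (simp add: decay_pos less_imp_le)
  have up: "real h * (real n - h) * decay (h + 1) = (real n - h) * (real h - 1 / 2) * decay h"
  proof -
    have "real h * decay (h + 1) = (real h - 1 / 2) * decay h"
      using h decay_Suc[of h] by (simp add: Suc_eq_plus1 field_simps)
    thus ?thesis by (simp add: mult_ac)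
  qed
  have "radial n decay h \<le> (1 - real h / real n) * decay h +
      ((real h)\<^sup>2 * decay h + (real n - h) * (real h - 1 / 2) * decay h) / N"
    unfolding radial_def up N_def[symmetric] using down N by (intro add_left_mono divide_right_mono add_right_mono) auto
  also have "\<dots> = (1 - 1 / (2 * real n)) * decay h + (3 * real h - 1) / 2 * decay h / N"
    using n by (simp add: N_def divide_simps) (simp add: algebra_simps power2_eq_square)
  also have "(3 * real h - 1) / 2 * decay h / N \<le> 3 / 2 * sqrt n / N"
  proof (intro divide_right_mono)
    have "real h * decay h \<le> sqrt n"
    proof (rule real_le_rsqrt)
      have "(real h * decay h)\<^sup>2 = (decay h)\<^sup>2 * h * h" by (simp add: power2_eq_square mult_ac)
      also have "\<dots> \<le> 1 * real h" using decay_upper[OF h(1)] by (intro mult_right_mono) auto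
      finally show "(real h * decay h)\<^sup>2 \<le> n" using h by simp
    qed
    moreover have "(3 * real h - 1) / 2 * decay h = 3 / 2 * (real h * decay h) - decay h / 2"
      by (simp add: field_simps)
    ultimately show "(3 * real h - 1) / 2 * decay h \<le> 3 / 2 * sqrt n"
      using decay_pos[of h] by linarith
  qed (use N in auto)
  finally show ?thesis by (simp add: N_def)
qed

lemma card_nonempty: "S \<in> Pow {1..n::nat} - {{}} \<Longrightarrow> 1 \<le> card S"
  by (metis Diff_iff Suc_leI card_gt_0_iff finite_Pow_mem One_nat_def singletonI)

text \<open>After \<open>n * ln n\<close> steps the mean of \<open>decay\<close> is of order
  \<open>1 / sqrt n\<close>, its size at weights linear in \<open>n\<close>. Markov's inequality
  excludes smaller weights, but with an error that is small only in \<open>e\<close>.\<close>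

lemma prob_card_small:
  assumes n: "n \<ge> 2" and X: "X \<in> Pow {1..n} - {{}}" and e: "e > 0" and t: "real n * ln n \<le> real t"
  shows "(avg n ^^ t) (indicator {S. real (card S) < e * n}) X \<le> 14 * sqrt e"
proof -
  define c where "c = 3 / 2 * sqrt n / (real n * (real n - 1))"
  have c: "c \<ge> 0" using n by (simp add: c_def)
  have "(avg n ^^ t) (\<lambda>S. decay (card S)) X \<le> (1 - 1 / (2 * real n)) ^ t * decay (card X) + c * 1 / (1 - (1 - 1 / (2 * real n)))"
  proof (rule avg_funpow_affine[OF n, where G = "\<lambda>_. 1"])
    fix S assume S: "S \<in> Pow {1..n} - {{}}"
    have "avg n (\<lambda>S. decay (card S)) S = radial n decay (card S)"
      using S n by (intro avg_radial) auto
    also have "\<dots> \<le> (1 - 1 / (2 * real n)) * decay (card S) + c"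
      unfolding c_def using card_nonempty[OF S] card_le_n[of S n] S n by (intro radial_decay_le) auto
    finally show "avg n (\<lambda>S. decay (card S)) S \<le> (1 - 1 / (2 * real n)) * decay (card S) + c * 1" by simp
  qed (use n c X in \<open>auto simp: avg_funpow_const field_simps\<close>)
  also have "(1 - 1 / (2 * real n)) ^ t * decay (card X) \<le> 1 / sqrt n"
  proof -
    have "(1 - 1 / (2 * real n)) ^ t \<le> exp (- 1 / (2 * real n)) ^ t"
      using n exp_ge_add_one_self[of "- 1 / (2 * real n)"] by (intro power_mono) (auto simp: field_simps)
    also have "\<dots> = exp (- real t / (2 * real n))" by (simp add: exp_of_nat_mult[symmetric])
    also have "\<dots> \<le> exp (- ln n / 2)" using t n by (simp add: field_simps)
    also have "\<dots> = 1 / exp (ln n / 2)" by (simp add: exp_minus field_simps)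
    also have "exp (ln n / 2) = sqrt n" using n by (simp add: ln_sqrt[symmetric])
    finally have 1: "(1 - 1 / (2 * real n)) ^ t \<le> 1 / sqrt n" .
    have 0: "0 \<le> (1 - 1 / (2 * real n)) ^ t" using n by (intro zero_le_power) (simp add: field_simps)
    show ?thesis using mult_mono[OF 1 decay_le_1[of "card X"]] decay_pos[of "card X"] 0 by simp
  qed
  also have "c * 1 / (1 - (1 - 1 / (2 * real n))) \<le> 6 / sqrt n"
  proof -
    have "c * 1 / (1 - (1 - 1 / (2 * real n))) = 3 * sqrt n / (real n - 1)"
      using n by (simp add: c_def field_simps)
    also have "\<dots> \<le> 3 * sqrt n / (real n / 2)" using n by (intro divide_left_mono) auto
    also have "\<dots> = 6 / sqrt n" using n by (simp add: field_simps)
    finally show ?thesis .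
  qed
  finally have *: "(avg n ^^ t) (\<lambda>S. decay (card S)) X \<le> 7 / sqrt n" by simp
  have "(avg n ^^ t) (indicator {S. real (card S) < e * n}) X \<le> (avg n ^^ t) (\<lambda>S. 2 * sqrt (e * n) * decay (card S)) X"
  proof (rule avg_funpow_mono[OF _ X])
    fix S assume S: "S \<in> Pow {1..n} - {{}}"
    show "indicator {S. real (card S) < e * n} S \<le> 2 * sqrt (e * n) * decay (card S)"
    proof (cases "real (card S) < e * n")
      case True
      have "1 \<le> (decay (card S))\<^sup>2 * (4 * card S - 3)" by (rule decay_lower[OF card_nonempty[OF S]])
      also have "\<dots> \<le> (decay (card S))\<^sup>2 * (4 * (e * n))"
        using True card_nonempty[OF S] by (intro mult_left_mono) auto
      also have "\<dots> = (2 * sqrt (e * n) * decay (card S))\<^sup>2"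
        using e by (simp add: power_mult_distrib)
      finally have "1\<^sup>2 \<le> (2 * sqrt (e * n) * decay (card S))\<^sup>2" by simp
      hence "1 \<le> 2 * sqrt (e * n) * decay (card S)"
        by (rule power2_le_imp_le) (use decay_pos[of "card S"] e in simp)
      thus ?thesis using True by simp
    qed (use decay_pos[of "card S"] e in simp)
  qed
  also have "\<dots> = 2 * sqrt (e * n) * (avg n ^^ t) (\<lambda>S. decay (card S)) X"
    by (simp only: avg_funpow_cmult)
  also have "\<dots> \<le> 2 * sqrt (e * n) * (7 / sqrt n)" using * e by (intro mult_left_mono) auto
  also have "\<dots> = 14 * sqrt e" using n by (simp add: real_sqrt_mult)
  finally show ?thesis .
qed

section \<open>Balance on a fixed set of coordinates\<close>

definition part_bias :: "nat set \<Rightarrow> nat set \<Rightarrow> real" where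
  "part_bias B S = real (card B) - 2 * real (card (S \<inter> B))"

text \<open>Every element is removed or inserted at nearly the same rate, so the imbalance is pulled
  towards 0 with a strength proportional to the weight. The other terms are at most
  \<open>8 * n\<^sup>2\<close> before division by \<open>n * (n - 1)\<close>, hence 16.\<close>

lemma avg_part_bias_power2:
  assumes B: "B \<subseteq> {1..n}" and S: "S \<in> Pow {1..n}" and n: "n \<ge> 2"
  shows "avg n (\<lambda>S. (part_bias B S)\<^sup>2) S \<le>
    (part_bias B S)\<^sup>2 * (1 - 4 * card S / (real n * (real n - 1))) + 16"
proof -
  have fB: "finite B" and fS: "finite S" using B S by (auto intro: finite_subset)
  define D where "D = part_bias B S"
  define N where "N = real n * (real n - 1)"
  have N: "N > 0" using n by (simp add: N_def)
  define b s h where "b = real (card B)" and "s = real (card (S \<inter> B))" and "h = real (card S)"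
  have D: "D = b - 2 * s" by (simp add: D_def part_bias_def b_def s_def)
  have bounds: "0 \<le> s" "s \<le> b" "s \<le> h" "h \<le> n" "b \<le> n"
    using card_mono[OF fB, of "S \<inter> B"] card_mono[OF fS, of "S \<inter> B"] card_le_n[OF S] card_mono[OF _ B]
    by (auto simp: b_def s_def h_def)
  have "(\<Sum>j\<in>S. (part_bias B (S - {j}))\<^sup>2) = (\<Sum>j\<in>S. D\<^sup>2 + (if j \<in> B then 4 * D + 4 else 0))"
  proof (rule sum.cong[OF refl])
    fix j assume j: "j \<in> S"
    have "part_bias B (S - {j}) = D + (if j \<in> B then 2 else 0)"
    proof (cases "j \<in> B")
      case True
      have "card (S \<inter> B) = Suc (card ((S - {j}) \<inter> B))"
        using True j fS card.remove[of "S \<inter> B" j] by (simp add: Int_Diff Diff_Int_distrib2 Int_commute)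
      thus ?thesis using True by (simp add: D_def part_bias_def)
    next
      case False
      hence "(S - {j}) \<inter> B = S \<inter> B" by auto
      thus ?thesis using False by (simp add: D_def part_bias_def)
    qed
    thus "(part_bias B (S - {j}))\<^sup>2 = D\<^sup>2 + (if j \<in> B then 4 * D + 4 else 0)"
      by (simp add: power2_eq_square algebra_simps)
  qed
  also have "\<dots> = h * D\<^sup>2 + s * (4 * D + 4)"
    using fS by (simp add: sum.distrib sum.If_cases h_def s_def Int_def)
  finally have 1: "(\<Sum>j\<in>S. (part_bias B (S - {j}))\<^sup>2) = h * D\<^sup>2 + s * (4 * D + 4)" .
  have "(\<Sum>j\<in>{1..n}-S. (part_bias B (insert j S))\<^sup>2) = (\<Sum>j\<in>{1..n}-S. D\<^sup>2 + (if j \<in> B then 4 - 4 * D else 0))"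
  proof (rule sum.cong[OF refl])
    fix j assume j: "j \<in> {1..n} - S"
    hence *: "part_bias B (insert j S) = D - (if j \<in> B then 2 else 0)"
      using fS by (auto simp: D_def part_bias_def)
    show "(part_bias B (insert j S))\<^sup>2 = D\<^sup>2 + (if j \<in> B then 4 - 4 * D else 0)"
      unfolding * by (simp add: power2_eq_square algebra_simps)
  qed
  also have "\<dots> = (n - h) * D\<^sup>2 + (b - s) * (4 - 4 * D)"
  proof -
    have "({1..n} - S) \<inter> {j. j \<in> B} = B - (S \<inter> B)" using B by auto
    moreover have "real (card (B - (S \<inter> B))) = b - s"
      using fB bounds by (simp add: card_Diff_subset of_nat_diff b_def s_def)
    moreover have "real (card ({1..n} - S)) = n - h"
      using S fS bounds by (simp add: card_Diff_subset of_nat_diff h_def)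
    ultimately show ?thesis by (simp add: sum.distrib sum.If_cases)
  qed
  finally have 2: "(\<Sum>j\<in>{1..n}-S. (part_bias B (insert j S))\<^sup>2) = (n - h) * D\<^sup>2 + (b - s) * (4 - 4 * D)" .
  have "avg n (\<lambda>S. (part_bias B S)\<^sup>2) S = (1 - h / n) * D\<^sup>2 +
     ((h - 1) * (h * D\<^sup>2 + s * (4 * D + 4)) + h * ((n - h) * D\<^sup>2 + (b - s) * (4 - 4 * D))) / N"
    using S n by (simp add: avg_formula 1 2 D_def N_def h_def)
  also have "\<dots> = D\<^sup>2 + ((h - 1) * (s * (4 * D + 4)) + h * ((b - s) * (4 - 4 * D))) / N"
    using n by (simp add: N_def divide_simps) (simp add: algebra_simps)
  also have "(h - 1) * (s * (4 * D + 4)) + h * ((b - s) * (4 - 4 * D)) = - 4 * h * D\<^sup>2 + (4 * h * b + 4 * s * (- D - 1))"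
    unfolding D by (simp add: algebra_simps power2_eq_square)
  also have "D\<^sup>2 + (- 4 * h * D\<^sup>2 + (4 * h * b + 4 * s * (- D - 1))) / N =
     D\<^sup>2 * (1 - 4 * h / N) + (4 * h * b + 4 * s * (- D - 1)) / N"
    using N by (simp add: field_simps)
  also have "(4 * h * b + 4 * s * (- D - 1)) / N \<le> 16"
  proof -
    have "h * b \<le> real n * real n" using bounds by (intro mult_mono) auto
    moreover have "s * (- D - 1) \<le> real n * real n"
    proof -
      have "s * (- D - 1) \<le> s * n" using bounds by (intro mult_left_mono) (auto simp: D)
      also have "\<dots> \<le> real n * real n" using bounds by (intro mult_right_mono) auto
      finally show ?thesis .
    qed
    ultimately have "4 * h * b + 4 * s * (- D - 1) \<le> 8 * (real n * n)" by simp
    also have "\<dots> \<le> 16 * N" using n by (simp add: N_def algebra_simps)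
    finally show ?thesis using N by (simp add: field_simps)
  qed
  finally show ?thesis by (simp add: D_def N_def h_def)
qed

text \<open>While the weight is at least \<open>e * n\<close>, the squared imbalance contracts by
  \<open>r\<close>. A smaller weight has probability at most \<open>w\<close> at each time from
  \<open>s\<close> on, so it only raises the equilibrium level.\<close>

lemma prob_part_bias:
  assumes n: "n \<ge> 2" and X: "X \<in> Pow {1..n} - {{}}" and B: "B \<subseteq> {1..n}"
    and e: "0 < e" "e \<le> 1 / 4" and g: "g > 0" and s: "real n * ln n \<le> real s"
  shows "(avg n ^^ (s + t)) (indicator {S. \<bar>part_bias B S\<bar> > g * n}) X \<le>
    (exp (- 4 * e * t / n) + 4 / (e * n) + 14 * sqrt e) / g\<^sup>2"
proof -
  define r where "r = 1 - 4 * e / n"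
  have r: "0 \<le> r" "r < 1" using e n by (auto simp: r_def field_simps)
  define w where "w = 14 * sqrt e"
  have w: "w \<ge> 0" using e by (simp add: w_def)
  define a where "a = (\<lambda>t. (avg n ^^ (s + t)) (\<lambda>S. (part_bias B S)\<^sup>2) X)"
  have pb: "(part_bias B S)\<^sup>2 \<le> (real n)\<^sup>2" if "S \<in> Pow {1..n}" for S
  proof (rule power2_le_iff_abs_le[THEN iffD2])
    have "finite B" using B finite_subset by auto
    thus "\<bar>part_bias B S\<bar> \<le> real n"
      using card_mono[of B "S \<inter> B"] card_mono[OF _ B] unfolding part_bias_def by auto
  qed simp
  have step: "avg n (\<lambda>S. (part_bias B S)\<^sup>2) S \<le> (r * (part_bias B S)\<^sup>2 + 16) + 4 * e * n * indicator {S. real (card S) < e * n} S"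
    if S: "S \<in> Pow {1..n} - {{}}" for S
  proof -
    define Q where "Q = (part_bias B S)\<^sup>2"
    have Q: "0 \<le> Q" "Q \<le> (real n)\<^sup>2" using pb S by (auto simp: Q_def)
    have *: "avg n (\<lambda>S. (part_bias B S)\<^sup>2) S \<le> Q * (1 - 4 * card S / (real n * (real n - 1))) + 16"
      unfolding Q_def using avg_part_bias_power2[OF B _ n, of S] S by simp
    show ?thesis
    proof (cases "real (card S) < e * n")
      case True
      have "Q * (1 - 4 * card S / (real n * (real n - 1))) \<le> Q * 1"
        using Q n by (intro mult_left_mono) auto
      moreover have "Q * (4 * e / n) \<le> (real n)\<^sup>2 * (4 * e / n)" using Q e by (intro mult_right_mono) auto
      moreover have "(real n)\<^sup>2 * (4 * e / n) = 4 * e * n" using n by (simp add: power2_eq_square)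
      ultimately show ?thesis using * True by (simp add: r_def Q_def algebra_simps)
    next
      case False
      have "4 * e / n \<le> 4 * card S / (real n * (real n - 1))"
      proof -
        have "4 * e / n = 4 * (e * n) / (real n * real n)" using n by simp
        also have "\<dots> \<le> 4 * card S / (real n * (real n - 1))"
          using False n e by (intro frac_le) auto
        finally show ?thesis .
      qed
      hence "Q * (1 - 4 * card S / (real n * (real n - 1))) \<le> Q * r"
        using Q by (intro mult_left_mono) (auto simp: r_def)
      thus ?thesis using * False by (simp add: Q_def mult.commute)
    qed
  qed
  \<comment> \<open>The bracket is the fixed point of
    \<open>v = r * v + 16 + 4 * e * n * w\<close>.\<close>
  have a: "a t \<le> r ^ t * (real n)\<^sup>2 + (4 * n / e + w * (real n)\<^sup>2)" for t
  proof (induction t)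
    case 0
    have "a 0 \<le> (avg n ^^ s) (\<lambda>_. (real n)\<^sup>2) X" unfolding a_def add_0_right
      by (rule avg_funpow_mono[OF _ X]) (use pb in auto)
    also have "\<dots> = (real n)\<^sup>2" using n by (simp add: avg_funpow_const)
    finally show ?case using e w by (simp add: add_increasing2)
  next
    case (Suc t)
    have "a (Suc t) = (avg n ^^ (s + t)) (avg n (\<lambda>S. (part_bias B S)\<^sup>2)) X"
      by (simp add: a_def funpow_swap1)
    also have "\<dots> \<le> (avg n ^^ (s + t)) (\<lambda>S. (r * (part_bias B S)\<^sup>2 + 16) + 4 * e * n * indicator {S. real (card S) < e * n} S) X"
      by (rule avg_funpow_mono[OF step X])
    also have "\<dots> = r * a t + 16 + 4 * e * n * (avg n ^^ (s + t)) (indicator {S. real (card S) < e * n}) X"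
      using n by (simp only: avg_funpow_add avg_funpow_cmult avg_funpow_const a_def)
    also have "\<dots> \<le> r * (r ^ t * (real n)\<^sup>2 + (4 * n / e + w * (real n)\<^sup>2)) + 16 + 4 * e * n * w"
      unfolding w_def using r e s n by (intro add_mono mult_left_mono Suc[unfolded w_def] prob_card_small X) auto
    also have "\<dots> = r ^ Suc t * (real n)\<^sup>2 + (4 * n / e + w * (real n)\<^sup>2)"
      using n e by (simp add: r_def field_simps power2_eq_square)
    finally show ?case .
  qed
  have rt: "r ^ t \<le> exp (- 4 * e * t / n)"
  proof -
    have "r ^ t \<le> exp (- 4 * e / n) ^ t"
      using r exp_ge_add_one_self[of "- 4 * e / n"] by (intro power_mono) (auto simp: r_def)
    thus ?thesis by (simp add: exp_of_nat_mult[symmetric] mult_ac)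
  qed
  have gn: "(g * n)\<^sup>2 > 0" using g n by simp
  have "(avg n ^^ (s + t)) (indicator {S. \<bar>part_bias B S\<bar> > g * n}) X \<le>
    (avg n ^^ (s + t)) (\<lambda>S. 1 / (g * n)\<^sup>2 * (part_bias B S)\<^sup>2) X"
  proof (rule avg_funpow_mono[OF _ X])
    fix S
    show "indicator {S. \<bar>part_bias B S\<bar> > g * n} S \<le> 1 / (g * n)\<^sup>2 * (part_bias B S)\<^sup>2"
    proof (cases "\<bar>part_bias B S\<bar> > g * n")
      case True
      hence "(g * n)\<^sup>2 \<le> \<bar>part_bias B S\<bar>\<^sup>2" using g by (intro power_mono) auto
      thus ?thesis using True gn by (simp add: field_simps)
    qed simp
  qed
  also have "\<dots> = 1 / (g * n)\<^sup>2 * a t" by (simp only: avg_funpow_cmult a_def)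
  also have "\<dots> \<le> 1 / (g * n)\<^sup>2 * (exp (- 4 * e * t / n) * (real n)\<^sup>2 + (4 * n / e + w * (real n)\<^sup>2))"
  proof (intro mult_left_mono order_trans[OF a[of t]] add_right_mono)
    show "r ^ t * (real n)\<^sup>2 \<le> exp (- 4 * e * t / n) * (real n)\<^sup>2"
      by (rule mult_right_mono[OF rt]) simp
  qed simp
  also have "\<dots> = (exp (- 4 * e * t / n) + 4 / (e * n) + 14 * sqrt e) / g\<^sup>2"
    using n g e by (simp add: w_def field_simps power2_eq_square)
  finally show ?thesis .
qed

text \<open>
  Transition probabilities from \<open>X\<close> to \<open>S\<close> only depend on the sizes of \<open>S \<inter> X\<close> and \<open>S - X\<close>.
  All sets with the same sizes are thus equally likely, which bounds the density of the law.
\<close>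

lemma avg_two_class:
  assumes X: "X \<subseteq> {1..n}" and n: "n \<ge> 2"
    and F: "\<And>S. S \<in> Pow {1..n} \<Longrightarrow> F S = f (card (S \<inter> X)) (card (S - X))"
  shows "\<exists>f'. \<forall>S\<in>Pow {1..n}. avg n F S = f' (card (S \<inter> X)) (card (S - X))"
proof (intro exI ballI)
  fix S assume S: "S \<in> Pow {1..n}"
  have fin: "finite S" "finite X" using S X by (auto intro: finite_subset)
  define a b where "a = card (S \<inter> X)" and "b = card (S - X)"
  have h: "card S = a + b" unfolding a_def b_def
    using fin by (subst card_Un_disjoint[symmetric]) (auto simp: Int_Un_distrib2 intro: arg_cong[of _ _ card])
  have "(\<Sum>j\<in>S. F (S - {j})) = (\<Sum>j\<in>S. if j \<in> X then f (a - 1) b else f a (b - 1))"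
  proof (rule sum.cong[OF refl])
    fix j assume j: "j \<in> S"
    have "(S - {j}) \<inter> X = (if j \<in> X then S \<inter> X - {j} else S \<inter> X)"
      "(S - {j}) - X = (if j \<in> X then S - X else S - X - {j})" by auto
    thus "F (S - {j}) = (if j \<in> X then f (a - 1) b else f a (b - 1))"
      using j S fin by (subst F) (auto simp: a_def b_def)
  qed
  also have "\<dots> = a * f (a - 1) b + b * f a (b - 1)"
    using fin by (simp add: sum.If_cases a_def b_def Int_def Diff_eq)
  finally have 1: "(\<Sum>j\<in>S. F (S - {j})) = a * f (a - 1) b + b * f a (b - 1)" .
  have "(\<Sum>j\<in>{1..n}-S. F (insert j S)) = (\<Sum>j\<in>{1..n}-S. if j \<in> X then f (Suc a) b else f a (Suc b))"
  proof (rule sum.cong[OF refl])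
    fix j assume j: "j \<in> {1..n} - S"
    have "(insert j S) \<inter> X = (if j \<in> X then insert j (S \<inter> X) else S \<inter> X)"
      "(insert j S) - X = (if j \<in> X then S - X else insert j (S - X))" by auto
    thus "F (insert j S) = (if j \<in> X then f (Suc a) b else f a (Suc b))"
      using j S fin by (subst F) (auto simp: a_def b_def)
  qed
  also have "\<dots> = card (({1..n} - S) \<inter> X) * f (Suc a) b + card (({1..n} - S) - X) * f a (Suc b)"
    by (simp add: sum.If_cases Int_def Diff_eq)
  also have "({1..n} - S) \<inter> X = X - (S \<inter> X)" using X by auto
  also have "card (X - (S \<inter> X)) = card X - a" using fin by (simp add: card_Diff_subset a_def)
  also have "({1..n} - S) - X = ({1..n} - X) - (S - X)" by auto
  also have "card (({1..n} - X) - (S - X)) = n - card X - b"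
    using fin S X by (simp add: card_Diff_subset b_def Diff_mono)
  finally show "avg n F S = (\<lambda>a b. (1 - real (a + b) / n) * f a b +
     ((real (a + b) - 1) * (a * f (a - 1) b + b * f a (b - 1)) +
      real (a + b) * (real (card X - a) * f (Suc a) b + real (n - card X - b) * f a (Suc b))) /
      (real n * (real n - 1))) (card (S \<inter> X)) (card (S - X))"
    using S n by (simp add: avg_formula 1 h F[OF S] a_def[symmetric] b_def[symmetric])
qed

lemma avg_funpow_two_class:
  assumes X: "X \<subseteq> {1..n}" and n: "n \<ge> 2"
  shows "\<exists>f. \<forall>S\<in>Pow {1..n}. (avg n ^^ t) (indicator {X}) S = f (card (S \<inter> X)) (card (S - X))"
proof (induction t)
  case 0
  have "S = X \<longleftrightarrow> card (S \<inter> X) = card X \<and> card (S - X) = 0" if S: "S \<in> Pow {1..n}" for S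
  proof
    assume *: "card (S \<inter> X) = card X \<and> card (S - X) = 0"
    have fin: "finite S" "finite X" using S X by (auto intro: finite_subset)
    have "S \<inter> X = X" using * fin by (intro card_subset_eq) auto
    thus "S = X" using * fin by auto
  qed auto
  hence "\<forall>S\<in>Pow {1..n}. (avg n ^^ 0) (indicator {X}) S =
    (\<lambda>a b. if a = card X \<and> b = 0 then 1 else 0) (card (S \<inter> X)) (card (S - X))"
    by (auto simp: indicator_def)
  thus ?case by (intro exI[of _ "\<lambda>a b. if a = card X \<and> b = 0 then 1 else 0"])
next
  case (Suc t)
  then obtain f where "\<And>S. S \<in> Pow {1..n} \<Longrightarrow> (avg n ^^ t) (indicator {X}) S = f (card (S \<inter> X)) (card (S - X))"
    by blast
  from avg_two_class[where F = "(avg n ^^ t) (indicator {X})" and f = f, OF X n this]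
  show ?case by simp
qed

lemma card_two_class:
  assumes X: "X \<subseteq> {1..n}"
  shows "(card X choose a) * (n - card X choose b) \<le> card {S \<in> Pow {1..n}. card (S \<inter> X) = a \<and> card (S - X) = b}"
proof -
  have fX: "finite X" using X finite_subset by auto
  define P where "P = {U. U \<subseteq> X \<and> card U = a} \<times> {V. V \<subseteq> {1..n} - X \<and> card V = b}"
  have "card P = (card X choose a) * (n - card X choose b)"
    using fX X by (simp add: P_def card_cartesian_product n_subsets card_Diff_subset)
  moreover have "inj_on (\<lambda>(U, V). U \<union> V) P"
    by (rule inj_onI) (auto simp: P_def)
  hence "card ((\<lambda>(U, V). U \<union> V) ` P) = card P" by (rule card_image)
  moreover have "(\<lambda>(U, V). U \<union> V) ` P \<subseteq> {S \<in> Pow {1..n}. card (S \<inter> X) = a \<and> card (S - X) = b}"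
  proof clarify
    fix U V assume UV: "(U, V) \<in> P"
    hence "(U \<union> V) \<inter> X = U" "(U \<union> V) - X = V" by (auto simp: P_def)
    thus "U \<union> V \<in> Pow {1..n} \<and> card ((U \<union> V) \<inter> X) = a \<and> card ((U \<union> V) - X) = b"
      using UV X by (auto simp: P_def)
  qed
  hence "card ((\<lambda>(U, V). U \<union> V) ` P) \<le> card {S \<in> Pow {1..n}. card (S \<inter> X) = a \<and> card (S - X) = b}"
    by (intro card_mono) auto
  ultimately show ?thesis by simp
qed

text \<open>The iterated indicator at \<open>S\<close> is the probability of going from
  \<open>S\<close> to \<open>X\<close>, by symmetry also from \<open>X\<close> to \<open>S\<close>,
  so it sums to 1 over all \<open>S\<close>. All sets in the class of \<open>S\<close> have the same
  share.\<close>

lemma transition_le: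
  assumes X: "X \<in> Pow {1..n} - {{}}" and n: "n \<ge> 2" and S: "S \<in> Pow {1..n} - {{}}"
  shows "(avg n ^^ t) (indicator {X}) S *
    (real (card X choose card (S \<inter> X)) * real (n - card X choose card (S - X))) \<le> 1"
proof -
  define C where "C = {T \<in> Pow {1..n}. card (T \<inter> X) = card (S \<inter> X) \<and> card (T - X) = card (S - X)}"
  define p where "p = (avg n ^^ t) (indicator {X})"
  have p0: "p T \<ge> 0" if "T \<in> Pow {1..n}" for T
  proof (cases "T = {}")
    case True
    have "(avg n ^^ t) F {} = F {}" for F using n by (induction t) (simp_all add: avg_empty)
    thus ?thesis using X True by (simp add: p_def)
  next
    case False
    thus ?thesis unfolding p_def using that n by (intro avg_funpow_nonneg) auto
  qed
  obtain f where f: "\<And>S. S \<in> Pow {1..n} \<Longrightarrow> p S = f (card (S \<inter> X)) (card (S - X))"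
    using avg_funpow_two_class[of X n t] X n unfolding p_def by blast
  have "p S * (real (card X choose card (S \<inter> X)) * real (n - card X choose card (S - X))) \<le> p S * real (card C)"
    using card_two_class[of X n "card (S \<inter> X)" "card (S - X)"] X S p0[of S] unfolding C_def
    by (intro mult_left_mono) (simp_all only: of_nat_mult[symmetric] of_nat_le_iff, auto)
  also have "\<dots> = (\<Sum>T\<in>C. p T)"
  proof -
    have "p T = p S" if "T \<in> C" for T using that S f[of T] f[of S] by (auto simp: C_def)
    thus ?thesis by simp
  qed
  also have "\<dots> \<le> (\<Sum>T\<in>Pow {1..n}. p T)" by (intro sum_mono2) (auto simp: C_def p0)
  also have "\<dots> = (\<Sum>T\<in>Pow {1..n}. indicator {X} T)" unfolding p_def by (rule sum_avg_funpow[OF n])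
  also have "\<dots> = 1" using X by (simp add: indicator_def)
  finally show ?thesis by (simp add: p_def)
qed

section \<open>Nearly central binomial coefficients\<close>

lemma binomial_le_exp:
  fixes x :: real
  assumes "0 < x"
  shows "real (n choose d) \<le> exp (x * n) / x ^ d"
proof (cases "d \<le> n")
  case True
  have "real (n choose d) * x ^ d \<le> (\<Sum>k\<le>n. real (n choose k) * x ^ k)"
    using True assms by (intro member_le_sum) auto
  also have "\<dots> = (1 + x) ^ n" using binomial_ring[of x 1 n] by (simp add: add.commute)
  also have "\<dots> \<le> exp x ^ n" using assms by (intro power_mono exp_ge_add_one_self) auto
  finally show ?thesis using assms by (simp add: field_simps exp_of_nat_mult[symmetric])
qed (use assms in \<open>simp add: binomial_eq_0\<close>)

text \<open>From \<open>(k choose c) * (c choose a) = (k choose a) * (k - a choose d)\<close>,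
  moving from the middle \<open>c\<close> to \<open>a\<close> costs at most
  \<open>n choose d\<close>, with \<open>d\<close> at most \<open>g * n\<close>. The tilt
  \<open>x\<close> stays free, to be balanced against \<open>g\<close> later.\<close>

lemma central_binomial_ratio:
  fixes x g :: real
  assumes a: "a \<le> k div 2" and k: "k \<le> n" and x: "0 < x" "x \<le> 1" and g: "real k - 2 * real a \<le> g * n"
  shows "2 ^ k \<le> (real n + 1) * (exp (x * n) * (1 / x) powr (g * n)) * real (k choose a)"
proof -
  define c d where "c = k div 2" and "d = c - a"
  have "real (2 ^ k) = (\<Sum>i\<le>k. real (k choose i))" by (simp only: choose_row_sum[symmetric] of_nat_sum)
  also have "\<dots> \<le> (\<Sum>i\<le>k. real (k choose c))" unfolding c_def by (intro sum_mono) (simp add: binomial_maximum)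
  also have "\<dots> \<le> (real n + 1) * real (k choose c)" using k by (simp add: mult_right_mono)
  finally have 1: "2 ^ k \<le> (real n + 1) * real (k choose c)" by simp
  have "(k choose c) * (c choose a) = (k choose a) * (k - a choose d)"
    unfolding d_def using a by (intro choose_mult) (auto simp: c_def)
  moreover have "(c choose a) \<ge> 1" using a zero_less_binomial[of a c] by (simp add: c_def Suc_leI One_nat_def)
  ultimately have "(k choose c) \<le> (k choose a) * (k - a choose d)"
    by (metis mult.right_neutral mult_le_mono2)
  also have "\<dots> \<le> (k choose a) * (n choose d)"
    using k by (intro mult_le_mono2 binomial_right_mono) auto
  finally have "real (k choose c) \<le> real (k choose a) * real (n choose d)"
    by (metis of_nat_le_iff of_nat_mult)
  also have "real (n choose d) \<le> exp (x * n) / x ^ d" using x by (intro binomial_le_exp)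
  also have "\<dots> = exp (x * n) * (1 / x) powr d" using x by (simp add: powr_realpow field_simps)
  also have "\<dots> \<le> exp (x * n) * (1 / x) powr (g * n)"
  proof (intro mult_left_mono powr_mono)
    have "2 * real c \<le> k" by (simp add: c_def)
    hence "real d \<le> (real k - 2 * real a) / 2" using a by (simp add: d_def c_def of_nat_diff)
    also have "\<dots> \<le> real k - 2 * real a" using a by (simp add: field_simps)
    also have "\<dots> \<le> g * n" by (rule g)
    finally show "real d \<le> g * n" .
  qed (use x in auto)
  finally have "real (k choose c) \<le> real (k choose a) * (exp (x * n) * (1 / x) powr (g * n))"
    by (simp add: mult_left_mono)
  hence "(real n + 1) * real (k choose c) \<le> (real n + 1) * (real (k choose a) * (exp (x * n) * (1 / x) powr (g * n)))"
    by (intro mult_left_mono) auto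
  from order_trans[OF 1 this] show ?thesis by (simp add: mult_ac)
qed

lemma central_binomial_ratio':
  fixes x g :: real
  assumes a: "a \<le> k" and k: "k \<le> n" and x: "0 < x" "x \<le> 1" and g: "\<bar>real k - 2 * real a\<bar> \<le> g * n"
  shows "2 ^ k \<le> (real n + 1) * (exp (x * n) * (1 / x) powr (g * n)) * real (k choose a)"
proof (cases "a \<le> k div 2")
  case True
  thus ?thesis using assms by (intro central_binomial_ratio) auto
next
  case False
  have "2 ^ k \<le> (real n + 1) * (exp (x * n) * (1 / x) powr (g * n)) * real (k choose (k - a))"
    using False assms by (intro central_binomial_ratio) (auto simp: of_nat_diff)
  thus ?thesis using binomial_symmetric[OF a] by simp
qed

text \<open>The class of \<open>S\<close> is counted by one binomial coefficient inside
  \<open>X\<close> and one outside. Each is central up to the same factor, hence the square, and the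
  two powers of 2 recombine to \<open>2 ^ n\<close>.\<close>

lemma transition_le_balanced:
  fixes x g :: real
  assumes X: "X \<in> Pow {1..n} - {{}}" and n: "n \<ge> 2" and S: "S \<in> Pow {1..n} - {{}}"
    and x: "0 < x" "x \<le> 1"
    and g: "\<bar>part_bias X S\<bar> \<le> g * n" "\<bar>part_bias ({1..n} - X) S\<bar> \<le> g * n"
  shows "(avg n ^^ t) (indicator {X}) S \<le> ((real n + 1) * (exp (x * n) * (1 / x) powr (g * n)))\<^sup>2 / 2 ^ n"
proof -
  define p where "p = (avg n ^^ t) (indicator {X}) S"
  have p: "p \<ge> 0" unfolding p_def using S n by (intro avg_funpow_nonneg) auto
  define M where "M = (real n + 1) * (exp (x * n) * (1 / x) powr (g * n))"
  have M: "M \<ge> 0" by (simp add: M_def)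
  define c1 c2 where "c1 = real (card X choose card (S \<inter> X))" and "c2 = real (n - card X choose card (S - X))"
  have kn: "card X \<le> n" using card_le_n[of X n] X by auto
  have fin: "finite X" "finite S" using X S by (auto intro: finite_subset)
  have cX: "card ({1..n} - X) = n - card X" using X fin by (simp add: card_Diff_subset)
  have SX: "S \<inter> ({1..n} - X) = S - X" using S by auto
  have 1: "2 ^ card X \<le> M * c1" unfolding M_def c1_def
    using g(1) x kn fin by (intro central_binomial_ratio') (auto simp: part_bias_def card_mono)
  have 2: "2 ^ (n - card X) \<le> M * c2" unfolding M_def c2_def
  proof (rule central_binomial_ratio')
    show "card (S - X) \<le> n - card X" unfolding cX[symmetric] using S by (intro card_mono) auto
    show "\<bar>real (n - card X) - 2 * real (card (S - X))\<bar> \<le> g * n"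
      using g(2) by (simp add: part_bias_def cX SX)
  qed (use x in auto)
  have "p * 2 ^ n = p * (2 ^ card X * 2 ^ (n - card X))" using kn by (simp add: power_add[symmetric])
  also have "\<dots> \<le> p * ((M * c1) * (M * c2))"
    using 1 2 p M by (intro mult_left_mono mult_mono) (auto simp: c1_def)
  also have "\<dots> = M\<^sup>2 * (p * (c1 * c2))" by (simp add: power2_eq_square)
  also have "\<dots> \<le> M\<^sup>2 * 1"
    using transition_le[OF X n S, of t] unfolding p_def c1_def c2_def by (intro mult_left_mono) auto
  finally show ?thesis by (simp add: p_def M_def field_simps)
qed

section \<open>Low Fourier levels\<close>

definition level :: "nat \<Rightarrow> nat \<Rightarrow> nat set set" where
  "level n k = {Y \<in> Pow {1..n}. card Y = k}"

lemma finite_level [simp]: "finite (level n k)"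
  by (simp add: level_def)

lemma level_0 [simp]: "level n 0 = {{}}"
  by (auto simp: level_def finite_subset)

lemma card_level: "card (level n k) = n choose k"
  using n_subsets[of "{1..n}" k] by (simp add: level_def Pow_def)

lemma level_double_count:
  "(\<Sum>Y\<in>level n k. \<Sum>j\<in>{1..n}-Y. f j Y) = (\<Sum>Z\<in>level n (Suc k). \<Sum>j\<in>Z. f j (Z - {j}))"
proof -
  have fin: "\<And>Y. Y \<in> level n k \<Longrightarrow> finite ({1..n} - Y)" "\<And>Z. Z \<in> level n (Suc k) \<Longrightarrow> finite Z"
    by (auto simp: level_def finite_subset)
  have "(\<Sum>Y\<in>level n k. \<Sum>j\<in>{1..n}-Y. f j Y) = (\<Sum>(Y, j)\<in>(SIGMA Y:level n k. {1..n} - Y). f j Y)"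
    by (rule sum.Sigma) auto
  also have "\<dots> = (\<Sum>(Z, j)\<in>(SIGMA Z:level n (Suc k). Z). f j (Z - {j}))"
    by (rule sum.reindex_bij_witness[of _ "\<lambda>(Z, j). (Z - {j}, j)" "\<lambda>(Y, j). (insert j Y, j)"])
      (auto simp: level_def finite_subset insert_absorb)
  also have "\<dots> = (\<Sum>Z\<in>level n (Suc k). \<Sum>j\<in>Z. f j (Z - {j}))"
    by (rule sum.Sigma[symmetric]) (use fin in auto)
  finally show ?thesis .
qed

lemma level_sum_up:
  fixes f :: "nat set \<Rightarrow> real"
  shows "(\<Sum>Y\<in>level n k. \<Sum>j\<in>{1..n}-Y. f (insert j Y)) = real (Suc k) * (\<Sum>Z\<in>level n (Suc k). f Z)"
proof -
  have "(\<Sum>Y\<in>level n k. \<Sum>j\<in>{1..n}-Y. f (insert j Y)) = (\<Sum>Z\<in>level n (Suc k). \<Sum>j\<in>Z. f Z)"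
    unfolding level_double_count by (intro sum.cong refl) (simp add: insert_absorb)
  also have "\<dots> = (\<Sum>Z\<in>level n (Suc k). real (Suc k) * f Z)"
    by (intro sum.cong refl) (simp add: level_def)
  finally show ?thesis by (simp only: sum_distrib_left)
qed

lemma level_sum_down:
  fixes f :: "nat set \<Rightarrow> real"
  shows "(\<Sum>Z\<in>level n (Suc k). \<Sum>j\<in>Z. f (Z - {j})) = (real n - real k) * (\<Sum>Y\<in>level n k. f Y)"
proof -
  have "(\<Sum>Z\<in>level n (Suc k). \<Sum>j\<in>Z. f (Z - {j})) = (\<Sum>Y\<in>level n k. \<Sum>j\<in>{1..n}-Y. f Y)"
    by (rule level_double_count[symmetric])
  also have "\<dots> = (\<Sum>Y\<in>level n k. (real n - real k) * f Y)"
  proof (intro sum.cong refl)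
    fix Y assume Y: "Y \<in> level n k"
    hence "card ({1..n} - Y) = n - k" "k \<le> n"
      using card_mono[of "{1..n}" Y] by (auto simp: level_def card_Diff_subset finite_subset)
    thus "(\<Sum>j\<in>{1..n}-Y. f Y) = (real n - real k) * f Y" by (simp add: of_nat_diff)
  qed
  finally show ?thesis by (simp only: sum_distrib_left)
qed

section \<open>Krawtchouk polynomials on balanced sets\<close>

definition krawtchouk :: "nat \<Rightarrow> nat \<Rightarrow> nat set \<Rightarrow> real" where
  "krawtchouk n k D = (\<Sum>Y\<in>level n k. chi Y D)"

lemma sum_chi_flip:
  assumes "Y \<in> Pow {1..n}" "D \<in> Pow {1..n}"
  shows "bias n D * chi Y D = (\<Sum>j\<in>Y. chi (Y - {j}) D) + (\<Sum>j\<in>{1..n}-Y. chi (insert j Y) D)"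
proof -
  have fin: "finite Y" "finite D" using assms by (auto intro: finite_subset)
  have "bias n D * chi Y D = (\<Sum>i\<in>{1..n}. chi (flip i Y) D)"
    using fin by (simp add: bias_conv_sum[OF assms(2)] sum_distrib_right chi_flip_left if_distrib[of "\<lambda>x. x * _"] cong: if_cong)
  also have "\<dots> = (\<Sum>i\<in>{1..n}-Y. chi (flip i Y) D) + (\<Sum>i\<in>Y. chi (flip i Y) D)"
    using assms by (intro sum.subset_diff) auto
  finally show ?thesis by (simp add: flip_def)
qed

lemma krawtchouk_0 [simp]: "krawtchouk n 0 D = 1"
  by (simp add: krawtchouk_def)

lemma krawtchouk_1: "D \<in> Pow {1..n} \<Longrightarrow> krawtchouk n (Suc 0) D = bias n D"
proof -
  assume D: "D \<in> Pow {1..n}"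
  have "bias n D = (\<Sum>j\<in>{1..n}. chi {j} D)"
    using sum_chi_flip[of "{}" n D] D by simp
  thus ?thesis using level_sum_up[where f = "\<lambda>Y. chi Y D" and n = n and k = 0] by (simp add: krawtchouk_def)
qed

text \<open>The three-term recurrence: multiplying by the bias inserts or removes one element, which
  produces each set of size \<open>k + 2\<close> exactly \<open>k + 2\<close> times and each set of
  size \<open>k\<close> exactly \<open>n - k\<close> times.\<close>

lemma krawtchouk_rec:
  assumes D: "D \<in> Pow {1..n}"
  shows "bias n D * krawtchouk n (Suc k) D = real (k + 2) * krawtchouk n (k + 2) D + (real n - real k) * krawtchouk n k D"
proof -
  have "bias n D * krawtchouk n (Suc k) D =
    (\<Sum>Y\<in>level n (Suc k). (\<Sum>j\<in>Y. chi (Y - {j}) D) + (\<Sum>j\<in>{1..n}-Y. chi (insert j Y) D))"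
    unfolding krawtchouk_def sum_distrib_left
    by (intro sum.cong refl sum_chi_flip D) (simp add: level_def)
  thus ?thesis
    using level_sum_up[where f = "\<lambda>Y. chi Y D" and n = n and k = "Suc k"]
      level_sum_down[where f = "\<lambda>Y. chi Y D" and n = n and k = k]
    by (simp add: sum.distrib krawtchouk_def)
qed

lemma abs_krawtchouk_le: "\<bar>krawtchouk n k D\<bar> \<le> real (n choose k)"
proof -
  have "\<bar>krawtchouk n k D\<bar> \<le> (\<Sum>Y\<in>level n k. \<bar>chi Y D\<bar>)" unfolding krawtchouk_def by (rule sum_abs)
  thus ?thesis by (simp add: card_level)
qed

lemma Suc_times_choose: "real (Suc k) * real (n choose Suc k) = (real n - real k) * real (n choose k)"
proof (cases "k \<le> n")
  case True
  have "Suc k * (n choose Suc k) = (n - k) * (n choose k)"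
    by (metis binomial_absorb_comp binomial_absorption mult.commute)
  hence "real (Suc k * (n choose Suc k)) = real ((n - k) * (n choose k))" by (rule arg_cong)
  thus ?thesis using True by (simp only: of_nat_mult of_nat_diff)
qed (simp add: binomial_eq_0)

text \<open>Relative to \<open>n choose k\<close>, the recurrence passes up two levels at the cost
  of a factor \<open>(g * d + \<eta>) / (1 - \<eta>)\<close>, and \<open>small\<close> bounds it by
  \<open>d\<^sup>2\<close>. Only \<open>k - 1\<close>, the middle index of the recurrence, has to be
  at most \<open>\<eta> * n\<close>.\<close>

lemma abs_krawtchouk_balanced_le:
  assumes D: "D \<in> Pow {1..n}" and bal: "\<bar>bias n D\<bar> \<le> g * n"
    and d: "d > 0" and g: "0 \<le> g" and \<eta>: "0 \<le> \<eta>" and small: "g * d + \<eta> \<le> (1 - \<eta>) * d\<^sup>2"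
    and k: "real k \<le> \<eta> * n + 1"
  shows "\<bar>krawtchouk n k D\<bar> \<le> d ^ k * real (n choose k)"
  using k
proof (induction k rule: less_induct)
  case (less k)
  consider "k = 0" | "k = Suc 0" | k' where "k = k' + 2"
    by (metis add_2_eq_Suc' not0_implies_Suc)
  thus ?case
  proof cases
    case 2
    have "0 \<le> \<eta> * (d * d)" using \<eta> d by simp
    hence "g * d \<le> d * d" using small \<eta> unfolding power2_eq_square left_diff_distrib by linarith
    hence "g \<le> d" using d by simp
    hence "g * n \<le> d * n" by (intro mult_right_mono) auto
    thus ?thesis using 2 bal krawtchouk_1[OF D] by simp
  next
    case (3 k')
    define c where "c = real (n choose Suc k')"
    have kn: "real k' + 1 \<le> \<eta> * n" using less.prems 3 by simp
    have "real k * \<bar>krawtchouk n k D\<bar> = \<bar>bias n D * krawtchouk n (Suc k') D - (real n - real k') * krawtchouk n k' D\<bar>"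
    proof -
      have "bias n D * krawtchouk n (Suc k') D - (real n - real k') * krawtchouk n k' D = real k * krawtchouk n k D"
        using krawtchouk_rec[OF D, of k'] 3 by simp
      thus ?thesis by (simp add: abs_mult)
    qed
    also have "\<dots> \<le> \<bar>bias n D\<bar> * \<bar>krawtchouk n (Suc k') D\<bar> + \<bar>real n - real k'\<bar> * \<bar>krawtchouk n k' D\<bar>"
      by (simp add: abs_mult[symmetric])
    also have "\<dots> \<le> (g * n) * (d ^ Suc k' * c) + \<bar>real n - real k'\<bar> * (d ^ k' * real (n choose k'))"
      unfolding c_def using less.IH[of "Suc k'"] less.IH[of k'] bal less.prems 3 g
      by (intro add_mono mult_mono) auto
    also have "\<bar>real n - real k'\<bar> * (d ^ k' * real (n choose k')) = d ^ k' * ((real k' + 1) * c)"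
    proof (cases "k' \<le> n")
      case True
      thus ?thesis using Suc_times_choose[of k' n] by (simp add: c_def mult_ac add.commute)
    qed (simp add: c_def binomial_eq_0)
    also have "(g * n) * (d ^ Suc k' * c) + d ^ k' * ((real k' + 1) * c) = d ^ k' * c * (n * (g * d) + (real k' + 1))"
      by (simp add: algebra_simps)
    also have "\<dots> \<le> d ^ k' * c * ((real n - (real k' + 1)) * d\<^sup>2)"
    proof (intro mult_left_mono)
      have "n * (g * d) + (real k' + 1) \<le> n * (g * d + \<eta>)" using kn by (simp add: algebra_simps)
      also have "\<dots> \<le> n * ((1 - \<eta>) * d\<^sup>2)" using small by (intro mult_left_mono) auto
      also have "\<dots> = (real n - \<eta> * n) * d\<^sup>2" by (simp add: algebra_simps)
      also have "\<dots> \<le> (real n - (real k' + 1)) * d\<^sup>2" using kn by (intro mult_right_mono) auto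
      finally show "n * (g * d) + (real k' + 1) \<le> (real n - (real k' + 1)) * d\<^sup>2" .
    qed (use d in \<open>auto simp: c_def\<close>)
    also have "\<dots> = d ^ k * ((real n - real (Suc k')) * c)"
      using 3 by (simp add: power_add power2_eq_square mult_ac add.commute)
    also have "(real n - real (Suc k')) * c = real k * real (n choose k)"
      using Suc_times_choose[of "Suc k'" n] 3 by (simp add: c_def)
    finally have "real k * \<bar>krawtchouk n k D\<bar> \<le> real k * (d ^ k * real (n choose k))"
      by (simp add: mult_ac)
    thus ?thesis using 3 by simp
  qed simp
qed

text \<open>The mass may be less than 1 because this is applied to a law cut off at the unbalanced
  sets; \<open>B\<close> bounds the density relative to the uniform distribution on all
  \<open>2 ^ n\<close> sets.\<close>

definition dens :: "nat \<Rightarrow> real \<Rightarrow> (nat set \<Rightarrow> real) \<Rightarrow> bool" where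
  "dens n B q \<longleftrightarrow> (\<forall>S\<in>Pow {1..n}. 0 \<le> q S \<and> q S \<le> B / 2 ^ n) \<and> (\<Sum>S\<in>Pow {1..n}. q S) \<le> 1"

lemma dens_avg:
  assumes "dens n B q" "n \<ge> 2" shows "dens n B (avg n q)"
proof -
  have "0 \<le> avg n q S \<and> avg n q S \<le> B / 2 ^ n" if S: "S \<in> Pow {1..n}" for S
  proof -
    have T: "toggle i j S \<in> Pow {1..n}" if "(i, j) \<in> coord_pairs n" for i j
      using that S toggle_Pow[of j "{1..n}" S i] by (auto simp: coord_pairs_def)
    have "avg n (\<lambda>_. 0) S \<le> avg n q S" "avg n q S \<le> avg n (\<lambda>_. B / 2 ^ n) S"
      using T assms(1) by (auto intro!: avg_mono_gen simp: dens_def)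
    thus ?thesis by (simp only: avg_const[OF assms(2)])
  qed
  thus ?thesis using assms by (auto simp: dens_def sum_avg)
qed

lemma dens_avg_funpow:
  assumes "dens n B q" "n \<ge> 2" shows "dens n B ((avg n ^^ t) q)"
  by (induction t) (auto intro: dens_avg assms)

lemma dens_bound_nonneg: "dens n B q \<Longrightarrow> 0 \<le> B"
proof -
  assume "dens n B q"
  hence "0 \<le> B / 2 ^ n" by (auto simp: dens_def intro: order_trans[of _ "q {}"])
  hence "0 \<le> B / 2 ^ n * 2 ^ n" by (rule mult_nonneg_nonneg) simp
  thus ?thesis by simp
qed

lemma dens_fourier_le_1: "dens n B q \<Longrightarrow> \<bar>fourier n q Y\<bar> \<le> 1"
  using abs_fourier_le[of n q Y] by (simp add: dens_def)

lemma dens_sum_power2: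
  assumes "dens n B q" shows "(\<Sum>Y\<in>Pow {1..n}. (fourier n q Y)\<^sup>2) \<le> B"
proof -
  have "(\<Sum>S\<in>Pow {1..n}. (q S)\<^sup>2) \<le> (\<Sum>S\<in>Pow {1..n}. q S * (B / 2 ^ n))"
    unfolding power2_eq_square using assms by (intro sum_mono mult_left_mono) (auto simp: dens_def)
  also have "\<dots> = (\<Sum>S\<in>Pow {1..n}. q S) * (B / 2 ^ n)" by (simp only: sum_distrib_right)
  also have "\<dots> \<le> 1 * (B / 2 ^ n)"
    using assms dens_bound_nonneg[OF assms] by (intro mult_right_mono) (auto simp: dens_def)
  finally show ?thesis unfolding parseval by (simp add: field_simps)
qed

lemma bij_betw_sym_diff: "S \<in> Pow A \<Longrightarrow> bij_betw (sym_diff S) (Pow A) (Pow A)"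
  by (rule bij_betwI[of _ _ _ "sym_diff S"]) auto

text \<open>
  A level-\<open>k\<close> inequality without hypercontractivity: the symmetric difference of two independent
  samples of a bounded density is balanced up to an event of tiny probability, and on balanced sets
  the Krawtchouk polynomials of low degree are small.
\<close>

lemma dens_level_le:
  assumes q: "dens n B q"
    and d: "d > 0" and g: "0 \<le> g" "g \<le> 1" and \<eta>: "0 \<le> \<eta>" and small: "g * d + \<eta> \<le> (1 - \<eta>) * d\<^sup>2"
    and k: "real k \<le> \<eta> * n"
  shows "(\<Sum>Y\<in>level n k. (fourier n q Y)\<^sup>2) \<le> real (n choose k) * (d ^ k + 2 * B * exp (- g\<^sup>2 * n / 4))"
proof -
  define P where "P = Pow {1..n}"
  define U where "U = {D \<in> P. \<bar>bias n D\<bar> > g * n}"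
  define C where "C = real (n choose k)"
  have B: "B \<ge> 0" by (rule dens_bound_nonneg[OF q])
  have q0: "\<And>S. S \<in> P \<Longrightarrow> 0 \<le> q S" "\<And>S. S \<in> P \<Longrightarrow> q S \<le> B / 2 ^ n" "(\<Sum>S\<in>P. q S) \<le> 1"
    using q by (auto simp: dens_def P_def)
  have kr: "krawtchouk n k D \<le> C * (d ^ k + indicator U D)" if "D \<in> P" for D
  proof (cases "D \<in> U")
    case True
    have "krawtchouk n k D \<le> C * 1" using abs_krawtchouk_le[of n k D] by (simp add: C_def)
    also have "\<dots> \<le> C * (d ^ k + indicator U D)"
      using True d by (intro mult_left_mono) (auto simp: C_def)
    finally show ?thesis .
  next
    case False
    hence "\<bar>krawtchouk n k D\<bar> \<le> d ^ k * C" unfolding C_def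
      using that k by (intro abs_krawtchouk_balanced_le[OF _ _ d g(1) \<eta> small]) (auto simp: U_def P_def)
    thus ?thesis using False by (simp add: mult.commute)
  qed
  have inner: "(\<Sum>T\<in>P. q T * krawtchouk n k (sym_diff S T)) \<le> C * (d ^ k + 2 * B * exp (- g\<^sup>2 * n / 4))"
    if S: "S \<in> P" for S
  proof -
    have SP: "sym_diff S T \<in> P" if "T \<in> P" for T using that S by (auto simp: P_def)
    have "(\<Sum>T\<in>P. q T * krawtchouk n k (sym_diff S T)) \<le> (\<Sum>T\<in>P. q T * (C * (d ^ k + indicator U (sym_diff S T))))"
      using q0 SP by (intro sum_mono mult_left_mono kr) auto
    also have "\<dots> = C * (d ^ k * (\<Sum>T\<in>P. q T) + (\<Sum>T\<in>P. q T * indicator U (sym_diff S T)))"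
    proof -
      have "q T * (C * (d ^ k + indicator U (sym_diff S T))) = C * (d ^ k * q T + q T * indicator U (sym_diff S T))" for T
        by (simp add: algebra_simps)
      thus ?thesis by (simp only: sum_distrib_left[symmetric] sum.distrib)
    qed
    also have "\<dots> \<le> C * (d ^ k * 1 + B / 2 ^ n * (2 * 2 ^ n * exp (- g\<^sup>2 * n / 4)))"
    proof (intro mult_left_mono add_mono)
      \<comment> \<open>For fixed \<open>S\<close>, taking the symmetric difference with
        \<open>S\<close> is a bijection, so the bound on \<open>q\<close> reduces the claim to
        counting unbalanced sets.\<close>
      have "(\<Sum>T\<in>P. q T * indicator U (sym_diff S T)) \<le> (\<Sum>T\<in>P. B / 2 ^ n * indicator U (sym_diff S T))"
        using q0 by (intro sum_mono mult_right_mono) auto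
      also have "\<dots> = B / 2 ^ n * (\<Sum>T\<in>P. indicator U T)"
        using sum.reindex_bij_betw[OF bij_betw_sym_diff[of S "{1..n}"], of "indicator U :: _ \<Rightarrow> real"] S
        by (simp only: P_def sum_distrib_left[symmetric])
      also have "(\<Sum>T\<in>P. indicator U T) = real (card U)"
        by (simp add: P_def U_def indicator_def sum.If_cases Int_def)
      also have "B / 2 ^ n * real (card U) \<le> B / 2 ^ n * (2 * 2 ^ n * exp (- g\<^sup>2 * n / 4))"
        unfolding U_def P_def using B g by (intro mult_left_mono chernoff) auto
      finally show "(\<Sum>T\<in>P. q T * indicator U (sym_diff S T)) \<le> B / 2 ^ n * (2 * 2 ^ n * exp (- g\<^sup>2 * n / 4))" .
    qed (use q0 d in \<open>auto simp: C_def\<close>)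
    also have "\<dots> = C * (d ^ k + 2 * B * exp (- g\<^sup>2 * n / 4))" by simp
    finally show ?thesis .
  qed
  have "(\<Sum>Y\<in>level n k. (fourier n q Y)\<^sup>2) = (\<Sum>Y\<in>level n k. \<Sum>S\<in>P. \<Sum>T\<in>P. q S * (q T * chi Y (sym_diff S T)))"
    unfolding power2_eq_square fourier_def P_def sum_product chi_mult[symmetric] by (simp add: mult_ac)
  also have "\<dots> = (\<Sum>S\<in>P. \<Sum>T\<in>P. q S * (q T * krawtchouk n k (sym_diff S T)))"
    unfolding krawtchouk_def sum_distrib_left
    by (subst sum.swap, rule sum.cong[OF refl], rule sum.swap)
  also have "\<dots> = (\<Sum>S\<in>P. q S * (\<Sum>T\<in>P. q T * krawtchouk n k (sym_diff S T)))"
    by (simp only: sum_distrib_left)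
  also have "\<dots> \<le> (\<Sum>S\<in>P. q S * (C * (d ^ k + 2 * B * exp (- g\<^sup>2 * n / 4))))"
    using q0 by (intro sum_mono mult_left_mono inner) auto
  also have "\<dots> = (\<Sum>S\<in>P. q S) * (C * (d ^ k + 2 * B * exp (- g\<^sup>2 * n / 4)))"
    by (simp only: sum_distrib_right)
  also have "\<dots> \<le> 1 * (C * (d ^ k + 2 * B * exp (- g\<^sup>2 * n / 4)))"
    using q0 d B by (intro mult_right_mono) (auto simp: C_def)
  finally show ?thesis by (simp add: C_def)
qed

section \<open>High Fourier levels\<close>

lemma fourier_divide: "fourier n (\<lambda>S. q S / c) Y = fourier n q Y / c"
  by (simp add: fourier_def sum_divide_distrib)

definition above :: "nat \<Rightarrow> nat \<Rightarrow> nat set set" where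
  "above n k = {Y \<in> Pow {1..n}. k < card Y}"

definition weight :: "nat \<Rightarrow> nat \<Rightarrow> (nat set \<Rightarrow> real) \<Rightarrow> real" where
  "weight n k g = (\<Sum>Y\<in>above n k. (g Y)\<^sup>2)"

text \<open>
  The factor \<open>n / card Y\<close> compensates that the coefficient at \<open>Y\<close> relaxes at rate \<open>card Y / n\<close>:
  with it, one step decreases the norm by the unweighted \<open>weight\<close>.
\<close>

definition hweight :: "nat \<Rightarrow> nat \<Rightarrow> (nat set \<Rightarrow> real) \<Rightarrow> real" where
  "hweight n k g = (\<Sum>Y\<in>above n k. real n / real (card Y) * (g Y)\<^sup>2)"

lemma finite_above [simp]: "finite (above n k)"
  by (simp add: above_def)

lemma above_subset: "above n k \<subseteq> Pow {1..n}"
  by (auto simp: above_def)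

lemma weight_nonneg: "0 \<le> weight n k g"
  by (simp add: weight_def sum_nonneg)

lemma above_pred: "k \<ge> 1 \<Longrightarrow> above n (k - 1) = above n k \<union> level n k"
  by (auto simp: above_def level_def)

lemma weight_pred:
  assumes "k \<ge> 1" shows "weight n (k - 1) g = weight n k g + (\<Sum>Y\<in>level n k. (g Y)\<^sup>2)"
  unfolding weight_def above_pred[OF assms]
  by (rule sum.union_disjoint) (auto simp: above_def level_def)

lemma hweight_le_weight:
  assumes "k \<ge> 1" "n \<ge> 1" shows "real k / real n * hweight n k g \<le> weight n k g"
proof -
  have "real k / real n * hweight n k g = (\<Sum>Y\<in>above n k. real k / real (card Y) * (g Y)\<^sup>2)"
    using assms by (simp add: hweight_def sum_distrib_left)
  also have "\<dots> \<le> (\<Sum>Y\<in>above n k. 1 * (g Y)\<^sup>2)"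
    by (intro sum_mono mult_right_mono) (auto simp: above_def)
  finally show ?thesis by (simp add: weight_def)
qed

lemma level_le_hweight:
  assumes "k \<ge> 1" "n \<ge> 1" shows "(\<Sum>Y\<in>level n k. (g Y)\<^sup>2) \<le> real k / real n * hweight n (k - 1) g"
proof -
  have "(\<Sum>Y\<in>level n k. (g Y)\<^sup>2) = real k / real n * (\<Sum>Y\<in>level n k. real n / real (card Y) * (g Y)\<^sup>2)"
    using assms by (simp add: sum_distrib_left level_def)
  also have "\<dots> \<le> real k / real n * hweight n (k - 1) g"
    unfolding hweight_def above_pred[OF assms(1)] by (intro mult_left_mono sum_mono2) auto
  finally show ?thesis .
qed

text \<open>
  Write \<open>fourier n q (flip i Y)\<close>, summed over \<open>i\<close>, as the Fourier transform of \<open>bias\<close> times a function.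
  The part where the bias is not small has tiny measure, and there the function is at most \<open>M\<close>.
\<close>

lemma sum_flip_power2_le:
  assumes q: "dens n B q" and k: "k \<ge> 1" and n: "n \<ge> 1"
  defines "M \<equiv> B + real (card {Y \<in> Pow {1..n}. card Y < k})"
  shows "(\<Sum>Y\<in>above n k. (\<Sum>i=1..n. fourier n q (flip i Y))\<^sup>2) \<le>
    (real n)\<^sup>2 / 16 * weight n (k - 1) (fourier n q) + 2 * (real n)\<^sup>2 * M\<^sup>2 * exp (- real n / 64)"
proof -
  define P where "P = Pow {1..n}"
  \<comment> \<open>Cutting off the levels below \<open>k\<close> does not affect the sum, since a
    set in \<open>above n k\<close> has at least \<open>k\<close> elements after one flip.\<close>
  define G where "G = (\<lambda>Y. if k \<le> card Y then fourier n q Y else 0)"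
  define G' where "G' = (\<lambda>Y. if k \<le> card Y then 0 else fourier n q Y)"
  define p where "p = (\<lambda>S. fourier n G S / 2 ^ n)"
  have fG: "fourier n p Y = G Y" if "Y \<in> P" for Y
  proof -
    have "fourier n p Y = fourier n (fourier n G) Y / 2 ^ n" unfolding p_def by (rule fourier_divide)
    thus ?thesis using that by (simp add: fourier_fourier P_def)
  qed
  have B: "B \<ge> 0" by (rule dens_bound_nonneg[OF q])
  have M: "M \<ge> 0" using B by (simp add: M_def)
  have pM: "\<bar>p S\<bar> \<le> M / 2 ^ n" if S: "S \<in> P" for S
  proof -
    \<comment> \<open>The cut removes one coefficient, of size at most 1, for each set with fewer
      than \<open>k\<close> elements: the second summand of \<open>M\<close>.\<close>
    have "G Y = fourier n q Y - G' Y" for Y by (simp add: G_def G'_def)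
    hence "fourier n G S = fourier n (fourier n q) S - fourier n G' S"
      by (simp add: fourier_def left_diff_distrib sum_subtractf)
    also have "fourier n (fourier n q) S = 2 ^ n * q S" using S by (simp add: fourier_fourier P_def)
    finally have *: "fourier n G S = 2 ^ n * q S - fourier n G' S" .
    have "\<bar>fourier n G' S\<bar> \<le> (\<Sum>Y\<in>P. \<bar>G' Y\<bar>)" unfolding P_def by (rule abs_fourier_le)
    also have "\<dots> \<le> (\<Sum>Y\<in>P. if card Y < k then 1 else 0)"
      using dens_fourier_le_1[OF q] by (intro sum_mono) (auto simp: G'_def)
    also have "\<dots> = real (card {Y \<in> Pow {1..n}. card Y < k})"
      by (simp add: P_def sum.If_cases Int_def)
    finally have "\<bar>fourier n G' S\<bar> \<le> real (card {Y \<in> Pow {1..n}. card Y < k})" .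
    moreover have "0 \<le> 2 ^ n * q S" "2 ^ n * q S \<le> B"
      using q S by (auto simp: dens_def P_def field_simps)
    ultimately have "\<bar>fourier n G S\<bar> \<le> M" unfolding * M_def by linarith
    thus ?thesis by (simp add: p_def abs_divide divide_right_mono)
  qed
  have psum: "2 ^ n * (\<Sum>S\<in>P. (p S)\<^sup>2) = weight n (k - 1) (fourier n q)"
  proof -
    have "2 ^ n * (\<Sum>S\<in>P. (p S)\<^sup>2) = (\<Sum>Y\<in>P. (fourier n p Y)\<^sup>2)" unfolding P_def by (rule parseval[symmetric])
    also have "\<dots> = (\<Sum>Y\<in>P. if k \<le> card Y then (fourier n q Y)\<^sup>2 else 0)"
      by (intro sum.cong refl) (simp add: fG G_def)
    also have "\<dots> = (\<Sum>Y\<in>{Y\<in>P. k \<le> card Y}. (fourier n q Y)\<^sup>2)"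
      by (simp add: P_def sum.If_cases Int_def)
    also have "{Y\<in>P. k \<le> card Y} = above n (k - 1)" using k by (auto simp: P_def above_def)
    finally show ?thesis by (simp add: weight_def)
  qed
  \<comment> \<open>Off \<open>U\<close> the squared bias is at most \<open>n\<^sup>2 / 16\<close>;
    Chernoff with tolerance 1/4 yields the exponent \<open>n / 64\<close>.\<close>
  define U where "U = {S \<in> P. \<bar>bias n S\<bar> > 1 / 4 * n}"
  have biasn: "\<bar>bias n S\<bar> \<le> n" if "S \<in> P" for S
    using that card_le_n[of S n] by (auto simp: bias_def P_def)
  have "(\<Sum>Y\<in>above n k. (\<Sum>i=1..n. fourier n q (flip i Y))\<^sup>2) = (\<Sum>Y\<in>above n k. (\<Sum>i=1..n. fourier n p (flip i Y))\<^sup>2)"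
  proof (intro sum.cong refl arg_cong[where f = "\<lambda>x. x\<^sup>2"])
    fix Y i assume Y: "Y \<in> above n k" and i: "i \<in> {1..n}"
    have "flip i Y \<in> P" using Y i flip_Pow[of i "{1..n}" Y] by (auto simp: P_def above_def)
    moreover have "k \<le> card (flip i Y)" using Y by (auto simp: flip_def above_def card_Diff_singleton finite_subset card_insert_if)
    ultimately show "fourier n q (flip i Y) = fourier n p (flip i Y)" by (simp add: fG G_def)
  qed
  also have "\<dots> \<le> (\<Sum>Y\<in>P. (\<Sum>i=1..n. fourier n p (flip i Y))\<^sup>2)"
    unfolding P_def using above_subset by (intro sum_mono2) auto
  also have "\<dots> = (\<Sum>Y\<in>P. (fourier n (\<lambda>S. bias n S * p S) Y)\<^sup>2)"
    by (intro sum.cong refl) (simp add: sum_fourier_flip P_def)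
  also have "\<dots> = 2 ^ n * (\<Sum>S\<in>P. (bias n S * p S)\<^sup>2)" unfolding P_def by (rule parseval)
  also have "\<dots> \<le> 2 ^ n * (\<Sum>S\<in>P. (real n)\<^sup>2 / 16 * (p S)\<^sup>2 + (real n)\<^sup>2 * (M / 2 ^ n)\<^sup>2 * indicator U S)"
  proof (intro mult_left_mono sum_mono)
    fix S assume S: "S \<in> P"
    show "(bias n S * p S)\<^sup>2 \<le> (real n)\<^sup>2 / 16 * (p S)\<^sup>2 + (real n)\<^sup>2 * (M / 2 ^ n)\<^sup>2 * indicator U S"
    proof (cases "S \<in> U")
      case True
      have "\<bar>bias n S * p S\<bar>\<^sup>2 \<le> (real n * (M / 2 ^ n))\<^sup>2"
        unfolding abs_mult using biasn[OF S] pM[OF S] by (intro power_mono mult_mono) auto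
      hence "(bias n S * p S)\<^sup>2 \<le> (real n)\<^sup>2 * (M / 2 ^ n)\<^sup>2 * indicator U S"
        using True by (simp add: power_mult_distrib power_divide)
      moreover have "0 \<le> (real n)\<^sup>2 / 16 * (p S)\<^sup>2" by simp
      ultimately show ?thesis by linarith
    next
      case False
      hence "\<bar>bias n S\<bar>\<^sup>2 \<le> (1 / 4 * real n)\<^sup>2" using S by (intro power_mono) (auto simp: U_def)
      hence "(bias n S)\<^sup>2 * (p S)\<^sup>2 \<le> (1 / 4 * real n)\<^sup>2 * (p S)\<^sup>2" by (intro mult_right_mono) auto
      thus ?thesis using False by (simp add: power_mult_distrib power_divide)
    qed
  qed simp
  also have "\<dots> = (real n)\<^sup>2 / 16 * weight n (k - 1) (fourier n q) + 2 ^ n * ((real n)\<^sup>2 * (M / 2 ^ n)\<^sup>2 * real (card U))"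
  proof -
    have U: "(\<Sum>S\<in>P. indicator U S) = real (card U)" by (simp add: P_def U_def indicator_def sum.If_cases Int_def)
    have split: "(\<Sum>S\<in>P. a * (p S)\<^sup>2 + c * indicator U S) = a * (\<Sum>S\<in>P. (p S)\<^sup>2) + c * (\<Sum>S\<in>P. indicator U S)" for a c :: real
      by (simp only: sum.distrib sum_distrib_left)
    show ?thesis unfolding psum[symmetric] split U by (simp add: algebra_simps)
  qed
  also have "2 ^ n * ((real n)\<^sup>2 * (M / 2 ^ n)\<^sup>2 * real (card U)) \<le>
    2 ^ n * ((real n)\<^sup>2 * (M / 2 ^ n)\<^sup>2 * (2 * 2 ^ n * exp (- (1 / 4)\<^sup>2 * n / 4)))"
    unfolding U_def P_def by (intro mult_left_mono chernoff) auto
  also have "\<dots> = 2 * (real n)\<^sup>2 * M\<^sup>2 * exp (- real n / 64)"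
    by (simp add: power2_eq_square)
  finally show ?thesis by simp
qed

text \<open>Each set of size at least \<open>k\<close> equals \<open>Y - {j}\<close> for at most
  \<open>n\<close> pairs.\<close>

lemma sum_above_pred_le:
  fixes f :: "nat set \<Rightarrow> real"
  assumes f: "\<And>Y. 0 \<le> f Y" and k: "k \<ge> 1"
  shows "(\<Sum>Y\<in>above n k. \<Sum>j\<in>Y. f (Y - {j})) \<le> n * (\<Sum>Y\<in>above n (k - 1). f Y)"
proof -
  define G where "G = (\<lambda>Y. if k \<le> card Y then f Y else 0)"
  have G0: "0 \<le> G Y" for Y by (simp add: G_def f)
  have "(\<Sum>Y\<in>above n k. \<Sum>j\<in>Y. f (Y - {j})) \<le> (\<Sum>Y\<in>above n k. \<Sum>j=1..n. G (flip j Y))"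
  proof (rule sum_mono)
    fix Y assume Y: "Y \<in> above n k"
    have fY: "finite Y" using Y by (auto simp: above_def finite_subset)
    have "(\<Sum>j\<in>Y. f (Y - {j})) = (\<Sum>j\<in>Y. G (flip j Y))"
      using Y fY by (intro sum.cong) (auto simp: G_def flip_def above_def)
    also have "\<dots> \<le> (\<Sum>j=1..n. G (flip j Y))"
      using Y G0 by (intro sum_mono2) (auto simp: above_def)
    finally show "(\<Sum>j\<in>Y. f (Y - {j})) \<le> (\<Sum>j=1..n. G (flip j Y))" .
  qed
  also have "\<dots> \<le> (\<Sum>Y\<in>Pow {1..n}. \<Sum>j=1..n. G (flip j Y))"
    using above_subset G0 by (intro sum_mono2 sum_nonneg) auto
  also have "\<dots> = (\<Sum>j=1..n. \<Sum>Y\<in>Pow {1..n}. G (flip j Y))" by (rule sum.swap)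
  also have "\<dots> = (\<Sum>j=1..n. \<Sum>Y\<in>Pow {1..n}. G Y)"
    by (intro sum.cong refl sum.reindex_bij_betw bij_betw_flip) auto
  also have "\<dots> = n * (\<Sum>Y\<in>Pow {1..n}. G Y)" by simp
  also have "(\<Sum>Y\<in>Pow {1..n}. G Y) = (\<Sum>Y\<in>{Y\<in>Pow {1..n}. k \<le> card Y}. f Y)"
    by (simp add: G_def sum.If_cases Int_def)
  also have "{Y\<in>Pow {1..n}. k \<le> card Y} = above n (k - 1)" using k by (auto simp: above_def)
  finally show ?thesis .
qed

text \<open>With \<open>h = card Y\<close>, the new coefficient is the convex combination of
  \<open>g Y\<close> and \<open>E Y\<close> with weights \<open>1 - h / n\<close> and
  \<open>h / n\<close>. By convexity of the square, a step subtracts \<open>(g Y)\<^sup>2\<close>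
  and adds \<open>(E Y)\<^sup>2\<close> in the norm weighted by \<open>n / h\<close>. The added part
  is at most a sixth of the weight on \<open>above n (k - 1)\<close>: a loss of 5/6 remains, and
  level \<open>k\<close> feeds in 1/6.\<close>

lemma hweight_avg_le:
  assumes q: "dens n B q" and k: "k \<ge> 1" and n: "n \<ge> 100"
  defines "M \<equiv> B + real (card {Y \<in> Pow {1..n}. card Y < k})"
  shows "hweight n k (fourier n (avg n q)) \<le> (1 - 5 / 6 * (real k / n)) * hweight n k (fourier n q) +
    1 / 6 * (real k / n) * hweight n (k - 1) (fourier n q) + 5 * M\<^sup>2 * exp (- real n / 64)"
proof -
  define g where "g = fourier n q"
  \<comment> \<open>Removals have only \<open>h - 1\<close> partners while insertions have
    \<open>h\<close>; the subtracted average makes up for the difference.\<close>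
  define E where "E = (\<lambda>Y. ((\<Sum>i=1..n. g (flip i Y)) - (\<Sum>j\<in>Y. g (Y - {j})) / card Y) / (real n - 1))"
  have pointwise: "real n / card Y * (avg n g Y)\<^sup>2 \<le> real n / card Y * (g Y)\<^sup>2 - (g Y)\<^sup>2 + (E Y)\<^sup>2"
    if Y: "Y \<in> above n k" for Y
  proof -
    define h where "h = real (card Y)"
    have YP: "Y \<in> Pow {1..n}" using Y by (auto simp: above_def)
    have h: "1 \<le> h" "h \<le> n" using Y k card_le_n[OF YP] by (auto simp: h_def above_def)
    have "(\<Sum>i\<in>{1..n}. g (flip i Y)) = (\<Sum>i\<in>{1..n}-Y. g (flip i Y)) + (\<Sum>i\<in>Y. g (flip i Y))"
      using YP by (intro sum.subset_diff) auto
    hence fl: "(\<Sum>i\<in>{1..n}. g (flip i Y)) = (\<Sum>j\<in>{1..n}-Y. g (insert j Y)) + (\<Sum>j\<in>Y. g (Y - {j}))"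
      by (simp add: flip_def)
    have "avg n g Y = (1 - h / n) * g Y + ((h - 1) * (\<Sum>j\<in>Y. g (Y - {j})) + h * (\<Sum>j\<in>{1..n}-Y. g (insert j Y))) / (real n * (real n - 1))"
      using YP n unfolding h_def by (intro avg_formula) auto
    also have "(h - 1) * (\<Sum>j\<in>Y. g (Y - {j})) + h * (\<Sum>j\<in>{1..n}-Y. g (insert j Y)) = h * ((real n - 1) * E Y)"
      using h n unfolding E_def fl h_def[symmetric] by (simp add: field_simps)
    also have "h * ((real n - 1) * E Y) / (real n * (real n - 1)) = (h / n) * E Y" using n by simp
    finally have a: "avg n g Y = (1 - h / n) * g Y + (h / n) * E Y" .
    have "(1 - h / n) * (g Y)\<^sup>2 + (h / n) * (E Y)\<^sup>2 - (avg n g Y)\<^sup>2 = (1 - h / n) * (h / n) * (g Y - E Y)\<^sup>2"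
      unfolding a by (simp add: power2_eq_square algebra_simps)
    moreover have "0 \<le> (1 - h / n) * (h / n) * (g Y - E Y)\<^sup>2"
      using h n by (intro mult_nonneg_nonneg) auto
    ultimately have "(avg n g Y)\<^sup>2 \<le> (1 - h / n) * (g Y)\<^sup>2 + (h / n) * (E Y)\<^sup>2" by linarith
    hence "real n / h * (avg n g Y)\<^sup>2 \<le> real n / h * ((1 - h / n) * (g Y)\<^sup>2 + (h / n) * (E Y)\<^sup>2)"
      using h by (intro mult_left_mono) auto
    also have "\<dots> = real n / h * (g Y)\<^sup>2 - (g Y)\<^sup>2 + (E Y)\<^sup>2"
      using h n by (simp add: field_simps)
    finally show ?thesis by (simp add: h_def)
  qed
  have "hweight n k (fourier n (avg n q)) = (\<Sum>Y\<in>above n k. real n / card Y * (avg n g Y)\<^sup>2)"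
    unfolding hweight_def g_def by (intro sum.cong refl) (auto simp: above_def fourier_avg)
  also have "\<dots> \<le> (\<Sum>Y\<in>above n k. real n / card Y * (g Y)\<^sup>2 - (g Y)\<^sup>2 + (E Y)\<^sup>2)"
    by (intro sum_mono pointwise)
  also have "\<dots> = hweight n k g - weight n k g + (\<Sum>Y\<in>above n k. (E Y)\<^sup>2)"
    by (simp add: sum.distrib sum_subtractf hweight_def weight_def)
  also have "(\<Sum>Y\<in>above n k. (E Y)\<^sup>2) \<le> 1 / 6 * weight n (k - 1) g + 5 * M\<^sup>2 * exp (- real n / 64)"
  proof -
    have "(E Y)\<^sup>2 \<le> 2 / (real n - 1)\<^sup>2 * ((\<Sum>i=1..n. g (flip i Y))\<^sup>2 + (\<Sum>j\<in>Y. (g (Y - {j}))\<^sup>2))"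
      if Y: "Y \<in> above n k" for Y
    proof -
      define a b where "a = (\<Sum>i=1..n. g (flip i Y))" and "b = (\<Sum>j\<in>Y. g (Y - {j})) / card Y"
      have c: "card Y \<ge> 1" using Y k by (auto simp: above_def)
      have "(\<Sum>j\<in>Y. 1 * g (Y - {j}))\<^sup>2 \<le> (\<Sum>j\<in>Y. 1\<^sup>2) * (\<Sum>j\<in>Y. (g (Y - {j}))\<^sup>2)"
        by (rule Cauchy_Schwarz_ineq_sum)
      hence "b\<^sup>2 \<le> (\<Sum>j\<in>Y. (g (Y - {j}))\<^sup>2) / card Y"
        using c by (simp add: b_def power_divide divide_simps power2_eq_square mult_ac)
      also have "\<dots> \<le> (\<Sum>j\<in>Y. (g (Y - {j}))\<^sup>2) / 1"
        using c by (intro divide_left_mono sum_nonneg) auto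
      finally have b: "b\<^sup>2 \<le> (\<Sum>j\<in>Y. (g (Y - {j}))\<^sup>2)" by simp
      have "(a - b)\<^sup>2 \<le> 2 * (a\<^sup>2 + b\<^sup>2)"
        using zero_le_power2[of "a + b"] by (simp add: power2_eq_square algebra_simps)
      also have "\<dots> \<le> 2 * (a\<^sup>2 + (\<Sum>j\<in>Y. (g (Y - {j}))\<^sup>2))" using b by simp
      finally have "(a - b)\<^sup>2 / (real n - 1)\<^sup>2 \<le> 2 * (a\<^sup>2 + (\<Sum>j\<in>Y. (g (Y - {j}))\<^sup>2)) / (real n - 1)\<^sup>2"
        by (rule divide_right_mono) simp
      thus ?thesis by (simp add: E_def a_def b_def power_divide)
    qed
    hence "(\<Sum>Y\<in>above n k. (E Y)\<^sup>2) \<le> (\<Sum>Y\<in>above n k. 2 / (real n - 1)\<^sup>2 * ((\<Sum>i=1..n. g (flip i Y))\<^sup>2 + (\<Sum>j\<in>Y. (g (Y - {j}))\<^sup>2)))"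
      by (rule sum_mono)
    also have "\<dots> = 2 / (real n - 1)\<^sup>2 * ((\<Sum>Y\<in>above n k. (\<Sum>i=1..n. g (flip i Y))\<^sup>2) + (\<Sum>Y\<in>above n k. \<Sum>j\<in>Y. (g (Y - {j}))\<^sup>2))"
      by (simp only: sum_distrib_left[symmetric] sum.distrib)
    also have "\<dots> \<le> 2 / (real n - 1)\<^sup>2 * (((real n)\<^sup>2 / 16 * weight n (k - 1) g + 2 * (real n)\<^sup>2 * M\<^sup>2 * exp (- real n / 64)) + n * weight n (k - 1) g)"
    proof (intro mult_left_mono add_mono)
      show "(\<Sum>Y\<in>above n k. (\<Sum>i=1..n. g (flip i Y))\<^sup>2) \<le> (real n)\<^sup>2 / 16 * weight n (k - 1) g + 2 * (real n)\<^sup>2 * M\<^sup>2 * exp (- real n / 64)"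
        unfolding g_def M_def using q k n by (intro sum_flip_power2_le) auto
      show "(\<Sum>Y\<in>above n k. \<Sum>j\<in>Y. (g (Y - {j}))\<^sup>2) \<le> n * weight n (k - 1) g"
        unfolding weight_def using k by (intro sum_above_pred_le[where f = "\<lambda>Y. (g Y)\<^sup>2"]) auto
    qed simp
    also have "\<dots> = (2 * ((real n)\<^sup>2 / 16 + n) / (real n - 1)\<^sup>2) * weight n (k - 1) g + (4 * (real n)\<^sup>2 / (real n - 1)\<^sup>2) * (M\<^sup>2 * exp (- real n / 64))"
      by (simp add: algebra_simps add_divide_distrib)
    also have "\<dots> \<le> 1 / 6 * weight n (k - 1) g + 5 * (M\<^sup>2 * exp (- real n / 64))"
    proof (intro add_mono mult_right_mono)
      have n100: "real n * 100 \<le> real n * real n" using n by (intro mult_left_mono) auto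
      have pos: "(real n - 1)\<^sup>2 > 0" using n by simp
      have sq: "(real n - 1)\<^sup>2 = real n * real n - 2 * real n + 1" "(real n)\<^sup>2 = real n * real n"
        by (simp_all add: power2_eq_square algebra_simps)
      have n': "real n \<ge> 100" using n by simp
      have "2 * (real n * real n / 16 + n) = real n * real n / 8 + 2 * real n" by simp
      moreover have "1 / 6 * (real n * real n - 2 * real n + 1) = real n * real n / 6 - real n / 3 + 1 / 6" by simp
      \<comment> \<open>Twice 1/16 is 1/8; the gap to 1/6 absorbs the terms of lower order.\<close>
      ultimately have "2 * ((real n)\<^sup>2 / 16 + n) \<le> 1 / 6 * (real n - 1)\<^sup>2"
        unfolding sq using n100 n' by linarith
      thus "2 * ((real n)\<^sup>2 / 16 + n) / (real n - 1)\<^sup>2 \<le> 1 / 6" using pos by (simp add: pos_divide_le_eq)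
      have "5 * (real n * real n - 2 * real n + 1) = 5 * (real n * real n) - 10 * real n + 5" by simp
      hence "4 * (real n)\<^sup>2 \<le> 5 * (real n - 1)\<^sup>2"
        unfolding sq using n100 n' by linarith
      thus "4 * (real n)\<^sup>2 / (real n - 1)\<^sup>2 \<le> 5" using pos by (simp add: pos_divide_le_eq)
    qed (auto simp: weight_nonneg)
    finally show ?thesis by (simp add: mult_ac)
  qed
  also have "weight n (k - 1) g = weight n k g + (\<Sum>Y\<in>level n k. (g Y)\<^sup>2)"
    by (rule weight_pred[OF k])
  also have "hweight n k g - weight n k g + (1 / 6 * (weight n k g + (\<Sum>Y\<in>level n k. (g Y)\<^sup>2)) + 5 * M\<^sup>2 * exp (- real n / 64)) =
    hweight n k g - 5 / 6 * weight n k g + 1 / 6 * (\<Sum>Y\<in>level n k. (g Y)\<^sup>2) + 5 * M\<^sup>2 * exp (- real n / 64)"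
    by (simp add: algebra_simps)
  also have "\<dots> \<le> hweight n k g - 5 / 6 * (real k / n * hweight n k g) + 1 / 6 * (real k / n * hweight n (k - 1) g) + 5 * M\<^sup>2 * exp (- real n / 64)"
  proof -
    have "real k / n * hweight n k g \<le> weight n k g" "(\<Sum>Y\<in>level n k. (g Y)\<^sup>2) \<le> real k / n * hweight n (k - 1) g"
      using hweight_le_weight[of k n g] level_le_hweight[of k n g] k n by auto
    thus ?thesis by (intro add_mono diff_mono mult_left_mono) auto
  qed
  also have "\<dots> = (1 - 5 / 6 * (real k / n)) * hweight n k g + 1 / 6 * (real k / n) * hweight n (k - 1) g + 5 * M\<^sup>2 * exp (- real n / 64)"
    by (simp add: algebra_simps)
  finally show ?thesis by (simp add: g_def)
qed

lemma hweight_le_bound: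
  assumes q: "dens n B q" and k: "k \<ge> 1"
  shows "hweight n k (fourier n q) \<le> n * B"
proof -
  have "hweight n k (fourier n q) \<le> (\<Sum>Y\<in>above n k. n * (fourier n q Y)\<^sup>2)"
    unfolding hweight_def using k
    by (intro sum_mono mult_right_mono) (auto simp: above_def divide_le_eq mult_le_cancel_left1)
  also have "\<dots> \<le> (\<Sum>Y\<in>Pow {1..n}. n * (fourier n q Y)\<^sup>2)"
    using above_subset by (intro sum_mono2) auto
  also have "\<dots> \<le> n * B" using dens_sum_power2[OF q] by (simp add: sum_distrib_left[symmetric] mult_left_mono)
  finally show ?thesis .
qed

text \<open>The trivial bound \<open>n * B\<close> holds at \<open>k0\<close>. Above it, loss 5/6
  and inflow 1/6 from one level lower admit the stationary profile
  \<open>(1 / 2) ^ (k - k0)\<close>, as doubling the inflow still leaves it below the loss, and the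
  transient part decays at the net rate 5/6 - 1/6 = 2/3, times at least
  \<open>k0 / n\<close>.\<close>

lemma hweight_funpow_le:
  assumes q: "dens n B q" and n: "n \<ge> 100" and k: "1 \<le> k0" "k0 \<le> k" "k \<le> m" "m \<le> n"
  defines "M \<equiv> B + real (card {Y \<in> Pow {1..n}. card Y < m})"
  shows "hweight n k (fourier n ((avg n ^^ t) q)) \<le>
    n * B * ((1 / 2) ^ (k - k0) + (1 - 2 / 3 * (real k0 / n)) ^ t) + 5 * M\<^sup>2 * exp (- real n / 64) * t"
  using k
proof (induction t arbitrary: k)
  case 0
  have "hweight n k (fourier n q) \<le> n * B" using 0 by (intro hweight_le_bound[OF q]) auto
  moreover have "0 \<le> n * B * (1 / 2) ^ (k - k0)" using dens_bound_nonneg[OF q] by simp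
  ultimately show ?case by (simp add: algebra_simps)
next
  case (Suc t)
  define e where "e = 5 * M\<^sup>2 * exp (- real n / 64)"
  define r where "r = 1 - 2 / 3 * (real k0 / n)"
  have B: "B \<ge> 0" by (rule dens_bound_nonneg[OF q])
  have nB: "n * B \<ge> 0" using B by simp
  have e: "e \<ge> 0" by (simp add: e_def)
  have r: "0 \<le> r" using k n by (simp add: r_def divide_simps)
  have q': "dens n B ((avg n ^^ t) q)" "dens n B ((avg n ^^ Suc t) q)"
    using n by (auto intro!: dens_avg_funpow[OF q] simp del: funpow.simps)
  show ?case
  proof (cases "k = k0")
    case True
    have "hweight n k (fourier n ((avg n ^^ Suc t) q)) \<le> n * B * 1"
      using hweight_le_bound[OF q'(2), of k] Suc.prems by simp
    also have "\<dots> \<le> n * B * ((1 / 2) ^ (k - k0) + r ^ Suc t)"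
      using True nB r by (intro mult_left_mono) auto
    also have "\<dots> \<le> n * B * ((1 / 2) ^ (k - k0) + r ^ Suc t) + e * Suc t"
      using e by (simp del: power_Suc of_nat_Suc)
    finally show ?thesis by (simp only: e_def r_def)
  next
    case False
    define H where "H = (\<lambda>k. hweight n k (fourier n ((avg n ^^ t) q)))"
    define \<kappa> where "\<kappa> = real k / n"
    define A where "A = n * B * (1 / 2) ^ (k - k0)"
    define R where "R = n * B * r ^ t"
    have AR: "A \<ge> 0" "R \<ge> 0" using nB r by (auto simp: A_def R_def)
    have \<kappa>: "0 \<le> \<kappa>" "\<kappa> \<le> 1" "real k0 / n \<le> \<kappa>" using Suc.prems n by (auto simp: \<kappa>_def divide_simps)
    have IH1: "H k \<le> A + R + e * t"
      using Suc.IH[of k] Suc.prems by (simp add: H_def A_def R_def e_def r_def distrib_left)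
    have half: "(1 / 2 :: real) ^ (k - 1 - k0) = 2 * (1 / 2) ^ (k - k0)"
    proof -
      have "k - k0 = Suc (k - 1 - k0)" using False Suc.prems by auto
      thus ?thesis by simp
    qed
    have IH2: "H (k - 1) \<le> 2 * A + R + e * t"
    proof -
      have "H (k - 1) \<le> n * B * ((1 / 2) ^ (k - 1 - k0) + r ^ t) + e * t"
        unfolding H_def e_def r_def using Suc.prems False by (intro Suc.IH) auto
      thus ?thesis unfolding half
        by (simp add: A_def R_def distrib_left)
    qed
    define M' where "M' = B + real (card {Y \<in> Pow {1..n}. card Y < k})"
    have "card {Y \<in> Pow {1..n}. card Y < k} \<le> card {Y \<in> Pow {1..n}. card Y < m}"
      using Suc.prems by (intro card_mono) auto
    hence "M'\<^sup>2 \<le> M\<^sup>2" using B unfolding M'_def M_def by (intro power_mono) auto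
    hence e': "5 * M'\<^sup>2 * exp (- real n / 64) \<le> e" by (simp add: e_def)
    have "hweight n k (fourier n ((avg n ^^ Suc t) q)) \<le> (1 - 5 / 6 * \<kappa>) * H k + 1 / 6 * \<kappa> * H (k - 1) + 5 * M'\<^sup>2 * exp (- real n / 64)"
      using hweight_avg_le[OF q'(1), of k] Suc.prems n by (simp add: H_def \<kappa>_def M'_def)
    also have "\<dots> \<le> (1 - 5 / 6 * \<kappa>) * (A + R + e * t) + 1 / 6 * \<kappa> * (2 * A + R + e * t) + e"
      using \<kappa> by (intro add_mono mult_left_mono IH1 IH2 e') auto
    also have "\<dots> = A + R * (1 - 2 / 3 * \<kappa>) + e * Suc t - \<kappa> / 2 * A - 2 / 3 * \<kappa> * (e * t)"
      by (simp add: field_simps)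
    also have "\<dots> \<le> A + R * (1 - 2 / 3 * \<kappa>) + e * Suc t"
    proof -
      have "0 \<le> \<kappa> / 2 * A" "0 \<le> 2 / 3 * \<kappa> * (e * t)" using \<kappa> AR e by auto
      thus ?thesis by linarith
    qed
    also have "\<dots> \<le> A + R * r + e * Suc t"
      using AR \<kappa> e by (intro add_mono mult_left_mono) (auto simp: r_def)
    also have "\<dots> = n * B * ((1 / 2) ^ (k - k0) + r ^ Suc t) + e * Suc t"
      by (simp add: A_def R_def algebra_simps)
    finally show ?thesis by (simp only: e_def r_def)
  qed
qed

section \<open>Contraction of the low levels\<close>

lemma radial_mono:
  assumes "\<And>k. k \<le> n \<Longrightarrow> f k \<le> g k" "h \<le> n" "n \<ge> 2"
  shows "radial n f h \<le> radial n g h"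
proof -
  have 1: "(1 - real h / real n) * f h \<le> (1 - real h / real n) * g h"
    using assms by (intro mult_left_mono) (auto simp: divide_simps)
  have 2: "real h * (real h - 1) * f (h - 1) \<le> real h * (real h - 1) * g (h - 1)"
    using assms by (cases "h = 0") (auto intro!: mult_left_mono)
  have 3: "real h * (real n - real h) * f (h + 1) \<le> real h * (real n - real h) * g (h + 1)"
    using assms by (cases "h = n") (auto intro!: mult_left_mono)
  show ?thesis unfolding radial_def using assms(3)
    by (intro add_mono 1 divide_right_mono 2 3) auto
qed

lemma radial_const: "n \<ge> 2 \<Longrightarrow> radial n (\<lambda>_. c) h = c"
  by (simp add: radial_def divide_simps) (simp add: algebra_simps)

lemma radial_add: "radial n (\<lambda>k. f k + g k) h = radial n f h + radial n g h"
  unfolding radial_def distrib_left add_divide_distrib by simp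

lemma radial_nonneg: "(\<And>k. k \<le> n \<Longrightarrow> 0 \<le> f k) \<Longrightarrow> h \<le> n \<Longrightarrow> n \<ge> 2 \<Longrightarrow> 0 \<le> radial n f h"
  using radial_mono[of n "\<lambda>_. 0" f h] by (simp add: radial_const)

text \<open>Cauchy-Schwarz over the \<open>n - k\<close> insertions; each set of size
  \<open>Suc k\<close> is hit \<open>Suc k\<close> times, and \<open>Suc_times_choose\<close>
  converts this count into the normalisation. Constants on the level give equality, so nothing is
  lost for functions of the cardinality.\<close>

lemma L2_set_up:
  assumes "k \<le> n" "0 \<le> c" "k < n \<Longrightarrow> L2_set G (level n (Suc k)) \<le> sqrt (n choose Suc k) * c"
  shows "L2_set (\<lambda>Y. \<Sum>j\<in>{1..n}-Y. G (insert j Y)) (level n k) \<le> sqrt (n choose k) * ((real n - k) * c)"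
proof (cases "k = n")
  case True
  have "(\<Sum>j\<in>{1..n}-Y. G (insert j Y)) = 0" if "Y \<in> level n k" for Y
  proof -
    have "Y = {1..n}" using that True by (intro card_subset_eq) (auto simp: level_def)
    thus ?thesis by simp
  qed
  thus ?thesis using True by (simp add: L2_set_def)
next
  case False
  have "(\<Sum>Y\<in>level n k. (\<Sum>j\<in>{1..n}-Y. G (insert j Y))\<^sup>2) \<le>
    (\<Sum>Y\<in>level n k. (real n - k) * (\<Sum>j\<in>{1..n}-Y. (G (insert j Y))\<^sup>2))"
  proof (rule sum_mono)
    fix Y assume Y: "Y \<in> level n k"
    have c: "real (card ({1..n} - Y)) = real n - k"
      using Y assms(1) by (auto simp: level_def card_Diff_subset finite_subset of_nat_diff)
    have "(\<Sum>j\<in>{1..n}-Y. 1 * G (insert j Y))\<^sup>2 \<le> (\<Sum>j\<in>{1..n}-Y. 1\<^sup>2) * (\<Sum>j\<in>{1..n}-Y. (G (insert j Y))\<^sup>2)"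
      by (rule Cauchy_Schwarz_ineq_sum)
    thus "(\<Sum>j\<in>{1..n}-Y. G (insert j Y))\<^sup>2 \<le> (real n - k) * (\<Sum>j\<in>{1..n}-Y. (G (insert j Y))\<^sup>2)"
      by (simp add: c)
  qed
  also have "\<dots> = (real n - k) * (real (Suc k) * (\<Sum>Y\<in>level n (Suc k). (G Y)\<^sup>2))"
    unfolding sum_distrib_left[symmetric] by (subst level_sum_up[where f = "\<lambda>Y. (G Y)\<^sup>2"]) simp
  also have "(\<Sum>Y\<in>level n (Suc k). (G Y)\<^sup>2) \<le> (sqrt (n choose Suc k) * c)\<^sup>2"
  proof -
    have "(L2_set G (level n (Suc k)))\<^sup>2 \<le> (sqrt (n choose Suc k) * c)\<^sup>2"
      using False assms by (intro power_mono L2_set_nonneg) auto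
    thus ?thesis by (simp add: L2_set_def sum_nonneg)
  qed
  also have "(real n - k) * (real (Suc k) * (sqrt (n choose Suc k) * c)\<^sup>2) = (real n - k) * (real (Suc k) * real (n choose Suc k)) * c\<^sup>2"
    by (simp add: power_mult_distrib mult_ac)
  also have "\<dots> = (sqrt (n choose k) * ((real n - k) * c))\<^sup>2"
    unfolding Suc_times_choose by (simp add: power_mult_distrib power2_eq_square mult_ac)
  finally show ?thesis unfolding L2_set_def using assms
    by (intro real_le_lsqrt sum_nonneg) (auto simp: mult_left_mono)
qed

lemma L2_set_down:
  assumes "k < n" "0 \<le> c" "L2_set G (level n k) \<le> sqrt (n choose k) * c"
  shows "L2_set (\<lambda>Z. \<Sum>j\<in>Z. G (Z - {j})) (level n (Suc k)) \<le> sqrt (n choose Suc k) * (real (Suc k) * c)"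
proof -
  have "(\<Sum>Z\<in>level n (Suc k). (\<Sum>j\<in>Z. G (Z - {j}))\<^sup>2) \<le>
    (\<Sum>Z\<in>level n (Suc k). real (Suc k) * (\<Sum>j\<in>Z. (G (Z - {j}))\<^sup>2))"
  proof (rule sum_mono)
    fix Z assume Z: "Z \<in> level n (Suc k)"
    have "(\<Sum>j\<in>Z. 1 * G (Z - {j}))\<^sup>2 \<le> (\<Sum>j\<in>Z. 1\<^sup>2) * (\<Sum>j\<in>Z. (G (Z - {j}))\<^sup>2)"
      by (rule Cauchy_Schwarz_ineq_sum)
    thus "(\<Sum>j\<in>Z. G (Z - {j}))\<^sup>2 \<le> real (Suc k) * (\<Sum>j\<in>Z. (G (Z - {j}))\<^sup>2)"
      using Z by (simp add: level_def)
  qed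
  also have "\<dots> = real (Suc k) * ((real n - k) * (\<Sum>Y\<in>level n k. (G Y)\<^sup>2))"
    unfolding sum_distrib_left[symmetric] by (subst level_sum_down[where f = "\<lambda>Y. (G Y)\<^sup>2"]) simp
  also have "(\<Sum>Y\<in>level n k. (G Y)\<^sup>2) \<le> (sqrt (n choose k) * c)\<^sup>2"
  proof -
    have "(L2_set G (level n k))\<^sup>2 \<le> (sqrt (n choose k) * c)\<^sup>2"
      using assms by (intro power_mono L2_set_nonneg) auto
    thus ?thesis by (simp add: L2_set_def sum_nonneg)
  qed
  also have "real (Suc k) * ((real n - k) * (sqrt (n choose k) * c)\<^sup>2) = real (Suc k) * ((real n - k) * real (n choose k)) * c\<^sup>2"
    by (simp add: power_mult_distrib mult_ac)
  also have "\<dots> = (sqrt (n choose Suc k) * (real (Suc k) * c))\<^sup>2"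
    unfolding Suc_times_choose[symmetric] by (simp add: power_mult_distrib power2_eq_square mult_ac)
  finally show ?thesis unfolding L2_set_def using assms
    by (intro real_le_lsqrt sum_nonneg) (auto simp: mult_left_mono)
qed

text \<open>By Cauchy-Schwarz, functions of the cardinality alone are the worst case.\<close>

lemma L2_set_level_avg:
  assumes n: "n \<ge> 2" and f0: "\<And>k. k \<le> n \<Longrightarrow> 0 \<le> f k"
    and f: "\<And>k. k \<le> n \<Longrightarrow> L2_set G (level n k) \<le> sqrt (n choose k) * f k" and k: "k \<le> n"
  shows "L2_set (avg n G) (level n k) \<le> sqrt (n choose k) * radial n f k"
proof (cases k)
  case 0
  thus ?thesis using f[of 0] n by (simp add: L2_set_def avg_empty radial_def)
next
  case (Suc k')
  define N where "N = real n * (real n - 1)"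
  have N: "N > 0" using n by (simp add: N_def)
  define s where "s = sqrt (n choose k)"
  define U where "U = (\<lambda>Y. \<Sum>j\<in>{1..n}-Y. G (insert j Y))"
  define D where "D = (\<lambda>Y. \<Sum>j\<in>Y. G (Y - {j}))"
  have "L2_set (avg n G) (level n k) =
    L2_set (\<lambda>Y. (1 - real k / n) * G Y + ((real k - 1) / N * D Y + real k / N * U Y)) (level n k)"
  proof (rule L2_set_cong[OF refl])
    fix Y assume "Y \<in> level n k"
    thus "avg n G Y = (1 - real k / n) * G Y + ((real k - 1) / N * D Y + real k / N * U Y)"
      using n by (simp add: level_def avg_formula D_def U_def N_def add_divide_distrib)
  qed
  also have "\<dots> \<le> L2_set (\<lambda>Y. (1 - real k / n) * G Y) (level n k) + (L2_set (\<lambda>Y. (real k - 1) / N * D Y) (level n k) + L2_set (\<lambda>Y. real k / N * U Y) (level n k))"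
    by (intro order_trans[OF L2_set_triangle_ineq] add_left_mono L2_set_triangle_ineq)
  also have "\<dots> = (1 - real k / n) * L2_set G (level n k) + ((real k - 1) / N * L2_set D (level n k) + real k / N * L2_set U (level n k))"
    using k N Suc n by (subst (1 2 3) L2_set_right_distrib[symmetric]) (auto simp: divide_simps)
  also have "\<dots> \<le> (1 - real k / n) * (s * f k) + ((real k - 1) / N * (s * (k * f (k - 1))) + real k / N * (s * ((real n - k) * f (k + 1))))"
  proof (intro add_mono mult_left_mono)
    show "L2_set D (level n k) \<le> s * (k * f (k - 1))"
      unfolding D_def s_def Suc using k Suc f0[of k'] f[of k'] by (simp del: of_nat_Suc) (intro L2_set_down, auto)
    show "L2_set U (level n k) \<le> s * ((real n - k) * f (k + 1))"
    proof (cases "k = n")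
      case True
      thus ?thesis using L2_set_up[of k n 0 G] k by (simp add: U_def s_def)
    next
      case False
      thus ?thesis unfolding U_def s_def using k f0[of "k + 1"] f[of "k + 1"] by (intro L2_set_up) (auto simp: Suc_eq_plus1)
    qed
  qed (use f[OF k] k N Suc n in \<open>auto simp: s_def divide_simps\<close>)
  also have "\<dots> = s * radial n f k"
    unfolding radial_def N_def[symmetric] by (simp add: add_divide_distrib distrib_left mult_ac)
  finally show ?thesis by (simp add: s_def)
qed

lemma L2_set_level_avg_funpow:
  assumes n: "n \<ge> 2" and f0: "\<And>k. k \<le> n \<Longrightarrow> 0 \<le> f k"
    and f: "\<And>k. k \<le> n \<Longrightarrow> L2_set G (level n k) \<le> sqrt (n choose k) * f k" and k: "k \<le> n"
  shows "0 \<le> (radial n ^^ t) f k \<and> L2_set ((avg n ^^ t) G) (level n k) \<le> sqrt (n choose k) * (radial n ^^ t) f k"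
  using k
proof (induction t arbitrary: k)
  case (Suc t)
  show ?case unfolding funpow.simps o_apply
    using Suc.IH Suc.prems n by (intro conjI radial_nonneg L2_set_level_avg) auto
qed (use f f0 in auto)

text \<open>
  Started from level \<open>h\<close>, each of the \<open>h\<close> elements contributes the probability scale
  \<open>a \<approx> exp (- t / n)\<close> of not having spread; the terms \<open>4 * i / n\<close> absorb the downward steps.
\<close>

definition sup_sol :: "nat \<Rightarrow> real \<Rightarrow> nat \<Rightarrow> real" where
  "sup_sol n a h = (\<Prod>i<h. a + 4 * real i / real n)"

lemma weierstrass_product:
  fixes x :: "nat \<Rightarrow> real"
  assumes "\<And>i. i < h \<Longrightarrow> 0 \<le> x i \<and> x i \<le> 1"
  shows "1 - (\<Sum>i<h. x i) \<le> (\<Prod>i<h. 1 - x i) \<and> (\<Prod>i<h. 1 - x i) \<le> 1 \<and> 0 \<le> (\<Prod>i<h. 1 - x i)"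
  using assms
proof (induction h)
  case (Suc h)
  hence IH: "1 - (\<Sum>i<h. x i) \<le> (\<Prod>i<h. 1 - x i)" "(\<Prod>i<h. 1 - x i) \<le> 1" "0 \<le> (\<Prod>i<h. 1 - x i)"
    and x: "0 \<le> x h" "x h \<le> 1" by auto
  define p where "p = (\<Prod>i<h. 1 - x i)"
  have "p * x h \<le> 1 * x h" using IH x by (intro mult_right_mono) (auto simp: p_def)
  moreover have "0 \<le> p * x h" "0 \<le> p * (1 - x h)" using IH x by (auto simp: p_def)
  moreover have "(\<Prod>i<Suc h. 1 - x i) = p - p * x h" by (simp add: p_def algebra_simps)
  ultimately show ?case using IH by (simp add: p_def algebra_simps)
qed simp

lemma sup_sol_pos: "a > 0 \<Longrightarrow> 0 < sup_sol n a h"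
  unfolding sup_sol_def by (intro prod_pos) (auto intro: add_pos_nonneg)

text \<open>Relative to \<open>sup_sol n a h\<close>, an upward step has the factor
  \<open>a + 4 * h / n\<close> and a downward step the factor \<open>1 / b\<close>, where
  \<open>b\<close> is the last factor of the product and \<open>z\<close> the share of
  \<open>b\<close> not due to \<open>a\<close>. By the constant 4, downward steps cost
  \<open>z / 4\<close> up to \<open>n / (n - 1)\<close>, hence at most \<open>z / 3\<close>. In
  return, lowering \<open>a\<close> to \<open>a'\<close> reduces the product less than for
  \<open>z = 0\<close>: averaged over the factors, the saving is \<open>z / 2\<close>.\<close>

lemma radial_sup_sol_le:
  assumes a: "0 < a'" "a' \<le> a" "a \<le> 1 / 12" and n: "n \<ge> 4" and h: "1 \<le> h" "48 * h \<le> n"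
    and step: "a' \<ge> a * (1 - (1 - 2 * a - 8 / n) / n)"
  shows "radial n (sup_sol n a) h \<le> sup_sol n a' h"
proof -
  define N where "N = real n * (real n - 1)"
  have N: "N > 0" using n by (simp add: N_def)
  define U where "U = sup_sol n a h"
  have U: "U > 0" using a by (simp add: U_def sup_sol_pos)
  define b where "b = a + 4 * (real h - 1) / n"
  define z where "z = (4 * (real h - 1) / n) / b"
  define \<kappa> where "\<kappa> = 2 * a + 8 / n"
  have n0: "real n > 0" using n by simp
  have h1: "real h \<ge> 1" using h by simp
  have b0: "b > 0" unfolding b_def using a h1 by (intro add_pos_nonneg divide_nonneg_nonneg) auto
  have b6: "b \<le> 1 / 6"
  proof -
    have "4 * (real h - 1) / n \<le> 1 / 12" using h n0 by (simp add: divide_simps)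
    thus ?thesis unfolding b_def using a by linarith
  qed
  have z: "0 \<le> z" "z \<le> 1" "4 * (real h - 1) / n = z * b"
  proof -
    have X: "0 \<le> 4 * (real h - 1) / n" "4 * (real h - 1) / n \<le> b" using h1 a by (auto simp: b_def)
    show "0 \<le> z" unfolding z_def by (rule divide_nonneg_pos[OF X(1) b0])
    show "z \<le> 1" unfolding z_def by (rule mult_imp_div_pos_le[OF b0]) (use X in simp)
    show "4 * (real h - 1) / n = z * b" unfolding z_def using b0 by simp
  qed
  have \<kappa>: "\<kappa> \<ge> 0" using a by (simp add: \<kappa>_def)
  define x where "x = (\<lambda>i. (a - a') / (a + 4 * real i / n))"
  have pos: "a + 4 * real i / n > 0" for i using a by (intro add_pos_nonneg) auto
  have x: "0 \<le> x i \<and> x i \<le> 1" for i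
  proof
    show "0 \<le> x i" unfolding x_def using a pos[of i] by (intro divide_nonneg_pos) auto
    have "a - a' \<le> 1 * (a + 4 * real i / n)" using a by (simp add: add_increasing2)
    thus "x i \<le> 1" unfolding x_def by (rule mult_imp_div_pos_le[OF pos])
  qed
  have xsum: "(\<Sum>i<h. x i) \<le> real h / n * ((1 - \<kappa>) * (1 - z / 2))"
  proof -
    define c where "c = (a - a') / a"
    have c: "0 \<le> c" "c \<le> (1 - \<kappa>) / n"
    proof -
      have "a - a' \<le> a * ((1 - \<kappa>) / n)" using step by (simp add: \<kappa>_def algebra_simps)
      thus "c \<le> (1 - \<kappa>) / n" using a by (simp add: c_def pos_divide_le_eq mult.commute)
    qed (use a in \<open>simp add: c_def\<close>)
    have "(\<Sum>i<h. x i) \<le> (\<Sum>i<h. c * (1 - 4 * real i / n / b))"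
    proof (rule sum_mono)
      fix i assume i: "i \<in> {..<h}"
      have le: "a + 4 * real i / n \<le> b"
      proof -
        have "real i \<le> real h - 1" using i by auto
        hence "4 * real i / n \<le> 4 * (real h - 1) / n" using n0 by (intro divide_right_mono) auto
        thus ?thesis by (simp add: b_def)
      qed
      have "x i = c * (a / (a + 4 * real i / n))" using a by (simp add: x_def c_def)
      also have "a / (a + 4 * real i / n) = 1 - (4 * real i / n) / (a + 4 * real i / n)"
      proof -
        have "a / (a + 4 * real i / n) = ((a + 4 * real i / n) - 4 * real i / n) / (a + 4 * real i / n)" by simp
        also have "\<dots> = 1 - (4 * real i / n) / (a + 4 * real i / n)"
          unfolding diff_divide_distrib using pos[of i] by simp
        finally show ?thesis .
      qed
      also have "\<dots> \<le> 1 - (4 * real i / n) / b"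
        using le pos[of i] by (intro diff_left_mono divide_left_mono) auto
      finally show "x i \<le> c * (1 - 4 * real i / n / b)" using c by (simp add: mult_left_mono)
    qed
    also have "\<dots> = c * (\<Sum>i<h. 1 - 4 / (n * b) * real i)"
      by (simp add: sum_distrib_left)
    also have "(\<Sum>i<h. 1 - 4 / (n * b) * real i) = h - 4 / (n * b) * (\<Sum>i<h. real i)"
      by (simp only: sum_subtractf sum_distrib_left[symmetric]) simp
    also have "(\<Sum>i<h. real i) = real h * (real h - 1) / 2"
      by (induction h) (simp_all add: field_simps)
    also have "real h - 4 / (n * b) * (real h * (real h - 1) / 2) = real h * (1 - z / 2)"
      using n0 b0 by (simp add: z_def field_simps)
    also have "c * (real h * (1 - z / 2)) \<le> (1 - \<kappa>) / n * (real h * (1 - z / 2))"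
      using c z by (intro mult_right_mono) auto
    finally show ?thesis by (simp add: mult_ac)
  qed
  have up: "sup_sol n a (h + 1) = U * (a + 4 * real h / n)"
    unfolding U_def sup_sol_def Suc_eq_plus1[symmetric] by simp
  have down: "sup_sol n a (h - 1) = U / b"
  proof -
    obtain k where k: "h = Suc k" using h by (cases h) auto
    have "U = sup_sol n a k * b" by (simp add: U_def sup_sol_def k b_def)
    thus ?thesis using b0 by (simp add: k)
  qed
  have "radial n (sup_sol n a) h = U * (1 - real h / n + real h * (real h - 1) / N / b + real h * (real n - h) / N * (a + 4 * real h / n))"
    unfolding radial_def up down N_def[symmetric] U_def[symmetric] using N b0 by (simp add: field_simps)
  also have "\<dots> \<le> U * (1 - (\<Sum>i<h. x i))"
  proof (intro mult_left_mono)
    have t1: "real h * (real h - 1) / N / b \<le> real h / n * (z / 3)"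
    proof -
      have "real h * (real h - 1) / N / b = real h / n * (z * (n / (4 * (real n - 1))))"
        using n0 b0 n by (simp add: z_def N_def field_simps)
      also have "\<dots> \<le> real h / n * (z * (1 / 3))"
        using z n by (intro mult_left_mono) (auto simp: divide_simps)
      finally show ?thesis by simp
    qed
    have t2: "real h * (real n - h) / N * (a + 4 * real h / n) \<le> real h / n * (a + 4 * real h / n)"
    proof (intro mult_right_mono)
      have "real h * (real n - h) / N \<le> real h * (real n - 1) / N"
        using h1 N by (intro divide_right_mono mult_left_mono) auto
      also have "\<dots> = real h / n" using n by (simp add: N_def)
      finally show "real h * (real n - h) / N \<le> real h / n" .
    qed (use pos[of h] in simp)
    \<comment> \<open>The room \<open>z / 2 - z / 3\<close> pays for \<open>z * b\<close>, as
      \<open>b\<close> is at most 1/6, and half of \<open>\<kappa>\<close> pays for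
      \<open>a + 4 / n\<close>.\<close>
    have "(1 - \<kappa>) * (1 - z / 2) \<le> 1 - z / 3 - (a + 4 * real h / n)"
    proof -
      have zb: "z * b \<le> z / 6" using z b6 mult_left_mono[of b "1 / 6" z] by simp
      have kz: "\<kappa> * z \<le> \<kappa>" using \<kappa> z by (simp add: mult_left_le)
      have hh: "4 * real h / n = 4 / n + z * b" unfolding z(3)[symmetric] by (simp add: diff_divide_distrib)
      have kk: "\<kappa> = 2 * a + 2 * (4 / n)" by (simp add: \<kappa>_def)
      have "(1 - \<kappa>) * (1 - z / 2) = 1 - z / 2 - \<kappa> + \<kappa> * z / 2" by (simp add: field_simps)
      also have "\<dots> \<le> 1 - z / 2 - \<kappa> / 2" using kz by simp
      also have "\<dots> \<le> 1 - z / 3 - (a + (4 / n + z * b))" using zb unfolding kk by argo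
      finally show ?thesis by (simp only: hh)
    qed
    hence "real h / n * ((1 - \<kappa>) * (1 - z / 2)) \<le> real h / n * (1 - z / 3 - (a + 4 * real h / n))"
      by (intro mult_left_mono) auto
    moreover have "real h / n * (1 - z / 3 - (a + 4 * real h / n)) = real h / n - real h / n * (z / 3) - real h / n * (a + 4 * real h / n)"
      by (simp only: right_diff_distrib mult_1_right)
    ultimately show "1 - real h / n + real h * (real h - 1) / N / b + real h * (real n - h) / N * (a + 4 * real h / n) \<le> 1 - (\<Sum>i<h. x i)"
      using xsum t1 t2 by linarith
  qed (use U in simp)
  also have "\<dots> \<le> U * (\<Prod>i<h. 1 - x i)"
    using weierstrass_product[of h x] x U by (intro mult_left_mono) auto
  also have "\<dots> = (\<Prod>i<h. (a + 4 * real i / n) * (1 - x i))"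
    by (simp add: U_def sup_sol_def prod.distrib)
  also have "\<dots> = sup_sol n a' h" unfolding sup_sol_def
  proof (intro prod.cong refl)
    fix i
    have "(a + 4 * real i / n) * x i = a - a'" unfolding x_def using pos[of i] by simp
    thus "(a + 4 * real i / n) * (1 - x i) = a' + 4 * real i / n"
      by (simp only: right_diff_distrib mult_1_right)
  qed
  finally show ?thesis .
qed

text \<open>Every factor is at most 1/12 + 1/12 in this range.\<close>

lemma sup_sol_antimono:
  assumes a: "0 < a" "a \<le> 1 / 12" and h: "k \<le> h" "48 * h \<le> n" "n \<ge> 1"
  shows "sup_sol n a h \<le> (1 / 6) ^ (h - k) * sup_sol n a k"
  using h
proof (induction h rule: dec_induct)
  case (step h)
  have "4 * real h / n \<le> 1 / 12" using step.prems by (simp add: divide_simps)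
  hence f: "0 \<le> a + 4 * real h / n" "a + 4 * real h / n \<le> 1 / 6" using a by auto
  have "sup_sol n a (Suc h) = (a + 4 * real h / n) * sup_sol n a h" by (simp add: sup_sol_def)
  also have "\<dots> \<le> 1 / 6 * ((1 / 6) ^ (h - k) * sup_sol n a k)"
    using f step sup_sol_pos[OF a(1), of n h] by (intro mult_mono) auto
  finally show ?case using step by (simp add: Suc_diff_le)
qed simp

lemma sup_sol_le_power:
  assumes "0 < a" "a \<le> 1 / 12" "48 * h \<le> n" "n \<ge> 1"
  shows "sup_sol n a h \<le> (1 / 6) ^ h"
  using sup_sol_antimono[of a 0 h n] assms by (simp add: sup_sol_def)

text \<open>
  The supersolution is frozen above level \<open>m = n div 48\<close>; the error made there is exponentially small.
\<close>

lemma radial_funpow_le: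
  fixes a :: "nat \<Rightarrow> real"
  assumes n: "n \<ge> 96" and m: "m = n div 48"
    and a: "\<And>t. 0 < a t" "\<And>t. a (Suc t) \<le> a t" "a 0 \<le> 1 / 12"
    and step: "\<And>t. a (Suc t) \<ge> a t * (1 - (1 - 2 * a t - 8 / n) / n)"
    and f: "\<And>k. k \<le> n \<Longrightarrow> f k \<le> sup_sol n (a 0) (min k m)"
    and h: "h \<le> n"
  shows "(radial n ^^ t) f h \<le> sup_sol n (a t) (min h m) + t * (1 / 6) ^ (m - 1)"
  using h
proof (induction t arbitrary: h)
  case (Suc t)
  define e where "e = (1 / 6 :: real) ^ (m - 1)"
  have n2: "n \<ge> 2" using n by simp
  have m2: "m \<ge> 2" "48 * m \<le> n" using n by (auto simp: m)
  have at: "a s \<le> 1 / 12" for s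
  proof (induction s)
    case (Suc s)
    show ?case by (rule order_trans[OF a(2) Suc])
  qed (rule a(3))
  define V where "V = (\<lambda>h. sup_sol n (a t) (min h m))"
  have V0: "V k > 0" for k using a by (simp add: V_def sup_sol_pos)
  \<comment> \<open>A downward step from level \<open>m\<close> lands on \<open>m - 1\<close>, hence
    the exponent \<open>m - 1\<close> in \<open>e\<close>.\<close>
  have small: "V k \<le> e" if "m - 1 \<le> k" for k
  proof -
    have "V k \<le> (1 / 6) ^ (min k m)" unfolding V_def using a at m2 n by (intro sup_sol_le_power) auto
    also have "\<dots> \<le> e" unfolding e_def using that by (intro power_decreasing) auto
    finally show ?thesis .
  qed
  have "(radial n ^^ Suc t) f h \<le> radial n (\<lambda>h. V h + t * e) h"
    unfolding funpow.simps o_apply V_def e_def using Suc by (intro radial_mono n2) auto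
  also have "\<dots> = radial n V h + t * e" using n2 by (simp add: radial_add radial_const)
  also have "radial n V h \<le> sup_sol n (a (Suc t)) (min h m) + e"
  proof -
    consider "h = 0" | "1 \<le> h" "h < m" | "m \<le> h" by linarith
    thus ?thesis
    proof cases
      case 1
      thus ?thesis by (simp add: radial_def V_def sup_sol_def e_def)
    next
      case 2
      have "radial n V h = radial n (sup_sol n (a t)) h" using 2 by (simp add: radial_def V_def)
      also have "\<dots> \<le> sup_sol n (a (Suc t)) h"
        using 2 a at step[of t] n m2 by (intro radial_sup_sol_le) auto
      finally show ?thesis using 2 by (simp add: e_def add_increasing2)
    next
      case 3
      have "radial n V h \<le> radial n (\<lambda>_. e) h"
      proof -
        have "radial n V h = (1 - real h / n) * V h + (real h * (real h - 1) * V (h - 1) + real h * (real n - h) * V (h + 1)) / (real n * (real n - 1))"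
          by (simp add: radial_def)
        also have "\<dots> \<le> (1 - real h / n) * e + (real h * (real h - 1) * e + real h * (real n - h) * e) / (real n * (real n - 1))"
          using 3 Suc.prems n m2 by (intro add_mono mult_left_mono divide_right_mono small) (auto simp: divide_simps)
        finally show ?thesis by (simp add: radial_def)
      qed
      also have "\<dots> = e" using n2 by (simp add: radial_const)
      finally show ?thesis using sup_sol_pos[OF a(1), of n "Suc t" "min h m"] by linarith
    qed
  qed
  finally show ?case by (simp add: e_def algebra_simps)
qed (use f in auto)

text \<open>An explicit majorant of \<open>2 * solrate n s + 8 / n\<close>, so that the nonlinear
  recursion for \<open>solrate\<close> is replaced by a sum. The argument is a bootstrap:
  \<open>rate\<close> is at most 1/2, which gives decay at half speed, and this suffices for the
  majorant.\<close>

definition rate :: "nat \<Rightarrow> nat \<Rightarrow> real" where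
  "rate n s = 1 / 6 * exp (- real s / (2 * real n)) + 8 / real n"

text \<open>An explicit sequence decreasing slowly enough for the step condition of \<open>radial_sup_sol_le\<close>.\<close>

definition solrate :: "nat \<Rightarrow> nat \<Rightarrow> real" where
  "solrate n t = 1 / 12 * exp (- real t / real n + (\<Sum>s<t. rate n s) / real n)"

lemma solrate_Suc: "solrate n (Suc t) = solrate n t * exp (- (1 - rate n t) / n)"
  by (simp add: solrate_def exp_add[symmetric] add_divide_distrib diff_divide_distrib algebra_simps)

lemma rate_le: "n \<ge> 24 \<Longrightarrow> rate n s \<le> 1 / 2"
proof -
  assume n: "n \<ge> 24"
  have "exp (- real s / (2 * real n)) \<le> 1" by simp
  moreover have "8 / real n \<le> 1 / 3" using n by (simp add: divide_simps)
  ultimately show ?thesis unfolding rate_def by linarith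
qed

lemma solrate_le_half: "n \<ge> 24 \<Longrightarrow> solrate n t \<le> 1 / 12 * exp (- real t / (2 * real n))"
proof -
  assume n: "n \<ge> 24"
  have "(\<Sum>s<t. rate n s) \<le> (\<Sum>s<t. 1 / 2)" using rate_le[OF n] by (intro sum_mono) auto
  hence "(\<Sum>s<t. rate n s) / n \<le> (real t / 2) / n" by (intro divide_right_mono) auto
  hence "- real t / real n + (\<Sum>s<t. rate n s) / real n \<le> - real t / (2 * real n)"
    using n by (simp add: field_simps)
  thus ?thesis by (simp add: solrate_def)
qed

lemma solrate_step:
  assumes n: "n \<ge> 24"
  shows "0 < solrate n t" "solrate n (Suc t) \<le> solrate n t"
    "solrate n (Suc t) \<ge> solrate n t * (1 - (1 - 2 * solrate n t - 8 / n) / n)"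
proof -
  show p: "0 < solrate n t" by (simp add: solrate_def)
  have "exp (- (1 - rate n t) / n) \<le> 1" using rate_le[OF n, of t] n by (simp add: divide_simps)
  thus "solrate n (Suc t) \<le> solrate n t" using p by (simp add: solrate_Suc mult_left_le)
  have "2 * solrate n t + 8 / n \<le> rate n t" using solrate_le_half[OF n, of t] by (simp add: rate_def)
  hence "(1 - rate n t) / n \<le> (1 - 2 * solrate n t - 8 / n) / n" by (intro divide_right_mono) auto
  moreover have "- (1 - rate n t) / n = - ((1 - rate n t) / n)" by (rule minus_divide_left[symmetric])
  ultimately have "1 - (1 - 2 * solrate n t - 8 / n) / n \<le> 1 + - (1 - rate n t) / n" by linarith
  also have "\<dots> \<le> exp (- (1 - rate n t) / n)" by (rule exp_ge_add_one_self)
  finally show "solrate n (Suc t) \<ge> solrate n t * (1 - (1 - 2 * solrate n t - 8 / n) / n)"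
    unfolding solrate_Suc using p by (intro mult_left_mono) auto
qed

text \<open>The half-speed terms sum geometrically to at most \<open>2 * n / 3\<close>, so full
  speed is reached up to the factor exp (2/3), which is at most 2. The terms \<open>8 / n\<close>
  accumulate to \<open>8 * t / n\<^sup>2\<close>.\<close>

lemma solrate_le:
  assumes n: "n \<ge> 24"
  shows "solrate n t \<le> 1 / 6 * exp (- real t / n + 8 * real t / (real n)\<^sup>2)"
proof -
  define x where "x = exp (- 1 / (2 * real n))"
  have x: "0 < x" "x < 1" using n by (auto simp: x_def)
  have x1: "1 / (4 * real n) \<le> 1 - x"
  proof -
    define y where "y = 1 / (2 * real n)"
    have y: "0 < y" "y \<le> 1" using n by (auto simp: y_def divide_simps)
    have "x = 1 / exp y" by (simp add: x_def y_def exp_minus inverse_eq_divide)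
    also have "\<dots> \<le> 1 / (1 + y)" using y by (intro divide_left_mono exp_ge_add_one_self) (auto intro: mult_pos_pos add_pos_pos)
    also have "\<dots> \<le> 1 - y / 2" using y by (simp add: divide_simps) (simp add: algebra_simps mult_left_le)
    finally show ?thesis by (simp add: y_def)
  qed
  have "(\<Sum>s<t. x ^ s) = (1 - x ^ t) / (1 - x)" using x by (simp add: sum_gp_strict)
  also have "\<dots> \<le> 1 / (1 - x)" using x by (intro divide_right_mono) auto
  also have "\<dots> \<le> 1 / (1 / (4 * real n))" using x1 n x by (intro divide_left_mono) auto
  finally have gp: "(\<Sum>s<t. x ^ s) \<le> 4 * n" by simp
  have "(\<Sum>s<t. rate n s) = (\<Sum>s<t. 1 / 6 * x ^ s + 8 / n)"
    by (intro sum.cong refl) (simp add: rate_def x_def exp_of_nat_mult[symmetric])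
  also have "\<dots> = 1 / 6 * (\<Sum>s<t. x ^ s) + t * (8 / n)" by (simp add: sum.distrib sum_distrib_left)
  also have "\<dots> \<le> 1 / 6 * (4 * n) + t * (8 / n)" using gp by simp
  finally have "(\<Sum>s<t. rate n s) / n \<le> (1 / 6 * (4 * n) + t * (8 / n)) / n" by (rule divide_right_mono) simp
  also have "\<dots> = 2 / 3 + 8 * real t / (real n)\<^sup>2" using n by (simp add: field_simps power2_eq_square)
  finally have "solrate n t \<le> 1 / 12 * exp (2 / 3 + (- real t / n + 8 * real t / (real n)\<^sup>2))"
    by (simp add: solrate_def)
  also have "\<dots> = 1 / 12 * exp (2 / 3) * exp (- real t / n + 8 * real t / (real n)\<^sup>2)" by (simp add: exp_add)
  also have "\<dots> \<le> 1 / 12 * 2 * exp (- real t / n + 8 * real t / (real n)\<^sup>2)"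
  proof (intro mult_right_mono mult_left_mono)
    have "ln (2 :: real) \<ge> 2 / 3" by (rule order_trans[OF _ ln2_ge_two_thirds]) simp
    thus "exp (2 / 3 :: real) \<le> 2" using exp_le_cancel_iff[of "2 / 3" "ln 2 :: real"] by simp
  qed auto
  finally show ?thesis by simp
qed

text \<open>Consecutive terms have quotient at most \<open>(n * a + 4 * k) / Suc k\<close>, which is
  at most 4.\<close>

lemma choose_sup_sol_le:
  fixes a :: real
  assumes n: "n \<ge> 1" and a: "0 < a" "n * a \<le> 4" and k: "1 \<le> k" "k \<le> n"
  shows "real (n choose k) * sup_sol n a k \<le> n * a * 4 ^ (k - 1)"
  using k
proof (induction k rule: dec_induct)
  case base
  thus ?case by (simp add: sup_sol_def lessThan_Suc One_nat_def)
next
  case (step k)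
  have "real (n choose Suc k) = (real n - k) * real (n choose k) / Suc k"
    using Suc_times_choose[of k n] by (simp add: field_simps)
  hence "real (n choose Suc k) * sup_sol n a (Suc k) = (real (n choose k) * sup_sol n a k) * ((real n - k) * (a + 4 * real k / n) / Suc k)"
    by (simp add: sup_sol_def)
  also have "\<dots> \<le> n * a * 4 ^ (k - 1) * 4"
  proof (rule mult_mono)
    have "(real n - k) * (a + 4 * real k / n) \<le> n * (a + 4 * real k / n)"
      using a by (intro mult_right_mono) auto
    also have "\<dots> = n * a + 4 * k" using n by (simp add: field_simps)
    also have "\<dots> \<le> 4 * Suc k" using a by simp
    finally have le: "(real n - k) * (a + 4 * real k / n) \<le> 4 * Suc k" .
    show "(real n - k) * (a + 4 * real k / n) / Suc k \<le> 4"
      by (rule mult_imp_div_pos_le) (use le in simp_all)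
    show "0 \<le> (real n - k) * (a + 4 * real k / n) / Suc k"
      using a step by (intro divide_nonneg_nonneg mult_nonneg_nonneg) auto
  qed (use step a in auto)
  also have "\<dots> = n * a * 4 ^ (Suc k - 1)" using step by (cases k) auto
  finally show ?case .
qed

text \<open>The squared norm after \<open>t\<close> steps is the pairing of \<open>G\<close> with
  its evolution for \<open>2 * t\<close> steps, hence \<open>solrate n (2 * t)\<close>. On level
  \<open>k\<close> the evolution yields at most \<open>n * a * 4 ^ (k - 1)\<close> and the initial
  size contributes \<open>(1 / 64) ^ k\<close>, so the levels sum geometrically and the result is of
  the size of level 1.\<close>

lemma low_level_contraction:
  assumes n: "n \<ge> 96" and m: "m \<le> n div 48"
    and G: "\<And>Y. Y \<in> Pow {1..n} \<Longrightarrow> card Y = 0 \<or> card Y > m \<Longrightarrow> G Y = 0"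
    and lev: "\<And>k. 1 \<le> k \<Longrightarrow> k \<le> m \<Longrightarrow> (\<Sum>Y\<in>level n k. (G Y)\<^sup>2) \<le> real (n choose k) * ((1 / 64) ^ k)\<^sup>2"
    and small: "n * solrate n (2 * t) \<le> 4"
  shows "(\<Sum>Y\<in>Pow {1..n}. ((avg n ^^ t) G Y)\<^sup>2) \<le>
    n * solrate n (2 * t) + 2 * real t * (1 / 6) ^ (n div 48 - 1) * (65 / 64) ^ n"
proof -
  define f where "f = (\<lambda>k. if 1 \<le> k \<and> k \<le> m then (1 / 64 :: real) ^ k else 0)"
  define a where "a = solrate n (2 * t)"
  have a: "a > 0" using solrate_step(1)[of n "2 * t"] n by (simp add: a_def)
  have n2: "n \<ge> 2" using n by simp
  have f0: "0 \<le> f k" for k by (simp add: f_def)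
  have Gf: "L2_set G (level n k) \<le> sqrt (n choose k) * f k" for k
  proof (cases "1 \<le> k \<and> k \<le> m")
    case True
    have "L2_set G (level n k) \<le> sqrt (real (n choose k) * ((1 / 64) ^ k)\<^sup>2)"
      unfolding L2_set_def using lev True by (intro real_sqrt_le_mono) auto
    thus ?thesis using True by (simp add: f_def real_sqrt_mult del: power_one_over)
  next
    case False
    have "G Y = 0" if "Y \<in> level n k" for Y using that False G[of Y] by (auto simp: level_def)
    thus ?thesis using f0[of k] by (simp add: L2_set_def)
  qed
  have fU: "f k \<le> sup_sol n (solrate n 0) (min k (n div 48))" for k
  proof (cases "1 \<le> k \<and> k \<le> m")
    case True
    have "f k = (\<Prod>i<k. 1 / 64)" using True by (simp add: f_def)
    also have "\<dots> \<le> (\<Prod>i<k. solrate n 0 + 4 * real i / n)"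
      by (intro prod_mono) (auto simp: solrate_def intro: add_increasing2)
    finally show ?thesis using True m by (simp add: sup_sol_def)
  next
    case False
    moreover have "0 < sup_sol n (solrate n 0) (min k (n div 48))"
      using n by (intro sup_sol_pos solrate_step(1)) simp
    ultimately show ?thesis by (simp only: f_def if_False less_imp_le)
  qed
  define e where "e = real (2 * t) * (1 / 6) ^ (n div 48 - 1)"
  have u: "(radial n ^^ (2 * t)) f k \<le> sup_sol n a k + e" if "k \<le> m" for k
  proof -
    have "(radial n ^^ (2 * t)) f k \<le> sup_sol n (solrate n (2 * t)) (min k (n div 48)) + real (2 * t) * (1 / 6) ^ (n div 48 - 1)"
    proof (rule radial_funpow_le[OF n refl])
      show "solrate n 0 \<le> 1 / 12" by (simp add: solrate_def)
    qed (use solrate_step[of n] n fU that m in auto)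
    thus ?thesis using that m by (simp add: a_def e_def)
  qed
  \<comment> \<open>Splitting into levels, including level 0, where \<open>G\<close>
    vanishes.\<close>
  have PU: "Pow {1..n} = (\<Union>k\<in>{..n}. level n k)"
  proof (rule set_eqI)
    fix Y
    show "Y \<in> Pow {1..n} \<longleftrightarrow> Y \<in> (\<Union>k\<in>{..n}. level n k)"
      using card_le_n[of Y n] unfolding level_def by blast
  qed
  have "(\<Sum>Y\<in>Pow {1..n}. ((avg n ^^ t) G Y)\<^sup>2) = (\<Sum>Y\<in>Pow {1..n}. G Y * (avg n ^^ (2 * t)) G Y)"
    using avg_funpow_selfadjoint[where n = n and t = t and F = G and G = "(avg n ^^ t) G"]
    by (simp add: power2_eq_square mult_2 funpow_add)
  also have "\<dots> = (\<Sum>Y\<in>(\<Union>k\<in>{..n}. level n k). G Y * (avg n ^^ (2 * t)) G Y)"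
    by (simp only: PU)
  also have "\<dots> =
    (\<Sum>k\<le>n. \<Sum>Y\<in>level n k. G Y * (avg n ^^ (2 * t)) G Y)"
    by (rule sum.UNION_disjoint) (auto simp: level_def)
  also have "\<dots> \<le> (\<Sum>k\<le>n. if 1 \<le> k \<and> k \<le> m then (n * a * 4 ^ (k - 1)) * (1 / 64) ^ k + e * (real (n choose k) * (1 / 64) ^ k) else 0)"
  proof (rule sum_mono)
    fix k assume k: "k \<in> {..n}"
    show "(\<Sum>Y\<in>level n k. G Y * (avg n ^^ (2 * t)) G Y) \<le> (if 1 \<le> k \<and> k \<le> m then (n * a * 4 ^ (k - 1)) * (1 / 64) ^ k + e * (real (n choose k) * (1 / 64) ^ k) else 0)"
    proof (cases "1 \<le> k \<and> k \<le> m")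
      case True
      have L: "0 \<le> (radial n ^^ (2 * t)) f k" "L2_set ((avg n ^^ (2 * t)) G) (level n k) \<le> sqrt (n choose k) * (radial n ^^ (2 * t)) f k"
        using L2_set_level_avg_funpow[OF n2 f0 Gf, of k "2 * t"] k by auto
      have "(\<Sum>Y\<in>level n k. G Y * (avg n ^^ (2 * t)) G Y) \<le> (\<Sum>Y\<in>level n k. \<bar>G Y\<bar> * \<bar>(avg n ^^ (2 * t)) G Y\<bar>)"
        by (intro sum_mono) (metis abs_ge_self abs_mult)
      also have "\<dots> \<le> L2_set G (level n k) * L2_set ((avg n ^^ (2 * t)) G) (level n k)"
        by (rule L2_set_mult_ineq)
      also have "\<dots> \<le> (sqrt (n choose k) * f k) * (sqrt (n choose k) * (radial n ^^ (2 * t)) f k)"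
        using Gf[of k] L f0[of k] by (intro mult_mono) auto
      also have "\<dots> = real (n choose k) * (radial n ^^ (2 * t)) f k * (1 / 64) ^ k"
        using True by (simp add: f_def del: power_one_over)
      also have "\<dots> \<le> real (n choose k) * (sup_sol n a k + e) * (1 / 64) ^ k"
        using u[of k] True by (intro mult_right_mono mult_left_mono) auto
      also have "\<dots> = real (n choose k) * sup_sol n a k * (1 / 64) ^ k + e * (real (n choose k) * (1 / 64) ^ k)"
        by (simp add: algebra_simps)
      also have "\<dots> \<le> (n * a * 4 ^ (k - 1)) * (1 / 64) ^ k + e * (real (n choose k) * (1 / 64) ^ k)"
        using True k n a small by (intro add_right_mono mult_right_mono choose_sup_sol_le) (auto simp: a_def)
      finally show ?thesis using True by simp
    next
      case False
      have "G Y = 0" if "Y \<in> level n k" for Y using that False G[of Y] by (auto simp: level_def)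
      thus ?thesis by (subst if_not_P[OF False]) simp
    qed
  qed
  also have "\<dots> \<le> (\<Sum>k\<le>n. n * a / 4 * (1 / 16) ^ k + e * (real (n choose k) * (1 / 64) ^ k))"
  proof (rule sum_mono)
    fix k
    have pos: "0 \<le> n * a / 4 * (1 / 16) ^ k + e * (real (n choose k) * (1 / 64) ^ k)"
      using a by (intro add_nonneg_nonneg mult_nonneg_nonneg) (auto simp: e_def)
    show "(if 1 \<le> k \<and> k \<le> m then (n * a * 4 ^ (k - 1)) * (1 / 64) ^ k + e * (real (n choose k) * (1 / 64) ^ k) else 0)
      \<le> n * a / 4 * (1 / 16) ^ k + e * (real (n choose k) * (1 / 64) ^ k)"
    proof (cases "1 \<le> k \<and> k \<le> m")
      case True
      then obtain j where j: "k = Suc j" by (cases k) auto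
      have "(4::real) ^ j * (1 / 64) ^ j = (1 / 16) ^ j" unfolding power_mult_distrib[symmetric] by simp
      hence "(4::real) ^ (k - 1) * (1 / 64) ^ k = 1 / 4 * (1 / 16) ^ k"
        by (simp add: j del: power_one_over)
      hence "n * a * (4 ^ (k - 1) * (1 / 64) ^ k) = n * a * (1 / 4 * (1 / 16) ^ k)" by (rule arg_cong)
      hence E: "(n * a * 4 ^ (k - 1)) * (1 / 64) ^ k = n * a / 4 * (1 / 16) ^ k"
        by (simp only: mult.assoc) simp
      show ?thesis unfolding if_P[OF True] E by (rule order_refl)
    next
      case False
      thus ?thesis using pos by (simp only: if_False)
    qed
  qed
  also have "\<dots> = n * a / 4 * (\<Sum>k\<le>n. (1 / 16) ^ k) + e * (\<Sum>k\<le>n. real (n choose k) * (1 / 64) ^ k)"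
    by (simp only: sum.distrib sum_distrib_left)
  also have "(\<Sum>k\<le>n. real (n choose k) * (1 / 64) ^ k) = (65 / 64) ^ n"
    using binomial_ring[of "1 / 64 :: real" 1 n] by simp
  also have "n * a / 4 * (\<Sum>k\<le>n. (1 / 16) ^ k) + e * (65 / 64) ^ n \<le> n * a / 4 * 4 + e * (65 / 64) ^ n"
  proof (intro add_right_mono mult_left_mono)
    have "(1 - q) / (1 - 1 / 16) \<le> 4" if "0 \<le> q" for q :: real using that by simp
    from this[of "(1 / 16) ^ Suc n"] show "(\<Sum>k\<le>n. (1 / 16 :: real) ^ k) \<le> 4"
      unfolding sum_gp0 by (simp del: power_Suc)
  qed (use a in simp)
  finally show ?thesis using a by (simp add: a_def e_def mult_ac)
qed

section \<open>Upper bound\<close>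

text \<open>Any minorant \<open>q\<close> of the law at time \<open>s\<close> may replace it at the
  price of the missing mass. The distance of its evolution from a multiple of the uniform density is
  estimated by Cauchy-Schwarz and Parseval.\<close>

lemma tv_le_fourier:
  assumes n: "n \<ge> 2" and q: "dens n B q" and X: "X \<in> Pow {1..n} - {{}}" and A: "A \<subseteq> Pow {1..n} - {{}}"
    and le: "\<And>S. S \<in> Pow {1..n} - {{}} \<Longrightarrow> q S \<le> (avg n ^^ s) (indicator {X}) S"
  shows "real (card A) / (2 ^ n - 1) - (avg n ^^ (s + t)) (indicator A) X \<le>
    1 / 2 ^ n + (1 - (\<Sum>S\<in>Pow {1..n}. q S)) + sqrt (\<Sum>Y\<in>Pow {1..n} - {{}}. ((avg n ^^ t) (fourier n q) Y)\<^sup>2)"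
proof -
  define P where "P = Pow {1..n}"
  have fP: "finite P" by (simp add: P_def)
  have AP: "A \<subseteq> P" using A by (auto simp: P_def)
  define qt where "qt = (avg n ^^ t) q"
  define \<mu> where "\<mu> = (\<Sum>S\<in>P. q S)"
  have \<mu>: "\<mu> \<le> 1" using q by (simp add: dens_def \<mu>_def P_def)
  have \<mu>t: "(\<Sum>S\<in>P. qt S) = \<mu>" using n by (simp add: qt_def \<mu>_def P_def sum_avg_funpow)
  have "(avg n ^^ (s + t)) (indicator A) X = (\<Sum>S\<in>P. indicator {X} S * (avg n ^^ (s + t)) (indicator A) S)"
    using X fP by (simp add: indicator_def if_distrib[of "\<lambda>x. x * _"] P_def cong: if_cong)
  also have "\<dots> = (\<Sum>S\<in>P. (avg n ^^ (s + t)) (indicator {X}) S * indicator A S)"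
    unfolding P_def by (rule avg_funpow_selfadjoint)
  also have "\<dots> = (\<Sum>S\<in>P. if S \<in> A then (avg n ^^ (s + t)) (indicator {X}) S else 0)"
    by (intro sum.cong) (auto simp: indicator_def)
  also have "\<dots> = (\<Sum>S\<in>A. (avg n ^^ (s + t)) (indicator {X}) S)"
    using AP fP by (simp add: sum.If_cases Int_absorb1)
  also have "\<dots> \<ge> (\<Sum>S\<in>A. qt S)"
  proof (rule sum_mono)
    fix S assume "S \<in> A"
    hence S: "S \<in> Pow {1..n} - {{}}" using A by auto
    have "(avg n ^^ t) q S \<le> (avg n ^^ t) ((avg n ^^ s) (indicator {X})) S"
      by (rule avg_funpow_mono[OF le S])
    also have "\<dots> = (avg n ^^ (s + t)) (indicator {X}) S" by (subst add.commute) (simp add: funpow_add)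
    finally show "qt S \<le> (avg n ^^ (s + t)) (indicator {X}) S" by (simp add: qt_def)
  qed
  finally have 1: "(\<Sum>S\<in>A. qt S) \<le> (avg n ^^ (s + t)) (indicator A) X" .
  have cA: "real (card A) \<le> 2 ^ n - 1"
    using card_mono[OF _ A] card_Pow_nonempty[of n] by simp
  have pow: "(2::real) ^ n \<ge> 2 ^ 2" using n by (intro power_increasing) auto
  \<comment> \<open>Passage from the uniform distribution on nonempty sets to the one on all
    sets.\<close>
  have 2: "real (card A) / (2 ^ n - 1) \<le> real (card A) / 2 ^ n + 1 / 2 ^ n"
  proof -
    have "real (card A) / (2 ^ n - 1) - real (card A) / 2 ^ n = real (card A) / (2 ^ n - 1) * (1 / 2 ^ n)"
      using pow by (simp add: divide_simps) (simp add: algebra_simps)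
    also have "\<dots> \<le> 1 * (1 / 2 ^ n)" using cA pow by (intro mult_right_mono) (auto simp: pos_divide_le_eq)
    finally show ?thesis by simp
  qed
  \<comment> \<open>Subtracting the constant density of mass \<open>\<mu>\<close> removes exactly
    the coefficient at the empty set.\<close>
  define d where "d = (\<lambda>S. qt S - \<mu> / 2 ^ n)"
  have "real (card A) / 2 ^ n - (\<Sum>S\<in>A. qt S) = (1 - \<mu>) * (real (card A) / 2 ^ n) - (\<Sum>S\<in>A. d S)"
    by (simp add: d_def sum_subtractf diff_divide_distrib algebra_simps)
  also have "(1 - \<mu>) * (real (card A) / 2 ^ n) \<le> (1 - \<mu>) * 1"
  proof (rule mult_left_mono)
    show "real (card A) / 2 ^ n \<le> 1" by (rule mult_imp_div_pos_le, simp) (use cA in linarith)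
  qed (use \<mu> in simp)
  also have "- (\<Sum>S\<in>A. d S) \<le> (\<Sum>S\<in>P. \<bar>d S\<bar>)"
  proof -
    have "- (\<Sum>S\<in>A. d S) \<le> \<bar>\<Sum>S\<in>A. d S\<bar>" by simp
    also have "\<dots> \<le> (\<Sum>S\<in>A. \<bar>d S\<bar>)" by (rule sum_abs)
    also have "\<dots> \<le> (\<Sum>S\<in>P. \<bar>d S\<bar>)" using AP fP by (intro sum_mono2) auto
    finally show ?thesis .
  qed
  hence "(1 - \<mu>) * 1 - (\<Sum>S\<in>A. d S) \<le> (1 - \<mu>) + (\<Sum>S\<in>P. \<bar>d S\<bar>)" by simp
  finally have 3: "real (card A) / 2 ^ n - (\<Sum>S\<in>A. qt S) \<le> (1 - \<mu>) + (\<Sum>S\<in>P. \<bar>d S\<bar>)" by simp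
  have "(\<Sum>S\<in>P. \<bar>d S\<bar>) \<le> sqrt (\<Sum>Y\<in>P - {{}}. ((avg n ^^ t) (fourier n q) Y)\<^sup>2)"
  proof (rule real_le_rsqrt)
    have "(\<Sum>S\<in>P. 1 * \<bar>d S\<bar>)\<^sup>2 \<le> (\<Sum>S\<in>P. 1\<^sup>2) * (\<Sum>S\<in>P. \<bar>d S\<bar>\<^sup>2)"
      by (rule Cauchy_Schwarz_ineq_sum)
    also have "\<dots> = (\<Sum>Y\<in>P. (fourier n d Y)\<^sup>2)" by (simp add: P_def card_Pow parseval)
    also have "\<dots> = (\<Sum>Y\<in>P - {{}}. ((avg n ^^ t) (fourier n q) Y)\<^sup>2)"
    proof -
      have fd: "fourier n d Y = fourier n qt Y - (if Y = {} then \<mu> else 0)" if Y: "Y \<in> P" for Y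
      proof -
        have "(\<Sum>S\<in>P. chi Y S) = (\<Sum>S\<in>P. chi S Y)"
          using Y by (intro sum.cong refl chi_sym) (auto simp: P_def finite_subset)
        also have "\<dots> = (if Y = {} then 2 ^ n else 0)"
          unfolding P_def using Y by (subst sum_chi) (auto simp: P_def Int_absorb2)
        finally have "(\<Sum>S\<in>P. chi Y S) = (if Y = {} then 2 ^ n else 0)" .
        moreover have "fourier n d Y = fourier n qt Y - \<mu> / 2 ^ n * (\<Sum>S\<in>P. chi Y S)"
          by (simp add: fourier_def d_def P_def left_diff_distrib sum_subtractf sum_distrib_left)
        ultimately show ?thesis by simp
      qed
      have "fourier n qt {} = \<mu>" using \<mu>t by (simp add: fourier_def P_def)
      hence "fourier n d {} = 0" using fd[of "{}"] by (simp add: P_def)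
      hence "(\<Sum>Y\<in>P. (fourier n d Y)\<^sup>2) = (\<Sum>Y\<in>P - {{}}. (fourier n d Y)\<^sup>2)"
        using fP by (subst sum.remove[of P "{}"]) (auto simp: P_def)
      also have "\<dots> = (\<Sum>Y\<in>P - {{}}. ((avg n ^^ t) (fourier n q) Y)\<^sup>2)"
      proof (intro sum.cong refl)
        fix Y assume Y: "Y \<in> P - {{}}"
        hence "fourier n d Y = (avg n ^^ t) (fourier n q) Y"
          using fd[of Y] fourier_avg_funpow[of Y n t q] by (simp add: P_def qt_def)
        thus "(fourier n d Y)\<^sup>2 = ((avg n ^^ t) (fourier n q) Y)\<^sup>2" by simp
      qed
      finally show ?thesis .
    qed
    finally show "(\<Sum>S\<in>P. \<bar>d S\<bar>)\<^sup>2 \<le> (\<Sum>Y\<in>P - {{}}. ((avg n ^^ t) (fourier n q) Y)\<^sup>2)" by simp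
  qed
  thus ?thesis using 1 2 3 by (simp add: \<mu>_def P_def)
qed

lemma nat_div_bounds:
  fixes n d :: nat
  assumes "d > 0"
  shows "real (n div d) \<le> real n / real d" "real n / real d - 1 \<le> real (n div d)"
proof -
  have "n mod d < d" using assms by simp
  moreover have "real n = real d * real (n div d) + real (n mod d)"
    by (simp only: of_nat_mult[symmetric] of_nat_add[symmetric] mult_div_mod_eq)
  ultimately show "real (n div d) \<le> real n / real d" "real n / real d - 1 \<le> real (n div d)"
    using assms by (auto simp: field_simps)
qed

text \<open>
  The constants are chosen from the largest to the smallest exponential rate: levels up to
  \<open>n / 2 ^ 40\<close> count as low, the density of the burnt-in law is at most \<open>exp (n / 2 ^ 44) / 2 ^ n\<close>,
  and \<open>balance_tol\<close> is the imbalance for which this density bound holds.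
\<close>

definition density_bound :: "nat \<Rightarrow> real" where
  "density_bound n = exp (real n / 2 ^ 44)"

definition balance_tol :: real where
  "balance_tol = 1 / 2 ^ 53"

text \<open>The bound of \<open>hweight_funpow_le\<close> after \<open>n\<close> steps with
  \<open>m = n div 2 ^ 40\<close> and \<open>k0 = m div 2\<close>. The constants 1/4 and 2/3 in the
  exponents come from the integer divisions.\<close>

definition high_bound :: "nat \<Rightarrow> real" where
  "high_bound n = n * density_bound n * (exp (1 / 4 - real n / 2 ^ 42) + exp (2 / 3 - real n / (3 * 2 ^ 40))) + 5 * n * exp (- real n / 128)"

text \<open>Polynomial and constant factors are absorbed by slightly larger exponential
  rates.\<close>

definition large :: "nat \<Rightarrow> bool" where
  "large n \<longleftrightarrow> real n \<ge> 2 ^ 42 \<and> (real n + 1)\<^sup>2 * exp (real n / 2 ^ 45) \<le> density_bound n \<and>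
     4 * density_bound n \<le> exp (real n / 2 ^ 33) \<and>
     (density_bound n + exp (real n / 512))\<^sup>2 \<le> exp (real n / 128)"

lemma eventually_large: "eventually large at_top"
proof -
  have "eventually (\<lambda>n. real n \<ge> 2 ^ 42) at_top" by real_asymp
  moreover have "eventually (\<lambda>n. (real n + 1)\<^sup>2 * exp (real n / 2 ^ 45) \<le> density_bound n) at_top"
    unfolding density_bound_def by real_asymp
  moreover have "eventually (\<lambda>n. 4 * density_bound n \<le> exp (real n / 2 ^ 33)) at_top"
    unfolding density_bound_def by real_asymp
  moreover have "eventually (\<lambda>n. (density_bound n + exp (real n / 512))\<^sup>2 \<le> exp (real n / 128)) at_top"
    unfolding density_bound_def by real_asymp
  ultimately show ?thesis unfolding large_def by eventually_elim auto
qed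

section \<open>Numerical bounds for the low and the high levels\<close>

lemma low_level_bound:
  assumes L: "large n" and q: "dens n (density_bound n) q" and k: "1 \<le> k" "k \<le> n div 2 ^ 40"
  shows "(\<Sum>Y\<in>level n k. (fourier n q Y)\<^sup>2) \<le> real (n choose k) * ((1 / 64) ^ k)\<^sup>2"
proof -
  have k': "real k \<le> 1 / 2 ^ 40 * n"
    using of_nat_mono[OF k(2), where 'a = real] nat_div_bounds(1)[of "2 ^ 40" n] by simp
  \<comment> \<open>Here \<open>d = 1 / 2 ^ 13\<close> is half the target rate
    \<open>1 / 2 ^ 12\<close> per level, and \<open>g = 1 / 2 ^ 15\<close> makes
    \<open>g * d\<close> a quarter of \<open>d\<^sup>2\<close>.\<close>
  have "(\<Sum>Y\<in>level n k. (fourier n q Y)\<^sup>2) \<le>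
    real (n choose k) * ((1 / 2 ^ 13) ^ k + 2 * density_bound n * exp (- (1 / 2 ^ 15)\<^sup>2 * n / 4))"
    by (rule dens_level_le[OF q _ _ _ _ _ k']) (simp_all add: power2_eq_square)
  also have "\<dots> \<le> real (n choose k) * ((1 / 64) ^ k)\<^sup>2"
  proof (rule mult_left_mono)
    define p :: real where "p = (1 / 2 ^ 12) ^ k"
    have p: "((1 / 64) ^ k)\<^sup>2 = p" unfolding p_def power_mult[symmetric]
      by (subst mult.commute, subst power_mult) (simp add: power2_eq_square)
    have "(1 / 2 ^ 13 :: real) ^ k = p * (1 / 2) ^ k" unfolding p_def power_mult_distrib[symmetric] by simp
    also have "\<dots> \<le> p * (1 / 2) ^ 1" unfolding p_def using k by (intro mult_left_mono power_decreasing) auto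
    finally have 1: "(1 / 2 ^ 13 :: real) ^ k \<le> p / 2" by simp
    \<comment> \<open>As \<open>k\<close> is at most \<open>n / 2 ^ 40\<close>, the target
      \<open>p\<close> is at least exp (- 12 n / 2 ^ 40), so the additive Chernoff error fits below
      it.\<close>
    have "exp (- real k * 12) \<le> p"
    proof -
      have "exp (- 12 :: real) \<le> 1 / 2 ^ 12"
      proof -
        have "(2::real) ^ 12 \<le> exp 1 ^ 12" using exp_ge_add_one_self[of 1] by (intro power_mono) auto
        also have "\<dots> = exp 12" by (simp add: exp_of_nat_mult[symmetric])
        finally show ?thesis by (simp add: exp_minus field_simps)
      qed
      hence "exp (- 12 :: real) ^ k \<le> p" unfolding p_def by (intro power_mono) auto
      thus ?thesis by (simp add: exp_of_nat_mult[symmetric])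
    qed
    moreover have "exp (- (12 * (1 / 2 ^ 40 * real n))) \<le> exp (- real k * 12)" using k' by simp
    ultimately have 2: "exp (- (12 * (1 / 2 ^ 40 * real n))) \<le> p" by linarith
    have "4 * density_bound n * exp (- (1 / 2 ^ 15)\<^sup>2 * n / 4) \<le> exp (real n / 2 ^ 33) * exp (- (1 / 2 ^ 15)\<^sup>2 * n / 4)"
      using L by (intro mult_right_mono) (auto simp: large_def)
    also have "\<dots> = exp (- (real n / 2 ^ 33))" by (simp add: exp_add[symmetric] power2_eq_square)
    also have "\<dots> \<le> exp (- (12 * (1 / 2 ^ 40 * real n)))" by simp
    also note 2
    finally have "2 * density_bound n * exp (- (1 / 2 ^ 15)\<^sup>2 * n / 4) \<le> p / 2" by simp
    thus "(1 / 2 ^ 13) ^ k + 2 * density_bound n * exp (- (1 / 2 ^ 15)\<^sup>2 * n / 4) \<le> ((1 / 64) ^ k)\<^sup>2"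
      using 1 unfolding p by linarith
  qed simp
  finally show ?thesis .
qed

text \<open>The levels between \<open>k0\<close> and \<open>m\<close> act as a buffer: both the
  halving per level across it and the decay at rate about \<open>k0 / n\<close> over
  \<open>n\<close> steps beat the density bound exp (n / 2 ^ 44).\<close>

lemma high_level_bound:
  assumes L: "large n" and q: "dens n (density_bound n) q"
  shows "weight n (n div 2 ^ 40) (fourier n ((avg n ^^ n) q)) \<le> high_bound n"
proof -
  define m where "m = n div 2 ^ 40"
  define k0 where "k0 = m div 2"
  have n: "real n \<ge> 2 ^ 42" using L by (simp add: large_def)
  have n100: "n \<ge> 100" using n by simp
  have m1: "real m \<le> real n / 2 ^ 40" "real n / 2 ^ 40 - 1 \<le> real m"
    unfolding m_def using nat_div_bounds[of "2 ^ 40" n] by simp_all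
  have k0': "real m / 2 - 1 / 2 \<le> real k0" "real k0 \<le> real m / 2"
    unfolding k0_def by linarith+
  have k0: "1 \<le> k0" "k0 \<le> m" "m \<le> n"
  proof -
    have "real n / 2 ^ 40 \<ge> 4" using n by simp
    hence "real k0 \<ge> 1" using m1 k0' by linarith
    thus "1 \<le> k0" by simp
  qed (simp_all add: k0_def m_def)
  define M where "M = density_bound n + real (card {Y \<in> Pow {1..n}. card Y < m})"
  have "hweight n m (fourier n ((avg n ^^ n) q)) \<le>
    n * density_bound n * ((1 / 2) ^ (m - k0) + (1 - 2 / 3 * (real k0 / n)) ^ n) + 5 * M\<^sup>2 * exp (- real n / 64) * n"
    unfolding M_def by (rule hweight_funpow_le[OF q n100 k0(1,2) order_refl k0(3)])
  also have "\<dots> \<le> n * density_bound n * (exp (1 / 4 - real n / 2 ^ 42) + exp (2 / 3 - real n / (3 * 2 ^ 40))) + 5 * exp (real n / 128) * exp (- real n / 64) * n"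
  proof (intro add_mono mult_left_mono mult_right_mono)
    have "(1 / 2 :: real) ^ (m - k0) \<le> exp (- 1 / 2) ^ (m - k0)"
      using exp_ge_add_one_self[of "- 1 / 2 :: real"] by (intro power_mono) auto
    also have "\<dots> = exp (- real (m - k0) / 2)" by (simp add: exp_of_nat_mult[symmetric])
    also have "\<dots> \<le> exp (1 / 4 - real n / 2 ^ 42)"
    proof -
      have "real (m - k0) \<ge> real m / 2" using k0' k0 by (simp add: of_nat_diff)
      hence "- real (m - k0) / 2 \<le> - (real n / 2 ^ 40 - 1) / 4" using m1 by simp
      also have "\<dots> = 1 / 4 - real n / 2 ^ 42" by simp
      finally show ?thesis by simp
    qed
    finally show "(1 / 2) ^ (m - k0) \<le> exp (1 / 4 - real n / 2 ^ 42)" .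
    have "0 \<le> 1 - 2 / 3 * (real k0 / n)" using k0 n100 by (simp add: divide_simps)
    hence "(1 - 2 / 3 * (real k0 / n)) ^ n \<le> exp (- 2 / 3 * (real k0 / n)) ^ n"
      using exp_ge_add_one_self[of "- 2 / 3 * (real k0 / n)"] by (intro power_mono) auto
    also have "\<dots> = exp (- 2 / 3 * real k0)" using n100 by (simp add: exp_of_nat_mult[symmetric])
    also have "\<dots> \<le> exp (2 / 3 - real n / (3 * 2 ^ 40))"
    proof -
      have "(real n / 2 ^ 40 - 1) / 2 \<le> real m / 2" using m1 by (intro divide_right_mono) auto
      hence "real k0 \<ge> (real n / 2 ^ 40 - 1) / 2 - 1 / 2" using k0' by linarith
      hence "- 2 / 3 * real k0 \<le> - 2 / 3 * ((real n / 2 ^ 40 - 1) / 2 - 1 / 2)"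
        by (rule mult_left_mono_neg) simp
      also have "\<dots> = 2 / 3 - real n / (3 * 2 ^ 40)" by (simp add: field_simps)
      finally show ?thesis by simp
    qed
    finally show "(1 - 2 / 3 * (real k0 / n)) ^ n \<le> exp (2 / 3 - real n / (3 * 2 ^ 40))" .
    \<comment> \<open>Tilting by 1/1024 shows that there are at most exp (n / 512) such
      sets.\<close>
    have "real (card {Y \<in> Pow {1..n}. card Y < m}) \<le> real (card {Y \<in> Pow {1..n}. card Y \<le> m})"
      by (intro of_nat_mono card_mono) auto
    also have "\<dots> \<le> (1 + 1 / 1024) ^ card {1..n} / (1 / 1024) ^ m"
      by (intro card_small_subsets) auto
    also have "\<dots> = (1 + 1 / 1024) ^ n * 1024 ^ m" by (simp add: power_divide)
    also have "\<dots> \<le> exp (1 / 1024) ^ n * exp 10 ^ m"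
    proof (intro mult_mono power_mono)
      have "(1024::real) = 2 ^ 10" by simp
      also have "\<dots> \<le> exp 1 ^ 10" using exp_ge_add_one_self[of 1] by (intro power_mono) auto
      also have "\<dots> = exp 10" by (simp add: exp_of_nat_mult[symmetric])
      finally show "(1024::real) \<le> exp 10" .
    qed (use exp_ge_add_one_self[of "1 / 1024"] in auto)
    also have "\<dots> = exp (real n / 1024 + 10 * real m)" by (simp add: exp_of_nat_mult[symmetric] exp_add mult.commute)
    also have "\<dots> \<le> exp (real n / 512)" using m1 n by simp
    finally have "M \<le> density_bound n + exp (real n / 512)" by (simp add: M_def)
    hence "M\<^sup>2 \<le> (density_bound n + exp (real n / 512))\<^sup>2"
      by (intro power_mono) (auto simp: M_def density_bound_def intro: add_nonneg_nonneg)
    thus "M\<^sup>2 \<le> exp (real n / 128)" using L by (simp add: large_def)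
  qed (auto simp: density_bound_def)
  also have "5 * exp (real n / 128) * exp (- real n / 64) * n = 5 * n * exp (- real n / 128)"
    by (simp add: exp_add[symmetric])
  finally have "hweight n m (fourier n ((avg n ^^ n) q)) \<le> high_bound n" by (simp add: high_bound_def)
  moreover have "weight n m g \<le> hweight n m g" for g
    unfolding weight_def hweight_def
  proof (rule sum_mono)
    fix Y assume Y: "Y \<in> above n m"
    have "1 \<le> real n / real (card Y)" using Y card_le_n[of Y n] by (auto simp: above_def le_divide_eq)
    hence "1 * (g Y)\<^sup>2 \<le> real n / real (card Y) * (g Y)\<^sup>2" by (rule mult_right_mono) simp
    thus "(g Y)\<^sup>2 \<le> real n / real (card Y) * (g Y)\<^sup>2" by simp
  qed
  ultimately show ?thesis unfolding m_def by (rule order_trans[rotated])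
qed

text \<open>The coefficients are split after the first \<open>n\<close> steps. By linearity the two
  parts evolve separately, so the high part, wherever it flows, needs only the L2 contraction, and
  the low part starts with no high levels.\<close>

lemma fourier_mass_bound:
  assumes L: "large n" and q: "dens n (density_bound n) q" and small: "n * solrate n (2 * t) \<le> 4"
  shows "(\<Sum>Y\<in>Pow {1..n} - {{}}. ((avg n ^^ (t + n)) (fourier n q) Y)\<^sup>2) \<le>
    2 * (n * solrate n (2 * t) + 2 * real t * (1 / 6) ^ (n div 48 - 1) * (65 / 64) ^ n) + 2 * high_bound n"
proof -
  define m where "m = n div 2 ^ 40"
  define P where "P = Pow {1..n}"
  have n: "real n \<ge> 2 ^ 42" using L by (simp add: large_def)
  have n96: "n \<ge> 96" "n \<ge> 2" using n by simp_all
  define q' where "q' = (avg n ^^ n) q"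
  have q': "dens n (density_bound n) q'" unfolding q'_def by (rule dens_avg_funpow[OF q n96(2)])
  define g where "g = fourier n q'"
  define lo hi where "lo = (\<lambda>Y. if 1 \<le> card Y \<and> card Y \<le> m then g Y else 0)"
    and "hi = (\<lambda>Y. if m < card Y then g Y else 0)"
  have eq: "(avg n ^^ (t + n)) (fourier n q) Y = (avg n ^^ t) lo Y + (avg n ^^ t) hi Y" if Y: "Y \<in> P - {{}}" for Y
  proof -
    have gq: "(avg n ^^ n) (fourier n q) Z = g Z" if "Z \<in> Pow {1..n}" for Z
      unfolding g_def q'_def by (rule fourier_avg_funpow[OF that, symmetric])
    have gs: "(avg n ^^ n) (fourier n q) Z = lo Z + hi Z" if "Z \<in> Pow {1..n} - {{}}" for Z
      using gq[of Z] card_nonempty[OF that] that by (auto simp: lo_def hi_def)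
    have "(avg n ^^ t) ((avg n ^^ n) (fourier n q)) Y = (avg n ^^ t) (\<lambda>Z. lo Z + hi Z) Y"
      using Y gs unfolding P_def by (intro antisym avg_funpow_mono) auto
    thus ?thesis by (simp add: funpow_add avg_funpow_add)
  qed
  have "(\<Sum>Y\<in>P - {{}}. ((avg n ^^ (t + n)) (fourier n q) Y)\<^sup>2) = (\<Sum>Y\<in>P - {{}}. ((avg n ^^ t) lo Y + (avg n ^^ t) hi Y)\<^sup>2)"
    by (intro sum.cong refl) (simp only: eq)
  also have "\<dots> \<le> (\<Sum>Y\<in>P - {{}}. 2 * ((avg n ^^ t) lo Y)\<^sup>2 + 2 * ((avg n ^^ t) hi Y)\<^sup>2)"
  proof (rule sum_mono)
    fix Y
    show "((avg n ^^ t) lo Y + (avg n ^^ t) hi Y)\<^sup>2 \<le> 2 * ((avg n ^^ t) lo Y)\<^sup>2 + 2 * ((avg n ^^ t) hi Y)\<^sup>2"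
      using zero_le_power2[of "(avg n ^^ t) lo Y - (avg n ^^ t) hi Y"] by (simp add: power2_eq_square algebra_simps)
  qed
  also have "\<dots> \<le> (\<Sum>Y\<in>P. 2 * ((avg n ^^ t) lo Y)\<^sup>2 + 2 * ((avg n ^^ t) hi Y)\<^sup>2)"
    by (intro sum_mono2) (auto simp: P_def)
  also have "\<dots> = 2 * (\<Sum>Y\<in>P. ((avg n ^^ t) lo Y)\<^sup>2) + 2 * (\<Sum>Y\<in>P. ((avg n ^^ t) hi Y)\<^sup>2)"
    by (simp only: sum.distrib sum_distrib_left)
  also have "\<dots> \<le> 2 * (n * solrate n (2 * t) + 2 * real t * (1 / 6) ^ (n div 48 - 1) * (65 / 64) ^ n) + 2 * high_bound n"
  proof (intro add_mono mult_left_mono)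
    have "m \<le> n div 48" unfolding m_def by (rule div_le_mono2) auto
    moreover have "(\<Sum>Y\<in>level n k. (lo Y)\<^sup>2) \<le> real (n choose k) * ((1 / 64) ^ k)\<^sup>2" if "1 \<le> k" "k \<le> m" for k
    proof -
      have "(\<Sum>Y\<in>level n k. (lo Y)\<^sup>2) = (\<Sum>Y\<in>level n k. (g Y)\<^sup>2)"
        using that by (intro sum.cong) (auto simp: lo_def level_def)
      thus ?thesis unfolding g_def using low_level_bound[OF L q'] that by (simp add: m_def)
    qed
    moreover have "lo Y = 0" if "card Y = 0 \<or> card Y > m" for Y using that by (auto simp: lo_def)
    ultimately show "(\<Sum>Y\<in>P. ((avg n ^^ t) lo Y)\<^sup>2) \<le> n * solrate n (2 * t) + 2 * real t * (1 / 6) ^ (n div 48 - 1) * (65 / 64) ^ n"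
      unfolding P_def using n96 small by (intro low_level_contraction[where m = m]) auto
    have "(\<Sum>Y\<in>P. ((avg n ^^ t) hi Y)\<^sup>2) \<le> (\<Sum>Y\<in>P. (hi Y)\<^sup>2)"
      unfolding P_def by (rule avg_funpow_l2_contraction[OF n96(2)])
    also have "\<dots> = (\<Sum>Y\<in>P. if m < card Y then (g Y)\<^sup>2 else 0)"
      by (intro sum.cong) (auto simp: hi_def)
    also have "\<dots> = weight n m g" by (simp add: weight_def above_def P_def sum.If_cases Int_def)
    also have "\<dots> \<le> high_bound n" unfolding g_def q'_def m_def by (rule high_level_bound[OF L q])
    finally show "(\<Sum>Y\<in>P. ((avg n ^^ t) hi Y)\<^sup>2) \<le> high_bound n" .
  qed auto
  finally show ?thesis by (simp add: P_def)
qed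

lemma balanced_density_le:
  assumes L: "large n" and X: "X \<in> Pow {1..n} - {{}}" and S: "S \<in> Pow {1..n} - {{}}"
    and g: "\<bar>part_bias X S\<bar> \<le> balance_tol * n" "\<bar>part_bias ({1..n} - X) S\<bar> \<le> balance_tol * n"
  shows "(avg n ^^ t) (indicator {X}) S \<le> density_bound n / 2 ^ n"
proof -
  have n: "n \<ge> 2" using L by (simp add: large_def)
  \<comment> \<open>With this tilt, \<open>exp (x * n)\<close> and
    \<open>(1 / x) powr (balance_tol * n)\<close> are both at most exp (n / 2 ^ 47), the second one
    because 47 is less than 64.\<close>
  define x :: real where "x = 1 / 2 ^ 47"
  have "(avg n ^^ t) (indicator {X}) S \<le> ((real n + 1) * (exp (x * n) * (1 / x) powr (balance_tol * n)))\<^sup>2 / 2 ^ n"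
    by (rule transition_le_balanced[OF X n S _ _ g]) (simp_all add: x_def)
  also have "\<dots> \<le> density_bound n / 2 ^ n"
  proof (rule divide_right_mono)
    have "1 / x = 2 ^ 47" by (simp add: x_def)
    hence "ln (1 / x) = 47 * ln 2" by (simp only: ln_realpow of_nat_numeral)
    also have "\<dots> \<le> 47" using ln_2_less_1 by simp
    finally have lnx: "ln (1 / x) \<le> 47" .
    have "(1 / x) powr (balance_tol * n) = exp (balance_tol * n * ln (1 / x))" by (simp add: powr_def x_def)
    also have "\<dots> \<le> exp (balance_tol * n * 47)" using lnx by (simp add: balance_tol_def mult_left_mono)
    also have "\<dots> \<le> exp (real n / 2 ^ 47)" by (simp add: balance_tol_def)
    finally have "exp (x * n) * (1 / x) powr (balance_tol * n) \<le> exp (real n / 2 ^ 47) * exp (real n / 2 ^ 47)"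
      by (intro mult_mono) (auto simp: x_def)
    also have "\<dots> = exp (real n / 2 ^ 46)" by (simp add: exp_add[symmetric])
    finally have "((real n + 1) * (exp (x * n) * (1 / x) powr (balance_tol * n)))\<^sup>2 \<le> ((real n + 1) * exp (real n / 2 ^ 46))\<^sup>2"
      by (intro power_mono mult_left_mono) auto
    also have "\<dots> = (real n + 1)\<^sup>2 * exp (real n / 2 ^ 45)"
      by (simp add: power_mult_distrib exp_double[symmetric])
    also have "\<dots> \<le> density_bound n" using L by (simp add: large_def)
    finally show "((real n + 1) * (exp (x * n) * (1 / x) powr (balance_tol * n)))\<^sup>2 \<le> density_bound n" .
  qed simp
  finally show ?thesis .
qed

text \<open>The \<open>s\<close> steps make the weight linear, \<open>s'\<close> steps balance the
  set, \<open>n\<close> steps remove the high levels and \<open>t\<close> steps contract the low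
  ones. The minorant \<open>q\<close> is the law at time \<open>s + s'\<close> restricted to sets
  balanced on \<open>X\<close> and on its complement; the two exceptional events account for the
  factor 2.\<close>

lemma worst_dist_upper:
  assumes L: "large n" and e: "0 < e" "e \<le> 1 / 4" and s: "real n * ln n \<le> real s"
    and small: "n * solrate n (2 * t) \<le> 4"
  shows "worst_dist n ((s + s') + (t + n)) \<le> 1 / 2 ^ n +
    2 * ((exp (- 4 * e * s' / n) + 4 / (e * n) + 14 * sqrt e) / balance_tol\<^sup>2) +
    sqrt (2 * (n * solrate n (2 * t) + 2 * real t * (1 / 6) ^ (n div 48 - 1) * (65 / 64) ^ n) + 2 * high_bound n)"
proof (rule worst_dist_le)
  show n: "n \<ge> 2" using L by (simp add: large_def)
  fix X A assume X: "X \<in> Pow {1..n} - {{}}" and A: "A \<subseteq> Pow {1..n} - {{}}"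
  define P where "P = Pow {1..n}"
  define p where "p = (avg n ^^ (s + s')) (indicator {X})"
  define W1 W2 where "W1 = {S. \<bar>part_bias X S\<bar> > balance_tol * n}" and "W2 = {S. \<bar>part_bias ({1..n} - X) S\<bar> > balance_tol * n}"
  define q where "q = (\<lambda>S. if S = {} \<or> S \<in> W1 \<or> S \<in> W2 then 0 else p S)"
  have p0: "0 \<le> p S" if "S \<in> P - {{}}" for S
    unfolding p_def using that n by (intro avg_funpow_nonneg) (auto simp: P_def)
  have pe: "p {} = 0"
  proof -
    have "(avg n ^^ t) F {} = F {}" for t F using n by (induction t) (simp_all add: avg_empty)
    thus ?thesis using X by (auto simp: p_def indicator_def)
  qed
  have psum: "(\<Sum>S\<in>P. p S) = 1"
  proof -
    have "(\<Sum>S\<in>P. p S) = (\<Sum>S\<in>P. indicator {X} S)" unfolding p_def P_def by (rule sum_avg_funpow[OF n])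
    thus ?thesis using X by (simp add: P_def indicator_def)
  qed
  have qp: "q S \<le> p S" "0 \<le> q S" if "S \<in> P" for S
    using p0[of S] pe that by (cases "S = {}"; simp add: q_def)+
  have q: "dens n (density_bound n) q"
    unfolding dens_def
  proof (intro conjI ballI)
    fix S assume S: "S \<in> Pow {1..n}"
    show "0 \<le> q S" using qp S by (simp add: P_def)
    show "q S \<le> density_bound n / 2 ^ n"
    proof (cases "S = {} \<or> S \<in> W1 \<or> S \<in> W2")
      case False
      thus ?thesis unfolding q_def p_def using S
        by (simp only: if_False) (intro balanced_density_le[OF L X], auto simp: W1_def W2_def)
    qed (simp add: q_def density_bound_def)
  next
    show "(\<Sum>S\<in>Pow {1..n}. q S) \<le> 1" using sum_mono[of P q p] qp psum by (simp add: P_def)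
  qed
  have prob: "(\<Sum>S\<in>P. p S * indicator W S) = (avg n ^^ (s + s')) (indicator W) X" for W
  proof -
    have "(\<Sum>S\<in>P. p S * indicator W S) = (\<Sum>S\<in>P. indicator {X} S * (avg n ^^ (s + s')) (indicator W) S)"
      unfolding P_def p_def by (rule avg_funpow_selfadjoint[symmetric])
    also have "\<dots> = (\<Sum>S\<in>P. if S = X then (avg n ^^ (s + s')) (indicator W) S else 0)"
      by (intro sum.cong) auto
    also have "\<dots> = (avg n ^^ (s + s')) (indicator W) X" using X by (simp add: P_def)
    finally show ?thesis .
  qed
  define b where "b = (exp (- 4 * e * s' / n) + 4 / (e * n) + 14 * sqrt e) / balance_tol\<^sup>2"
  have "1 - (\<Sum>S\<in>P. q S) = (\<Sum>S\<in>P. p S - q S)" by (simp add: psum sum_subtractf)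
  also have "\<dots> \<le> (\<Sum>S\<in>P. p S * indicator W1 S + p S * indicator W2 S)"
  proof (rule sum_mono)
    fix S assume "S \<in> P"
    thus "p S - q S \<le> p S * indicator W1 S + p S * indicator W2 S"
      using p0[of S] pe by (cases "S = {}") (auto simp: q_def indicator_def)
  qed
  also have "\<dots> = (avg n ^^ (s + s')) (indicator W1) X + (avg n ^^ (s + s')) (indicator W2) X"
    by (simp only: sum.distrib prob)
  also have "\<dots> \<le> b + b" unfolding W1_def W2_def b_def
    using X by (intro add_mono prob_part_bias[OF n X _ e _ s]) (auto simp: balance_tol_def)
  finally have mass: "1 - (\<Sum>S\<in>Pow {1..n}. q S) \<le> 2 * b" by (simp add: P_def)
  have "real (card A) / (2 ^ n - 1) - (avg n ^^ ((s + s') + (t + n))) (indicator A) X \<le>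
    1 / 2 ^ n + (1 - (\<Sum>S\<in>Pow {1..n}. q S)) + sqrt (\<Sum>Y\<in>Pow {1..n} - {{}}. ((avg n ^^ (t + n)) (fourier n q) Y)\<^sup>2)"
    using qp by (intro tv_le_fourier[OF n q X A]) (auto simp: p_def P_def)
  also have "\<dots> \<le> 1 / 2 ^ n + 2 * b + sqrt (2 * (n * solrate n (2 * t) + 2 * real t * (1 / 6) ^ (n div 48 - 1) * (65 / 64) ^ n) + 2 * high_bound n)"
    using mass fourier_mass_bound[OF L q small] by (intro add_mono real_sqrt_le_mono) auto
  finally show "real (card A) / (2 ^ n - 1) - (avg n ^^ ((s + s') + (t + n))) (indicator A) X \<le> 1 / 2 ^ n +
    2 * ((exp (- 4 * e * s' / n) + 4 / (e * n) + 14 * sqrt e) / balance_tol\<^sup>2) +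
    sqrt (2 * (n * solrate n (2 * t) + 2 * real t * (1 / 6) ^ (n div 48 - 1) * (65 / 64) ^ n) + 2 * high_bound n)"
    by (simp only: b_def)
qed

section \<open>Choice of the times and passage to the limit\<close>

lemma worst_dist_real_upper:
  assumes \<alpha>: "\<alpha> \<ge> 4" and e: "0 < e" "e \<le> 1 / 4"
  shows "eventually (\<lambda>n. worst_dist_real n (3 / 2 * real n * ln (real n) + \<alpha> * real n) \<le>
    2 * ((exp (1 - e * \<alpha>) + 15 * sqrt e) / balance_tol\<^sup>2) + exp (- \<alpha> / 4) + sqrt e) at_top"
proof -
  have "eventually (\<lambda>n. real n \<ge> 2 ^ 42) at_top" by real_asymp
  moreover note eventually_large
  moreover have "eventually (\<lambda>n. 1 / 2 ^ n + 8 / (e * real n) / balance_tol\<^sup>2 < 2 * sqrt e / balance_tol\<^sup>2) at_top"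
    using e by (simp add: balance_tol_def) real_asymp
  moreover have "eventually (\<lambda>n. 4 * e / real n \<le> 1) at_top" by real_asymp
  moreover have "eventually (\<lambda>n. 2 / real n + 8 * (real n * ln n + \<alpha> * n / 2) / (real n)\<^sup>2 \<le> 1) at_top"
    by real_asymp
  moreover have "eventually (\<lambda>n. 2 * (2 * (real n * ln n / 2 + \<alpha> * n / 4) * (9 * exp (- (real n / 48))) * exp (real n / 64)) + 2 * high_bound n \<le> e) at_top"
    unfolding high_bound_def density_bound_def using e by real_asymp
  ultimately show ?thesis
  proof eventually_elim
    case (elim n)
    define T where "T = nat \<lfloor>3 / 2 * real n * ln (real n) + \<alpha> * real n\<rfloor>"
    define s' where "s' = nat \<lfloor>\<alpha> * n / 4\<rfloor>"
    define t where "t = nat \<lfloor>real n * ln n / 2 + \<alpha> * n / 4\<rfloor>"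
    \<comment> \<open>\<open>s\<close> receives what is left; because \<alpha> is at least 4, this
      is at least \<open>n * ln n\<close> in spite of the rounding.\<close>
    define s where "s = T - (s' + t + n)"
    have n: "real n \<ge> 2 ^ 42" using elim(1) .
    have n0: "real n > 0" and n1: "real n \<ge> 1" using n by simp_all
    have ln0: "ln (real n) \<ge> 0" using n by simp
    have s': "real s' \<le> \<alpha> * n / 4" "\<alpha> * n / 4 - 1 \<le> real s'"
      unfolding s'_def using \<alpha> by (intro nat_floor_bounds; simp)+
    have t: "real t \<le> real n * ln n / 2 + \<alpha> * n / 4" "real n * ln n / 2 + \<alpha> * n / 4 - 1 \<le> real t"
      unfolding t_def using \<alpha> ln0 by (intro nat_floor_bounds; simp)+
    have T: "3 / 2 * real n * ln n + \<alpha> * n - 1 \<le> real T"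
      unfolding T_def using \<alpha> ln0 by (intro nat_floor_bounds) simp
    have \<alpha>n: "4 * real n \<le> \<alpha> * n" using \<alpha> by (intro mult_right_mono) auto
    define x where "x = real n * ln n"
    have x: "0 \<le> x" "3 / 2 * real n * ln n = x + x / 2" using ln0 by (auto simp: x_def)
    have le: "real s' + real t + real n + real n * ln n \<le> real T"
      using s'(1) t(1) T \<alpha>n x(1) n1 unfolding x(2) x_def[symmetric] by linarith
    hence "s' + t + n \<le> T" using x(1) unfolding x_def by linarith
    hence sT: "T = (s + s') + (t + n)" "real s = real T - (real s' + real t + real n)"
      by (auto simp: s_def of_nat_diff)
    have s: "real n * ln n \<le> real s" using le sT(2) by linarith
    have solrate: "n * solrate n (2 * t) \<le> exp (- \<alpha> / 2) / 2"
    proof -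
      have "solrate n (2 * t) \<le> 1 / 6 * exp (- real (2 * t) / n + 8 * real (2 * t) / (real n)\<^sup>2)"
        using n by (intro solrate_le) simp
      also have "\<dots> \<le> 1 / 6 * exp (1 - ln n - \<alpha> / 2)"
      proof -
        have "- real (2 * t) / n \<le> - (real n * ln n + \<alpha> * n / 2 - 2) / n"
          using t(2) n0 by (intro divide_right_mono) auto
        also have "\<dots> = - ln n - \<alpha> / 2 + 2 / n" using n0 by (simp add: field_simps)
        finally have 1: "- real (2 * t) / n \<le> - ln n - \<alpha> / 2 + 2 / n" .
        have 2: "8 * real (2 * t) / (real n)\<^sup>2 \<le> 8 * (real n * ln n + \<alpha> * n / 2) / (real n)\<^sup>2"
          using t(1) by (intro divide_right_mono) auto
        show ?thesis using 1 2 elim(5) by simp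
      qed
      also have "exp (1 - ln n - \<alpha> / 2) = exp 1 * exp (- \<alpha> / 2) / n"
      proof -
        have "1 - ln (real n) - \<alpha> / 2 = (1 + - \<alpha> / 2) - ln n" by simp
        thus ?thesis using n0 by (simp only: exp_diff exp_add exp_ln)
      qed
      also have "1 / 6 * (exp 1 * exp (- \<alpha> / 2) / n) \<le> 1 / 6 * (3 * exp (- \<alpha> / 2) / n)"
        using exp_le by (intro mult_left_mono divide_right_mono mult_right_mono) auto
      finally show ?thesis using n0 by (simp add: field_simps)
    qed
    have small: "n * solrate n (2 * t) \<le> 4"
    proof -
      have "exp (- \<alpha> / 2) \<le> 1" using \<alpha> by simp
      thus ?thesis using solrate by linarith
    qed
    \<comment> \<open>\<open>n div 48 - 1\<close> falls short of \<open>n / 48\<close> by at most 2,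
      and 9 bounds exp 2. The product decays since 1/48 exceeds 1/64.\<close>
    have E: "2 * real t * (1 / 6) ^ (n div 48 - 1) * (65 / 64) ^ n \<le>
      2 * (real n * ln n / 2 + \<alpha> * n / 4) * (9 * exp (- (real n / 48))) * exp (real n / 64)"
    proof (intro mult_mono)
      have "(1 / 6 :: real) \<le> exp (- 1)" using exp_le by (simp add: exp_minus field_simps)
      hence "(1 / 6 :: real) ^ (n div 48 - 1) \<le> exp (- 1) ^ (n div 48 - 1)" by (intro power_mono) auto
      also have "\<dots> = exp (- real (n div 48 - 1))" by (simp add: exp_of_nat_mult[symmetric])
      also have "\<dots> \<le> exp (2 + - (real n / 48))"
        using nat_div_bounds(2)[of 48 n] by simp linarith?
      also have "\<dots> = exp 1 * exp 1 * exp (- (real n / 48))" by (simp add: exp_add[symmetric])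
      also have "\<dots> \<le> 3 * 3 * exp (- (real n / 48))" using exp_le by (intro mult_right_mono mult_mono) auto
      finally show "(1 / 6 :: real) ^ (n div 48 - 1) \<le> 9 * exp (- (real n / 48))" by simp
      have "(65 / 64 :: real) ^ n \<le> exp (1 / 64) ^ n" using exp_ge_add_one_self[of "1 / 64 :: real"] by (intro power_mono) auto
      thus "(65 / 64 :: real) ^ n \<le> exp (real n / 64)" by (simp add: exp_of_nat_mult[symmetric])
    qed (use t \<alpha> ln0 in auto)
    have "sqrt (2 * (n * solrate n (2 * t) + 2 * real t * (1 / 6) ^ (n div 48 - 1) * (65 / 64) ^ n) + 2 * high_bound n)
      \<le> sqrt (exp (- \<alpha> / 2) + e)"
    proof (rule real_sqrt_le_mono)
      have "2 * (a + b) + 2 * h \<le> x + e" if "b \<le> b'" "a \<le> x / 2" "2 * b' + 2 * h \<le> e" for a b b' h x :: real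
        using that by argo
      from this[OF E solrate elim(6)]
      show "2 * (n * solrate n (2 * t) + 2 * real t * (1 / 6) ^ (n div 48 - 1) * (65 / 64) ^ n) + 2 * high_bound n
        \<le> exp (- \<alpha> / 2) + e" .
    qed
    also have "\<dots> \<le> sqrt (exp (- \<alpha> / 2)) + sqrt e" using e by (intro sqrt_add_le_add_sqrt) auto
    also have "sqrt (exp (- \<alpha> / 2)) = exp (- \<alpha> / 4)"
      by (rule real_sqrt_unique) (simp_all add: exp_double[symmetric])
    finally have 1: "sqrt (2 * (n * solrate n (2 * t) + 2 * real t * (1 / 6) ^ (n div 48 - 1) * (65 / 64) ^ n) + 2 * high_bound n)
      \<le> exp (- \<alpha> / 4) + sqrt e" .
    have 2: "exp (- 4 * e * s' / n) \<le> exp (1 - e * \<alpha>)"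
    proof -
      have "- 4 * e * s' / n \<le> - 4 * e * (\<alpha> * n / 4 - 1) / n"
        using s'(2) e n0 by (intro divide_right_mono) auto
      also have "\<dots> = 4 * e / n - e * \<alpha>" using n0 by (simp add: field_simps)
      finally show ?thesis using elim(4) by simp
    qed
    have "worst_dist n T \<le> 1 / 2 ^ n + 2 * ((exp (- 4 * e * s' / n) + 4 / (e * n) + 14 * sqrt e) / balance_tol\<^sup>2) +
      sqrt (2 * (n * solrate n (2 * t) + 2 * real t * (1 / 6) ^ (n div 48 - 1) * (65 / 64) ^ n) + 2 * high_bound n)"
      unfolding sT(1) by (rule worst_dist_upper[OF elim(2) e s small])
    also have "\<dots> \<le> 1 / 2 ^ n + 2 * ((exp (1 - e * \<alpha>) + 4 / (e * n) + 14 * sqrt e) / balance_tol\<^sup>2) + (exp (- \<alpha> / 4) + sqrt e)"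
      using 1 2 e by (intro add_mono mult_left_mono divide_right_mono) auto
    also have "\<dots> = (1 / 2 ^ n + 8 / (e * real n) / balance_tol\<^sup>2) + 2 * ((exp (1 - e * \<alpha>) + 14 * sqrt e) / balance_tol\<^sup>2) + (exp (- \<alpha> / 4) + sqrt e)"
      by (simp add: add_divide_distrib)
    also have "\<dots> \<le> 2 * sqrt e / balance_tol\<^sup>2 + 2 * ((exp (1 - e * \<alpha>) + 14 * sqrt e) / balance_tol\<^sup>2) + (exp (- \<alpha> / 4) + sqrt e)"
      using elim(3) by (intro add_right_mono) simp
    also have "\<dots> = 2 * ((exp (1 - e * \<alpha>) + 15 * sqrt e) / balance_tol\<^sup>2) + exp (- \<alpha> / 4) + sqrt e"
      by (simp add: add_divide_distrib)
    finally show ?case by (simp add: worst_dist_real_def T_def)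
  qed
qed

lemma cutoff_upper:
  "((\<lambda>\<alpha>::real. limsup (\<lambda>n. ereal (worst_dist_real n (3 / 2 * real n * ln (real n) + \<alpha> * real n)))) \<longlongrightarrow> 0) at_top"
proof (rule order_tendstoI)
  fix a :: ereal assume a: "a < 0"
  have "0 \<le> limsup (\<lambda>n. ereal (worst_dist_real n (3 / 2 * real n * ln (real n) + \<alpha> * real n)))" for \<alpha>
  proof -
    have "eventually (\<lambda>n. 0 \<le> ereal (worst_dist_real n (3 / 2 * real n * ln (real n) + \<alpha> * real n))) at_top"
      using eventually_ge_at_top[of "2::nat"]
      by eventually_elim (simp add: worst_dist_real_def worst_dist_nonneg)
    hence "0 \<le> liminf (\<lambda>n. ereal (worst_dist_real n (3 / 2 * real n * ln (real n) + \<alpha> * real n)))"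
      by (rule Liminf_bounded)
    thus ?thesis by (rule order_trans[OF _ Liminf_le_Limsup[OF sequentially_bot]])
  qed
  thus "\<forall>\<^sub>F \<alpha> in at_top. a < limsup (\<lambda>n. ereal (worst_dist_real n (3 / 2 * real n * ln (real n) + \<alpha> * real n)))"
    using a by (intro always_eventually allI) (rule less_le_trans)
next
  fix a :: ereal assume "0 < a"
  then obtain c where c: "0 < ereal c" "ereal c < a" by (metis ereal_dense2 zero_ereal_def)
  \<comment> \<open>The total coefficient of \<open>sqrt e\<close> left in the bound as \<alpha>
    tends to infinity; \<open>e\<close> is chosen to make \<open>C * sqrt e\<close> at most
    \<open>c / 2\<close>.\<close>
  define C where "C = 30 / balance_tol\<^sup>2 + 1"
  have C: "C > 0" unfolding C_def by (intro add_nonneg_pos divide_nonneg_nonneg) auto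
  define e where "e = min (1 / 4) ((c / (2 * C))\<^sup>2)"
  have c0: "c > 0" using c by simp
  have e: "0 < e" "e \<le> 1 / 4" using c0 C by (auto simp: e_def)
  have "sqrt e \<le> sqrt ((c / (2 * C))\<^sup>2)" by (intro real_sqrt_le_mono) (simp add: e_def)
  also have "\<dots> = c / (2 * C)" using c0 C by simp
  finally have "C * sqrt e \<le> C * (c / (2 * C))" using C by (intro mult_left_mono) auto
  hence Ce: "C * sqrt e < c" using C c0 by simp
  define g where "g = (\<lambda>\<alpha>::real. 2 * ((exp (1 - e * \<alpha>) + 15 * sqrt e) / balance_tol\<^sup>2) + exp (- \<alpha> / 4) + sqrt e)"
  have "(g \<longlongrightarrow> 2 * ((0 + 15 * sqrt e) / balance_tol\<^sup>2) + 0 + sqrt e) at_top"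
    unfolding g_def
  proof (intro tendsto_intros)
    show "((\<lambda>\<alpha>. exp (1 - e * \<alpha>)) \<longlongrightarrow> 0) at_top" using e by real_asymp
    show "((\<lambda>\<alpha>::real. exp (- \<alpha> / 4)) \<longlongrightarrow> 0) at_top" by real_asymp
  qed (simp add: balance_tol_def)
  moreover have "2 * ((0 + 15 * sqrt e) / balance_tol\<^sup>2) + 0 + sqrt e < c" using Ce by (simp add: C_def algebra_simps)
  ultimately have "eventually (\<lambda>\<alpha>. g \<alpha> < c) at_top" by (rule order_tendstoD)
  with eventually_ge_at_top[of 4]
  show "\<forall>\<^sub>F \<alpha> in at_top. limsup (\<lambda>n. ereal (worst_dist_real n (3 / 2 * real n * ln (real n) + \<alpha> * real n))) < a"
  proof eventually_elim
    case (elim \<alpha>)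
    have "eventually (\<lambda>n. ereal (worst_dist_real n (3 / 2 * real n * ln (real n) + \<alpha> * real n)) \<le> ereal (g \<alpha>)) at_top"
      using worst_dist_real_upper[OF elim(1) e]
      by eventually_elim (use exp_ge_zero[of "- \<alpha> / 4"] in \<open>simp add: g_def\<close>)
    hence "limsup (\<lambda>n. ereal (worst_dist_real n (3 / 2 * real n * ln (real n) + \<alpha> * real n))) \<le> ereal (g \<alpha>)"
      by (rule Limsup_bounded)
    also have "\<dots> < ereal c" using elim by simp
    finally show ?case using c(2) by (rule less_trans)
  qed
qed

theorem theorem1:
  "((\<lambda>\<alpha>::real. liminf (\<lambda>n. ereal (worst_dist_real n (3 / 2 * real n * ln (real n) - \<alpha> * real n))))
      \<longlongrightarrow> 1) at_top
   \<and> ((\<lambda>\<alpha>::real. limsup (\<lambda>n. ereal (worst_dist_real n (3 / 2 * real n * ln (real n) + \<alpha> * real n))))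
      \<longlongrightarrow> 0) at_top"
  using cutoff_lower cutoff_upper by blast

end
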